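(* Let $G=(V,E)$ be a simple undirected graph with $m=|E|$ that has a perfect matching, let $c\in\mathbb{Z}^E$ be integer edge costs and $\sigma:E\to\{1,\dots,m\}$ a bijection. Then the Unperturbed C-P-Matching Algorithm on input $(G,c,\sigma)$ terminates and returns the incidence vector of a minimum-cost perfect matching of $G$ with respect to $c$.
   Context: Notation: $\delta(S)$ is the set of edges with exactly one endpoint in $S\subseteq V$; $x(T)=\sum_{e\in T}x(e)$; $\mathscr{V}=\{\{v\}:v\in V\}$; $\operatorname{supp}(x)=\{e:x(e)\neq0\}$. For a laminar family $\mathscr{F}$ of odd subsets of $V$, $P_{\mathscr{F}}(G,c)$ is the LP: minimize $\sum_e c(e)x(e)$ s.t. $x(\delta(u))=1$ for all $u\in V$, $x(\delta(S))\ge1$ for all $S\in\mathscr{F}$, $x\ge0$. Unperturbed C-P-Matching Algorithm (input $G,c,\sigma$): define $c_0=c$ and for $1\le i\le m$, $c_i(e)=1$ if $\sigma(e)=i$ and $0$ otherwise. Set $\mathscr{F}\leftarrow\emptyset$, $\Gamma_0,\dots,\Gamma_m\leftarrow0$ (vectors indexed by sets, zero where undefined). Repeat: (1) let $x$ be the lexicographically-minimal optimal solution of $P_{\mathscr{F}}(G,c)$ with respect to $\sigma$ (among optimal solutions minimize $x(\sigma^{-1}(1))$, then subject to that $x(\sigma^{-1}(2))$, etc.); (2) $\mathscr{F}_x\leftarrow\{S\in\mathscr{F}:x(\delta(S))=1\}$, $L,M,N,Q\leftarrow\emptyset$; (3) for $i=0,\dots,m$: find an optimal $(r,\Pi)$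 of the LP $D^i$: minimize $\sum_{S\in\mathscr{V}\cup\mathscr{F}_x}\frac{1}{|S|}r(S)$ s.t. $r(S)+\Pi(S)\ge\Gamma_i(S)$ for $S\in(\mathscr{V}\cup\mathscr{F}_x)\setminus L$; $-r(S)+\Pi(S)\le\Gamma_i(S)$ for $S\in(\mathscr{V}\cup\mathscr{F}_x)\setminus M$; $\sum_{S\in\mathscr{V}\cup\mathscr{F}_x:uv\in\delta(S)}\Pi(S)=c_i(uv)$ for $uv\in\operatorname{supp}(x)$; $\sum_{S\in\mathscr{V}\cup\mathscr{F}_x:uv\in\delta(S)}\Pi(S)\le c_i(uv)$ for $uv\notin\operatorname{supp}(x)\cup N$; $\Pi(S)\ge0$ for $S\in\mathscr{F}_x\setminus Q$; then $L\leftarrow L\cup\{S:r(S)+\Pi(S)\ne\Gamma_i(S)\}$, $M\leftarrow M\cup\{S:-r(S)+\Pi(S)\ne\Gamma_i(S)\}$, $N\leftarrow N\cup\{uv\in E:\sum_{S:uv\in\delta(S)}\Pi(S)\ne c_i(uv)\}$, $Q\leftarrow Q\cup\{S\in\mathscr{F}_x:\Pi(S)\ne0\}$, $D_i\leftarrow\Pi$ (zero on $\mathscr{F}\setminus\mathscr{F}_x$); (4) $\mathscr{H}'\leftarrow\{S\in\mathscr{F}:D_i(S)>0\text{ for some }i\}$; for each odd cycle $C$ in $\operatorname{supp}(x)$ let $\hat C$ be $V(C)$ together with all sets of $\mathscr{H}'$ intersecting it; $\mathscr{H}''\leftarrow\{\hat C\}$; $\mathscr{F}\leftarrow\mathscr{H}'\cup\mathscr{H}''$;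 $\Gamma_i\leftarrow D_i$ for all $i$; until $x$ integral; return $x$. *)

theory Defs
  imports Complex_Main
begin

definition simple_graph :: "'v set \<Rightarrow> 'v set set \<Rightarrow> bool" where
  "simple_graph V E \<longleftrightarrow> finite V \<and> (\<forall>e\<in>E. e \<subseteq> V \<and> card e = 2)"

definition perfect_matching :: "'v set \<Rightarrow> 'v set set \<Rightarrow> 'v set set \<Rightarrow> bool" where
  "perfect_matching V E A \<longleftrightarrow> A \<subseteq> E \<and> (\<forall>v\<in>V. \<exists>!e. e \<in> A \<and> v \<in> e)"

definition min_cost_perfect_matching ::
  "'v set \<Rightarrow> 'v set set \<Rightarrow> ('v set \<Rightarrow> int) \<Rightarrow> 'v set set \<Rightarrow> bool" where
  "min_cost_perfect_matching V E c A \<longleftrightarrow>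
     is_arg_min (\<lambda>B. \<Sum>e\<in>B. c e) (perfect_matching V E) A"

definition incidence_vector :: "'v set set \<Rightarrow> 'v set \<Rightarrow> real" where
  "incidence_vector A e = (if e \<in> A then 1 else 0)"

definition edge_cut :: "'v set set \<Rightarrow> 'v set \<Rightarrow> 'v set set" where
  "edge_cut E S = {e \<in> E. card (e \<inter> S) = 1}"

definition singletons :: "'v set \<Rightarrow> 'v set set" where
  "singletons V = {{v} | v. v \<in> V}"

definition supp :: "'v set set \<Rightarrow> ('v set \<Rightarrow> real) \<Rightarrow> 'v set set" where
  "supp E x = {e \<in> E. x e \<noteq> 0}"

definition laminar :: "'v set set \<Rightarrow> bool" where
  "laminar \<F> \<longleftrightarrow> (\<forall>A\<in>\<F>. \<forall>B\<in>\<F>. A \<subseteq> B \<or> B \<subseteq> A \<or> A \<inter> B = {})"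

definition laminar_odd_family :: "'v set \<Rightarrow> 'v set set \<Rightarrow> bool" where
  "laminar_odd_family V \<F> \<longleftrightarrow> laminar \<F> \<and> (\<forall>S\<in>\<F>. S \<subseteq> V \<and> odd (card S))"


subsection \<open>The primal linear program\<close>

text \<open>A vector in \<open>\<real>\<^sup>E\<close> is a function on sets that vanishes outside \<open>E\<close>.\<close>

definition P_feasible ::
  "'v set \<Rightarrow> 'v set set \<Rightarrow> 'v set set \<Rightarrow> ('v set \<Rightarrow> real) \<Rightarrow> bool" where
  "P_feasible V E \<F> x \<longleftrightarrow>
     (\<forall>e. e \<notin> E \<longrightarrow> x e = 0) \<and>
     (\<forall>u\<in>V. (\<Sum>e\<in>edge_cut E {u}. x e) = 1) \<and>
     (\<forall>S\<in>\<F>. (\<Sum>e\<in>edge_cut E S. x e) \<ge> 1) \<and>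
     (\<forall>e\<in>E. x e \<ge> 0)"

definition P_optimal ::
  "'v set \<Rightarrow> 'v set set \<Rightarrow> ('v set \<Rightarrow> int) \<Rightarrow> 'v set set \<Rightarrow> ('v set \<Rightarrow> real) \<Rightarrow> bool" where
  "P_optimal V E c \<F> =
     is_arg_min (\<lambda>x. \<Sum>e\<in>E. of_int (c e) * x e) (P_feasible V E \<F>)"

text \<open>\<open>P_lex_optimal V E c \<sigma> \<F> k x\<close>: among the optimal solutions, \<open>x\<close> successively minimizes its
  values at the edges \<open>\<sigma>\<^sup>-\<^sup>1(1), \<dots>, \<sigma>\<^sup>-\<^sup>1(k)\<close>.\<close>

primrec P_lex_optimal ::
  "'v set \<Rightarrow> 'v set set \<Rightarrow> ('v set \<Rightarrow> int) \<Rightarrow> ('v set \<Rightarrow> nat) \<Rightarrow> 'v set set \<Rightarrow> nat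
     \<Rightarrow> ('v set \<Rightarrow> real) \<Rightarrow> bool" where
  "P_lex_optimal V E c \<sigma> \<F> 0 = P_optimal V E c \<F>"
| "P_lex_optimal V E c \<sigma> \<F> (Suc k) =
     is_arg_min (\<lambda>x. x (inv_into E \<sigma> (Suc k))) (P_lex_optimal V E c \<sigma> \<F> k)"

definition lex_min_optimal ::
  "'v set \<Rightarrow> 'v set set \<Rightarrow> ('v set \<Rightarrow> int) \<Rightarrow> ('v set \<Rightarrow> nat) \<Rightarrow> 'v set set
     \<Rightarrow> ('v set \<Rightarrow> real) \<Rightarrow> bool" where
  "lex_min_optimal V E c \<sigma> \<F> x \<longleftrightarrow> P_lex_optimal V E c \<sigma> \<F> (card E) x"


subsection \<open>The dual linear programs\<close>

definition level_cost ::
  "('v set \<Rightarrow> int) \<Rightarrow> ('v set \<Rightarrow> nat) \<Rightarrow> nat \<Rightarrow> 'v set \<Rightarrow> real" where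
  "level_cost c \<sigma> i e =
     (if i = 0 then of_int (c e) else if \<sigma> e = i then 1 else 0)"

definition tight_sets ::
  "'v set set \<Rightarrow> 'v set set \<Rightarrow> ('v set \<Rightarrow> real) \<Rightarrow> 'v set set" where
  "tight_sets E \<F> x = {S \<in> \<F>. (\<Sum>e\<in>edge_cut E S. x e) = 1}"

definition dual_index ::
  "'v set \<Rightarrow> 'v set set \<Rightarrow> 'v set set \<Rightarrow> ('v set \<Rightarrow> real) \<Rightarrow> 'v set set" where
  "dual_index V E \<F> x = singletons V \<union> tight_sets E \<F> x"

definition dual_load ::
  "'v set \<Rightarrow> 'v set set \<Rightarrow> 'v set set \<Rightarrow> ('v set \<Rightarrow> real) \<Rightarrow> ('v set \<Rightarrow> real) \<Rightarrow> 'v set \<Rightarrow> real" where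
  "dual_load V E \<F> x \<Pi> e = (\<Sum>S | S \<in> dual_index V E \<F> x \<and> e \<in> edge_cut E S. \<Pi> S)"

text \<open>Below, \<open>\<gamma>\<close> is the vector \<open>\<Gamma>\<^sub>i\<close> and \<open>w\<close> the cost vector \<open>c\<^sub>i\<close>. Only the values of \<open>r\<close> and
  \<open>\<Pi>\<close> on \<open>dual_index V E \<F> x\<close> matter.\<close>

definition D_feasible ::
  "'v set \<Rightarrow> 'v set set \<Rightarrow> 'v set set \<Rightarrow> ('v set \<Rightarrow> real) \<Rightarrow> ('v set \<Rightarrow> real) \<Rightarrow> ('v set \<Rightarrow> real)
     \<Rightarrow> 'v set set \<Rightarrow> 'v set set \<Rightarrow> 'v set set \<Rightarrow> 'v set set
     \<Rightarrow> ('v set \<Rightarrow> real) \<times> ('v set \<Rightarrow> real) \<Rightarrow> bool" where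
  "D_feasible V E \<F> x w \<gamma> L M N Q = (\<lambda>(r, \<Pi>).
     (\<forall>S \<in> dual_index V E \<F> x - L. r S + \<Pi> S \<ge> \<gamma> S) \<and>
     (\<forall>S \<in> dual_index V E \<F> x - M. - r S + \<Pi> S \<le> \<gamma> S) \<and>
     (\<forall>e \<in> supp E x. dual_load V E \<F> x \<Pi> e = w e) \<and>
     (\<forall>e \<in> E - (supp E x \<union> N). dual_load V E \<F> x \<Pi> e \<le> w e) \<and>
     (\<forall>S \<in> tight_sets E \<F> x - Q. \<Pi> S \<ge> 0))"

definition D_optimal ::
  "'v set \<Rightarrow> 'v set set \<Rightarrow> 'v set set \<Rightarrow> ('v set \<Rightarrow> real) \<Rightarrow> ('v set \<Rightarrow> real) \<Rightarrow> ('v set \<Rightarrow> real)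
     \<Rightarrow> 'v set set \<Rightarrow> 'v set set \<Rightarrow> 'v set set \<Rightarrow> 'v set set
     \<Rightarrow> ('v set \<Rightarrow> real) \<times> ('v set \<Rightarrow> real) \<Rightarrow> bool" where
  "D_optimal V E \<F> x w \<gamma> L M N Q =
     is_arg_min (\<lambda>(r, \<Pi>). \<Sum>S\<in>dual_index V E \<F> x. 1 / real (card S) * r S)
       (D_feasible V E \<F> x w \<gamma> L M N Q)"


subsection \<open>Updating the family of cuts\<close>

text \<open>A cycle is given by the list of its vertices in cyclic order.\<close>

definition is_cycle :: "'v set set \<Rightarrow> 'v list \<Rightarrow> bool" where
  "is_cycle A vs \<longleftrightarrow> length vs \<ge> 3 \<and> distinct vs \<and>
     (\<forall>i < length vs. {vs ! i, vs ! (Suc i mod length vs)} \<in> A)"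

definition positive_sets ::
  "nat \<Rightarrow> 'v set set \<Rightarrow> (nat \<Rightarrow> 'v set \<Rightarrow> real) \<Rightarrow> 'v set set" where
  "positive_sets m \<F> D = {S \<in> \<F>. \<exists>i\<le>m. D i S > 0}"

definition cycle_hull :: "'v set set \<Rightarrow> 'v list \<Rightarrow> 'v set" where
  "cycle_hull \<H> vs = set vs \<union> \<Union>{S \<in> \<H>. S \<inter> set vs \<noteq> {}}"

definition cycle_sets ::
  "'v set set \<Rightarrow> ('v set \<Rightarrow> real) \<Rightarrow> 'v set set \<Rightarrow> 'v set set" where
  "cycle_sets E x \<H> =
     {cycle_hull \<H> vs | vs. is_cycle (supp E x) vs \<and> odd (length vs)}"

definition next_family ::
  "'v set set \<Rightarrow> 'v set set \<Rightarrow> ('v set \<Rightarrow> real) \<Rightarrow> (nat \<Rightarrow> 'v set \<Rightarrow> real) \<Rightarrow> 'v set set" where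
  "next_family E \<F> x D =
     (let \<H>' = positive_sets (card E) \<F> D in \<H>' \<union> cycle_sets E x \<H>')"

definition integral_vector :: "'v set set \<Rightarrow> ('v set \<Rightarrow> real) \<Rightarrow> bool" where
  "integral_vector E x \<longleftrightarrow> (\<forall>e\<in>E. x e \<in> \<int>)"


subsection \<open>The algorithm as a transition system\<close>

text \<open>Configurations:
  \<^item> \<open>Outer \<F> \<Gamma>\<close>: at the beginning of the body of the repeat loop;
  \<^item> \<open>Inner \<F> \<Gamma> x i L M N Q D\<close>: in the for loop, with the duals of levels below \<open>i\<close> computed;
  \<^item> \<open>Returned x\<close>: halted with output \<open>x\<close>.

  The choice of an optimal solution \<open>(r, \<Pi>)\<close> is nondeterministic. The program \<open>P\<^sub>\<F>(G,c)\<close> is defined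
  for laminar families of odd sets only, so an \<open>Outer\<close> configuration with any other family has no
  successor; likewise a configuration in which a linear program to be solved has no optimum. Such
  dead ends are not of the form \<open>Returned x\<close> and thus count as failure.\<close>

datatype 'v config =
    Outer "'v set set" "nat \<Rightarrow> 'v set \<Rightarrow> real"
  | Inner "'v set set" "nat \<Rightarrow> 'v set \<Rightarrow> real" "'v set \<Rightarrow> real" nat
      "'v set set" "'v set set" "'v set set" "'v set set" "nat \<Rightarrow> 'v set \<Rightarrow> real"
  | Returned "'v set \<Rightarrow> real"

inductive cpm_step ::
  "'v set \<Rightarrow> 'v set set \<Rightarrow> ('v set \<Rightarrow> int) \<Rightarrow> ('v set \<Rightarrow> nat) \<Rightarrow> 'v config \<Rightarrow> 'v config \<Rightarrow> bool"
  for V E c \<sigma> where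
  solve_primal:
    "\<lbrakk> laminar_odd_family V \<F>; lex_min_optimal V E c \<sigma> \<F> x \<rbrakk> \<Longrightarrow>
     cpm_step V E c \<sigma> (Outer \<F> \<Gamma>) (Inner \<F> \<Gamma> x 0 {} {} {} {} (\<lambda>_ _. 0))"
| solve_dual:
    "\<lbrakk> i \<le> card E;
       D_optimal V E \<F> x (level_cost c \<sigma> i) (\<Gamma> i) L M N Q (r, \<Pi>);
       L' = L \<union> {S \<in> dual_index V E \<F> x. r S + \<Pi> S \<noteq> \<Gamma> i S};
       M' = M \<union> {S \<in> dual_index V E \<F> x. - r S + \<Pi> S \<noteq> \<Gamma> i S};
       N' = N \<union> {e \<in> E. dual_load V E \<F> x \<Pi> e \<noteq> level_cost c \<sigma> i e};
       Q' = Q \<union> {S \<in> tight_sets E \<F> x. \<Pi> S \<noteq> 0};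
       D' = D(i := (\<lambda>S. if S \<in> dual_index V E \<F> x then \<Pi> S else 0)) \<rbrakk> \<Longrightarrow>
     cpm_step V E c \<sigma> (Inner \<F> \<Gamma> x i L M N Q D) (Inner \<F> \<Gamma> x (Suc i) L' M' N' Q' D')"
| repeat_loop:
    "\<lbrakk> i > card E; \<not> integral_vector E x \<rbrakk> \<Longrightarrow>
     cpm_step V E c \<sigma> (Inner \<F> \<Gamma> x i L M N Q D) (Outer (next_family E \<F> x D) D)"
| return_solution:
    "\<lbrakk> i > card E; integral_vector E x \<rbrakk> \<Longrightarrow>
     cpm_step V E c \<sigma> (Inner \<F> \<Gamma> x i L M N Q D) (Returned x)"

definition cpm_init :: "'v config" where
  "cpm_init = Outer {} (\<lambda>_ _. 0)"

text \<open>Every execution is finite.\<close>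

definition cpm_terminates ::
  "'v set \<Rightarrow> 'v set set \<Rightarrow> ('v set \<Rightarrow> int) \<Rightarrow> ('v set \<Rightarrow> nat) \<Rightarrow> bool" where
  "cpm_terminates V E c \<sigma> \<longleftrightarrow>
     \<not> (\<exists>s :: nat \<Rightarrow> 'v config. s 0 = cpm_init \<and> (\<forall>k. cpm_step V E c \<sigma> (s k) (s (Suc k))))"

definition cpm_halts_in ::
  "'v set \<Rightarrow> 'v set set \<Rightarrow> ('v set \<Rightarrow> int) \<Rightarrow> ('v set \<Rightarrow> nat) \<Rightarrow> 'v config \<Rightarrow> bool" where
  "cpm_halts_in V E c \<sigma> s \<longleftrightarrow>
     (cpm_step V E c \<sigma>)\<^sup>*\<^sup>* cpm_init s \<and> (\<nexists>t. cpm_step V E c \<sigma> s t)"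

end

theory Submission
  imports Defs
begin

text \<open>
  The tuple of duals \<open>D\<^sub>0, \<dots>, D\<^sub>m\<close> is read lexicographically, level \<open>0\<close> being dominant. It
  certifies that \<open>x\<close> is lexicographically minimal already for the program whose cuts are the sets
  with nonzero dual, and any vector that is complementary to \<open>D\<close> has the same costs \<open>c\<^sub>0, \<dots>, c\<^sub>m\<close>
  as \<open>x\<close>, hence equals \<open>x\<close>.

  The invariant is that every set \<open>S\<close> of the family is factor-critical: for each \<open>u \<in> S\<close> the set
  \<open>S - {u}\<close> has a perfect matching of \<open>\<Gamma>\<close>-tight edges that meets every cut of the family inside \<open>S\<close>
  at most once. Extremality of \<open>D\<close> forces \<open>D = \<Gamma>\<close> inside each set with nonzero dual, so these sets
  are factor-critical with respect to \<open>D\<close>. Contracting them turns uniqueness of \<open>x\<close> into half-integrality,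
  and the support of \<open>x\<close> consists of single edges and cycles. The hull of an odd cycle is again
  an odd factor-critical set, is laminar with the remaining sets, and is not crossed by the support of \<open>x\<close>.

  Hence, as long as \<open>x\<close> is not integral, \<open>x\<close> violates a new cut, and the next optimum is
  lexicographically strictly larger. As there are only finitely many families, the algorithm stops,
  and an integral optimum of a relaxation is a minimum-cost perfect matching.
\<close>

section \<open>Linear inequalities\<close>

text \<open>The lexicographic order plays the part of a perturbation of the costs: a dual constraint
  that is strict at some level holds lexicographically whatever follows, so it is dropped, and
  \<open>L\<close>, \<open>M\<close>, \<open>N\<close>, \<open>Q\<close> record this. A run that
  meets a program without optimum counts as failure, so existence has to be proved at every level.
  Feasibility is where minimality of \<open>x\<close> enters, through Farkas' lemma. Boundedness is
  endangered by dropped constraints on \<open>r\<close>; it survives because a newly gained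
  recession direction is a feasible direction at the preceding optimum.

  Critical matchings are tight for the old duals \<open>\<Gamma>\<close>, whereas the structure of
  \<open>x\<close> has to be read off from the new \<open>D\<close>. The objective closes this gap:
  it charges the deviation of \<open>D\<close> from \<open>\<Gamma>\<close> at a set T at the rate
  1/|T|, so moving a discrepancy from proper subsets of S to S itself would always pay.

  Progress is weak duality: sets that leave the family carry zero dual, so \<open>D\<close> stays a
  certificate for the next program, and levels 1 to \<open>m\<close>, which read off single
  coordinates, turn equal costs into equal vectors.\<close>

inductive_set cone_of :: "(('a \<Rightarrow> real) \<times> real) set \<Rightarrow> (('a \<Rightarrow> real) \<times> real) set"
  for C where
  base: "p \<in> C \<Longrightarrow> p \<in> cone_of C"
| add: "(a, \<alpha>) \<in> cone_of C \<Longrightarrow> (b, \<beta>) \<in> cone_of C \<Longrightarrow> (\<lambda>i. a i + b i, \<alpha> + \<beta>) \<in> cone_of C"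
| scale: "(a, \<alpha>) \<in> cone_of C \<Longrightarrow> t \<ge> 0 \<Longrightarrow> (\<lambda>i. t * a i, t * \<alpha>) \<in> cone_of C"

text \<open>A pair \<open>(a, \<beta>)\<close> stands for the inequality with coefficients
  \<open>a\<close> and bound \<open>\<beta>\<close>, and the cone for its nonnegative consequences.
  Closure rules instead of explicit multipliers make this transitivity immediate, which is what
  iterated elimination needs.\<close>

lemma cone_of_subset_cone:
  assumes "p \<in> cone_of C'" "C' \<subseteq> cone_of C"
  shows "p \<in> cone_of C"
  using assms by (induction) (auto intro: cone_of.intros)

lemma cone_of_zero_coordinate:
  assumes "p \<in> cone_of C" "\<And>q. q \<in> C \<Longrightarrow> fst q i = 0"
  shows "fst p i = 0"
  using assms by (induction) auto

lemma between_finite_sets: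
  fixes L U :: "real set"
  assumes "finite L" "finite U" "\<And>l u. l \<in> L \<Longrightarrow> u \<in> U \<Longrightarrow> l \<le> u"
  shows "\<exists>t. (\<forall>l\<in>L. l \<le> t) \<and> (\<forall>u\<in>U. t \<le> u)"
proof (cases "L = {}")
  case True
  show ?thesis
  proof (cases "U = {}")
    case False
    then show ?thesis using True assms(2) by (intro exI[of _ "Min U"]) auto
  qed (use True in auto)
next
  case False
  then show ?thesis using assms by (intro exI[of _ "Max L"]) auto
qed

text \<open>By Fourier--Motzkin elimination of the variables of \<open>X\<close>, one at a time.\<close>

lemma farkas_cone:
  fixes C :: "(('a \<Rightarrow> real) \<times> real) set"
  assumes "finite X" "finite C"
  shows "(\<exists>x. \<forall>(a, \<beta>)\<in>C. (\<Sum>i\<in>X. a i * x i) \<le> \<beta>) \<or>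
         (\<exists>(a, \<beta>)\<in>cone_of C. (\<forall>i\<in>X. a i = 0) \<and> \<beta> < 0)"
  using assms
proof (induction X arbitrary: C rule: finite_induct)
  case empty
  then show ?case by (force intro: cone_of.base)
next
  case (insert i X)
  define Z P N where "Z = {q \<in> C. fst q i = 0}" and "P = {q \<in> C. fst q i > 0}"
    and "N = {q \<in> C. fst q i < 0}"
  \<comment> \<open>The two inequalities are rescaled so that their coefficients at \<open>i\<close>
    become 1 and -1 and cancel.\<close>
  define comb where "comb = (\<lambda>p q :: ('a \<Rightarrow> real) \<times> real.
    (\<lambda>j. (1 / fst p i) * fst p j + (1 / (- fst q i)) * fst q j,
     (1 / fst p i) * snd p + (1 / (- fst q i)) * snd q))"
  define C' where "C' = Z \<union> (\<lambda>(p, q). comb p q) ` (P \<times> N)"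
  have finC': "finite C'"
    unfolding C'_def Z_def P_def N_def using insert.prems by auto
  have C'_zero: "fst q i = 0" if "q \<in> C'" for q
    using that unfolding C'_def Z_def P_def N_def comb_def by auto
  have C'_sub: "C' \<subseteq> cone_of C"
  proof
    fix q assume "q \<in> C'"
    then consider "q \<in> Z" | p n where "p \<in> P" "n \<in> N" "q = comb p n"
      unfolding C'_def by auto
    then show "q \<in> cone_of C"
    proof cases
      case 1
      then show ?thesis unfolding Z_def by (auto intro: cone_of.base)
    next
      case 2
      have p: "(fst p, snd p) \<in> cone_of C" and n: "(fst n, snd n) \<in> cone_of C"
        using 2 unfolding P_def N_def by (auto intro: cone_of.base)
      have "1 / fst p i \<ge> 0" "1 / (- fst n i) \<ge> 0"
        using 2 unfolding P_def N_def by (auto simp: divide_simps)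
      then show ?thesis
        unfolding 2(3) comb_def by (intro cone_of.add cone_of.scale p n)
    qed
  qed
  from insert.IH[OF finC'] show ?case
  proof
    assume "\<exists>(a, \<beta>)\<in>cone_of C'. (\<forall>j\<in>X. a j = 0) \<and> \<beta> < 0"
    then obtain a \<beta> where a: "(a, \<beta>) \<in> cone_of C'" "\<forall>j\<in>X. a j = 0" "\<beta> < 0" by auto
    have "a i = 0" using cone_of_zero_coordinate[OF a(1), of i] C'_zero by auto
    moreover have "(a, \<beta>) \<in> cone_of C" using cone_of_subset_cone[OF a(1) C'_sub] .
    ultimately show ?case using a by auto
  next
    assume "\<exists>x. \<forall>(a, \<beta>)\<in>C'. (\<Sum>j\<in>X. a j * x j) \<le> \<beta>"
    then obtain x where x: "\<And>q. q \<in> C' \<Longrightarrow> (\<Sum>j\<in>X. fst q j * x j) \<le> snd q" by fastforce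
    \<comment> \<open>With the other variables fixed at \<open>x\<close>, \<open>s q\<close> is the
      bound that \<open>q\<close> puts on variable \<open>i\<close>: an upper bound for
      \<open>q\<close> in \<open>P\<close>, a lower one for \<open>q\<close> in
      \<open>N\<close>.\<close>
    define s where "s = (\<lambda>q :: ('a \<Rightarrow> real) \<times> real. (snd q - (\<Sum>j\<in>X. fst q j * x j)) / fst q i)"
    have "\<exists>t. (\<forall>l\<in>s ` N. l \<le> t) \<and> (\<forall>u\<in>s ` P. t \<le> u)"
    proof (rule between_finite_sets)
      fix l u assume "l \<in> s ` N" "u \<in> s ` P"
      then obtain p n where pn: "p \<in> P" "n \<in> N" "l = s n" "u = s p" by auto
      have pos: "fst p i > 0" "fst n i < 0" using pn unfolding P_def N_def by auto
      have "comb p n \<in> C'" using pn unfolding C'_def by auto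
      from x[OF this] have "(\<Sum>j\<in>X. ((1 / fst p i) * fst p j + (1 / (- fst n i)) * fst n j) * x j)
          \<le> (1 / fst p i) * snd p + (1 / (- fst n i)) * snd n"
        unfolding comb_def by simp
      also have "(\<Sum>j\<in>X. ((1 / fst p i) * fst p j + (1 / (- fst n i)) * fst n j) * x j) =
         (1 / fst p i) * (\<Sum>j\<in>X. fst p j * x j) + (1 / (- fst n i)) * (\<Sum>j\<in>X. fst n j * x j)"
        by (simp only: sum_distrib_left distrib_right sum.distrib mult.assoc)
      finally show "l \<le> u" unfolding pn s_def
        by (simp add: diff_divide_distrib)
    qed (use insert.prems in \<open>auto simp: N_def P_def\<close>)
    then obtain t where t: "\<And>q. q \<in> N \<Longrightarrow> s q \<le> t" "\<And>q. q \<in> P \<Longrightarrow> t \<le> s q" by auto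
    have "(\<Sum>j\<in>insert i X. fst q j * (x(i := t)) j) \<le> snd q" if "q \<in> C" for q
    proof -
      have "(\<Sum>j\<in>X. fst q j * (x(i := t)) j) = (\<Sum>j\<in>X. fst q j * x j)"
        using insert.hyps by (intro sum.cong) auto
      then have eq: "(\<Sum>j\<in>insert i X. fst q j * (x(i := t)) j) = fst q i * t + (\<Sum>j\<in>X. fst q j * x j)"
        using insert.hyps by simp
      have "q \<in> Z \<or> q \<in> P \<or> q \<in> N" using that unfolding Z_def P_def N_def by auto
      then consider "q \<in> Z" | "q \<in> P" | "q \<in> N" by blast
      then show ?thesis
      proof cases
        case 1
        then have "q \<in> C'" "fst q i = 0" unfolding C'_def Z_def by auto
        then show ?thesis using x eq by simp
      next
        case 2
        then have "fst q i > 0" unfolding P_def by auto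
        then show ?thesis using t(2)[OF 2] unfolding eq s_def by (simp add: field_simps)
      next
        case 3
        then have "fst q i < 0" unfolding N_def by auto
        then show ?thesis using t(1)[OF 3] unfolding eq s_def by (simp add: field_simps)
      qed
    qed
    then show ?case by fastforce
  qed
qed

text \<open>Constraints are kept as functionals, so that linearity of cuts and loads follows from
  introduction rules; coefficients are extracted only where a proof computes with them.\<close>

definition linear_form :: "'a set \<Rightarrow> (('a \<Rightarrow> real) \<Rightarrow> real) \<Rightarrow> bool" where
  "linear_form X f \<longleftrightarrow> (\<exists>a. \<forall>x. f x = (\<Sum>i\<in>X. a i * x i))"

lemma linear_form_sum_coeff: "linear_form X (\<lambda>x. \<Sum>i\<in>X. a i * x i)"
  unfolding linear_form_def by blast

lemma linear_form_coord: "finite X \<Longrightarrow> i \<in> X \<Longrightarrow> linear_form X (\<lambda>x. x i)"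
  unfolding linear_form_def
  by (intro exI[of _ "\<lambda>j. if j = i then 1 else 0"]) (simp add: if_distrib[of "\<lambda>a. a * _"] cong: if_cong)

lemma linear_form_zero: "linear_form X (\<lambda>x. 0)"
  unfolding linear_form_def by (intro exI[of _ "\<lambda>_. 0"]) simp

lemma linear_form_add: "linear_form X f \<Longrightarrow> linear_form X g \<Longrightarrow> linear_form X (\<lambda>x. f x + g x)"
  unfolding linear_form_def
  apply clarify
  subgoal for a b by (intro exI[of _ "\<lambda>i. a i + b i"]) (simp add: sum.distrib distrib_right)
  done

lemma linear_form_scale: "linear_form X f \<Longrightarrow> linear_form X (\<lambda>x. t * f x)"
  unfolding linear_form_def
  apply clarify
  subgoal for a by (intro exI[of _ "\<lambda>i. t * a i"]) (simp add: sum_distrib_left mult.assoc)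
  done

lemma linear_form_uminus: "linear_form X f \<Longrightarrow> linear_form X (\<lambda>x. - f x)"
  using linear_form_scale[of X f "-1"] by simp

lemma linear_form_diff: "linear_form X f \<Longrightarrow> linear_form X g \<Longrightarrow> linear_form X (\<lambda>x. f x - g x)"
  using linear_form_add[OF _ linear_form_uminus, of X f g] by simp

lemma linear_form_sum:
  assumes "finite J" "\<And>j. j \<in> J \<Longrightarrow> linear_form X (f j)"
  shows "linear_form X (\<lambda>x. \<Sum>j\<in>J. f j x)"
  using assms by (induction J rule: finite_induct) (auto intro: linear_form_zero linear_form_add)

lemmas linear_form_intros =
  linear_form_coord linear_form_zero linear_form_add linear_form_scale linear_form_uminus
  linear_form_diff linear_form_sum

lemma linear_form_apply_add: "linear_form X f \<Longrightarrow> f (\<lambda>i. x i + y i) = f x + f y"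
  unfolding linear_form_def by (auto simp: algebra_simps sum.distrib)

lemma linear_form_apply_scale: "linear_form X f \<Longrightarrow> f (\<lambda>i. t * x i) = t * f x"
  unfolding linear_form_def by (auto simp: algebra_simps sum_distrib_left)

lemma linear_form_cong: "linear_form X f \<Longrightarrow> (\<And>i. i \<in> X \<Longrightarrow> x i = y i) \<Longrightarrow> f x = f y"
  unfolding linear_form_def by (auto intro!: sum.cong)

text \<open>The multipliers are recovered from the derivation in \<open>cone_of\<close> by
  induction. That the combination vanishes at every point, rather than coefficientwise, allows it to
  be tested later at vectors of choice.\<close>

lemma farkas:
  fixes f :: "'j \<Rightarrow> ('a \<Rightarrow> real) \<Rightarrow> real" and b :: "'j \<Rightarrow> real"
  assumes "finite X" "finite J" and lin: "\<And>j. j \<in> J \<Longrightarrow> linear_form X (f j)"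
    and infeasible: "\<nexists>x. \<forall>j\<in>J. f j x \<le> b j"
  shows "\<exists>z. (\<forall>j\<in>J. z j \<ge> 0) \<and> (\<forall>x. (\<Sum>j\<in>J. z j * f j x) = 0) \<and> (\<Sum>j\<in>J. z j * b j) < 0"
proof -
  from lin have "\<forall>j\<in>J. \<exists>a. \<forall>x. f j x = (\<Sum>i\<in>X. a i * x i)" unfolding linear_form_def by blast
  then obtain A where A: "\<And>j x. j \<in> J \<Longrightarrow> f j x = (\<Sum>i\<in>X. A j i * x i)" by metis
  define C where "C = (\<lambda>j. (A j, b j)) ` J"
  have "\<not> (\<exists>x. \<forall>(a, \<beta>)\<in>C. (\<Sum>i\<in>X. a i * x i) \<le> \<beta>)"
    using infeasible A unfolding C_def by auto
  then obtain a \<beta> where ab: "(a, \<beta>) \<in> cone_of C" "\<forall>i\<in>X. a i = 0" "\<beta> < 0"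
    using farkas_cone[OF assms(1), of C] assms(2) unfolding C_def by auto
  have "\<exists>z. (\<forall>j\<in>J. z j \<ge> 0) \<and> (\<forall>i. fst p i = (\<Sum>j\<in>J. z j * A j i)) \<and> snd p = (\<Sum>j\<in>J. z j * b j)"
    if "p \<in> cone_of C" for p
    using that
  proof induction
    case (base p)
    then obtain j where j: "j \<in> J" "p = (A j, b j)" unfolding C_def by auto
    then show ?case using assms(2)
      by (intro exI[of _ "\<lambda>k. if k = j then 1 else 0"])
        (simp add: if_distrib[of "\<lambda>a. a * _"] cong: if_cong)
  next
    case (add a \<alpha> b' \<beta>)
    then obtain z z' where "\<forall>j\<in>J. z j \<ge> 0" "\<forall>i. a i = (\<Sum>j\<in>J. z j * A j i)" "\<alpha> = (\<Sum>j\<in>J. z j * b j)"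
      "\<forall>j\<in>J. z' j \<ge> 0" "\<forall>i. b' i = (\<Sum>j\<in>J. z' j * A j i)" "\<beta> = (\<Sum>j\<in>J. z' j * b j)" by auto
    then show ?case
      by (intro exI[of _ "\<lambda>j. z j + z' j"]) (simp add: sum.distrib distrib_right)
  next
    case (scale a \<alpha> t)
    then obtain z where "\<forall>j\<in>J. z j \<ge> 0" "\<forall>i. a i = (\<Sum>j\<in>J. z j * A j i)" "\<alpha> = (\<Sum>j\<in>J. z j * b j)"
      by auto
    then show ?case using scale
      by (intro exI[of _ "\<lambda>j. t * z j"]) (simp add: sum_distrib_left mult.assoc)
  qed
  from this[OF ab(1)] obtain z where z: "\<forall>j\<in>J. z j \<ge> 0" "\<And>i. a i = (\<Sum>j\<in>J. z j * A j i)"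
    "\<beta> = (\<Sum>j\<in>J. z j * b j)" by auto
  have "(\<Sum>j\<in>J. z j * f j x) = 0" for x
  proof -
    have "(\<Sum>j\<in>J. z j * f j x) = (\<Sum>j\<in>J. \<Sum>i\<in>X. z j * A j i * x i)"
      using A by (simp add: sum_distrib_left mult.assoc)
    also have "\<dots> = (\<Sum>i\<in>X. a i * x i)"
      by (subst sum.swap) (simp add: z(2) sum_distrib_right)
    finally show ?thesis using ab(2) by simp
  qed
  then show ?thesis using z ab by (intro exI[of _ z]) auto
qed

section \<open>Attainment of optima in linear programs\<close>

definition satisfies :: "((('a \<Rightarrow> real) \<Rightarrow> real) \<times> real) set \<Rightarrow> ('a \<Rightarrow> real) \<Rightarrow> bool" where
  "satisfies C x \<longleftrightarrow> (\<forall>(f, b)\<in>C. f x \<le> b)"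

text \<open>If the infimum \<open>v\<close> were not attained, adding the constraint that
  \<open>g\<close> is at most \<open>v\<close> would be infeasible. In the Farkas certificate
  \<open>g\<close> has a positive multiplier, since \<open>C\<close> alone is feasible, and dividing
  by it bounds \<open>g\<close> from below by a number larger than \<open>v\<close>.\<close>

lemma lp_attains_bounded:
  fixes C :: "((('a \<Rightarrow> real) \<Rightarrow> real) \<times> real) set"
  assumes "finite X" "finite C" and lin: "\<And>f b. (f, b) \<in> C \<Longrightarrow> linear_form X f" and g: "linear_form X g"
    and feas: "satisfies C x0" and bdd: "\<And>x. satisfies C x \<Longrightarrow> B \<le> g x"
  shows "\<exists>x. satisfies C x \<and> (\<forall>y. satisfies C y \<longrightarrow> g x \<le> g y)"
proof (rule ccontr)
  assume not: "\<not> ?thesis"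
  define v where "v = Inf (g ` Collect (satisfies C))"
  have bb: "bdd_below (g ` Collect (satisfies C))" using bdd by (intro bdd_belowI[of _ B]) auto
  have low: "v \<le> g x" if "satisfies C x" for x
    unfolding v_def using that by (intro cInf_lower bb) auto
  have inf: "\<nexists>x. \<forall>j\<in>insert (g, v) C. fst j x \<le> snd j"
  proof
    assume "\<exists>x. \<forall>j\<in>insert (g, v) C. fst j x \<le> snd j"
    then obtain x where x: "satisfies C x" "g x \<le> v" unfolding satisfies_def by fastforce
    then show False using not low by force
  qed
  have "\<exists>z. (\<forall>j\<in>insert (g, v) C. z j \<ge> 0) \<and> (\<forall>x. (\<Sum>j\<in>insert (g, v) C. z j * fst j x) = 0)
      \<and> (\<Sum>j\<in>insert (g, v) C. z j * snd j) < 0"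
    by (rule farkas[OF \<open>finite X\<close> _ _ inf]) (use assms in auto)
  then obtain z where z: "\<And>j. j \<in> insert (g, v) C \<Longrightarrow> z j \<ge> 0"
    "\<And>x. (\<Sum>j\<in>insert (g, v) C. z j * fst j x) = 0" "(\<Sum>j\<in>insert (g, v) C. z j * snd j) < 0" by blast
  show False
  proof (cases "(g, v) \<in> C")
    \<comment> \<open>Inserting \<open>(g, v)\<close> into \<open>C\<close> would not create a new
      constraint here, so its multiplier could not be separated; but then \<open>x0\<close> itself
      attains \<open>v\<close>.\<close>
    case True
    have "g x0 \<le> v" using feas True unfolding satisfies_def by auto
    then show False using not feas low by force
  next
    case False
    define t where "t = z (g, v)"
    define s where "s = (\<Sum>j\<in>C. z j * snd j)"
    have neg: "t * v + s < 0" using z(3) False assms(2) by (simp add: t_def s_def)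
    have t0: "t \<ge> 0" using z(1) unfolding t_def by simp
    have ge: "0 \<le> s + t * g x" if "satisfies C x" for x
    proof -
      have "(\<Sum>j\<in>C. z j * fst j x) \<le> s"
        unfolding s_def using z(1) that unfolding satisfies_def
        by (intro sum_mono mult_left_mono) auto
      moreover have "t * g x + (\<Sum>j\<in>C. z j * fst j x) = 0"
        using z(2)[of x] False assms(2) by (simp add: t_def)
      ultimately show ?thesis by linarith
    qed
    have "t \<noteq> 0" using ge[OF feas] neg by auto
    then have t: "t > 0" using t0 by simp
    have "- s / t \<le> v" unfolding v_def
    proof (rule cInf_greatest)
      fix w assume "w \<in> g ` Collect (satisfies C)"
      then have "0 \<le> s + t * w" using ge by auto
      then show "- s / t \<le> w" using t by (simp add: field_simps)
    qed (use feas in auto)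
    then show False using neg t by (simp add: field_simps)
  qed
qed

text \<open>By homogeneity, nonnegativity of \<open>g\<close> on the recession cone means that no
  direction reaches the value -1. The Farkas multipliers of this infeasible homogeneous system give
  a lower bound for \<open>g\<close> on the inhomogeneous one.\<close>

lemma lp_attains:
  fixes C :: "((('a \<Rightarrow> real) \<Rightarrow> real) \<times> real) set"
  assumes "finite X" "finite C" and lin: "\<And>f b. (f, b) \<in> C \<Longrightarrow> linear_form X f" and g: "linear_form X g"
    and feas: "satisfies C x0"
    and rec: "\<And>d. (\<And>f b. (f, b) \<in> C \<Longrightarrow> f d \<le> 0) \<Longrightarrow> g d \<ge> 0"
  shows "\<exists>x. satisfies C x \<and> (\<forall>y. satisfies C y \<longrightarrow> g x \<le> g y)"
proof -
  \<comment> \<open>The \<open>option\<close> index keeps the objective apart from the constraints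
    even if the same functional occurs in \<open>C\<close>.\<close>
  define J where "J = insert None (Some ` C)"
  define ff :: "((('a \<Rightarrow> real) \<Rightarrow> real) \<times> real) option \<Rightarrow> ('a \<Rightarrow> real) \<Rightarrow> real"
    where "ff = (\<lambda>j. case j of None \<Rightarrow> g | Some q \<Rightarrow> fst q)"
  define bb :: "((('a \<Rightarrow> real) \<Rightarrow> real) \<times> real) option \<Rightarrow> real"
    where "bb = (\<lambda>j. case j of None \<Rightarrow> -1 | Some q \<Rightarrow> 0)"
  have inf: "\<nexists>x. \<forall>j\<in>J. ff j x \<le> bb j"
  proof
    assume "\<exists>x. \<forall>j\<in>J. ff j x \<le> bb j"
    then obtain d where d: "\<And>j. j \<in> J \<Longrightarrow> ff j d \<le> bb j" by blast
    have "g d \<le> -1" using d[of None] by (simp add: J_def ff_def bb_def)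
    moreover have "f d \<le> 0" if "(f, b) \<in> C" for f b
      using d[of "Some (f, b)"] that by (simp add: J_def ff_def bb_def)
    ultimately show False using rec[of d] by force
  qed
  have "\<exists>z. (\<forall>j\<in>J. z j \<ge> 0) \<and> (\<forall>x. (\<Sum>j\<in>J. z j * ff j x) = 0) \<and> (\<Sum>j\<in>J. z j * bb j) < 0"
    by (rule farkas[OF \<open>finite X\<close> _ _ inf]) (use assms in \<open>auto simp: J_def ff_def\<close>)
  then obtain z where z: "\<And>j. j \<in> J \<Longrightarrow> z j \<ge> 0" "\<And>x. (\<Sum>j\<in>J. z j * ff j x) = 0"
    "(\<Sum>j\<in>J. z j * bb j) < 0" by blast
  have sumJ: "(\<Sum>j\<in>J. h j) = h None + (\<Sum>q\<in>C. h (Some q))" for h :: "_ \<Rightarrow> real"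
    unfolding J_def using assms(2) by (subst sum.insert) (auto simp: sum.reindex)
  have t: "z None > 0" using z(3) unfolding sumJ by (simp add: bb_def)
  define s where "s = (\<Sum>q\<in>C. z (Some q) * snd q)"
  have "- s / z None \<le> g x" if "satisfies C x" for x
  proof -
    have "z None * g x + (\<Sum>q\<in>C. z (Some q) * fst q x) = 0"
      using z(2)[of x] unfolding sumJ by (simp add: ff_def case_prod_unfold)
    moreover have "(\<Sum>q\<in>C. z (Some q) * fst q x) \<le> s"
      unfolding s_def using z(1) that unfolding satisfies_def J_def
      by (intro sum_mono mult_left_mono) auto
    ultimately have "z None * g x \<ge> - s" by linarith
    then show ?thesis using t by (simp add: field_simps)
  qed
  from lp_attains_bounded[OF assms(1-5) this] show ?thesis .
qed

text \<open>Gaussian elimination: an equation with a nonzero coefficient at \<open>e0\<close> is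
  solved for the value at \<open>e0\<close>, which removes one equation and one unknown.\<close>

lemma underdetermined_system:
  fixes k :: "'b \<Rightarrow> 'a \<Rightarrow> real"
  assumes "finite B" "finite A" "card B < card A"
  shows "\<exists>z. (\<exists>e\<in>A. z e \<noteq> 0) \<and> (\<forall>p\<in>B. (\<Sum>e\<in>A. k p e * z e) = 0)"
  using assms
proof (induction B arbitrary: A k rule: finite_induct)
  case empty
  then have "A \<noteq> {}" by auto
  then show ?case by (intro exI[of _ "\<lambda>_. 1"]) auto
next
  case (insert p B)
  show ?case
  proof (cases "\<forall>e\<in>A. k p e = 0")
    case True
    have "card B < card A" using insert by simp
    then show ?thesis using insert.IH[of A k] True insert.prems by auto
  next
    case False
    then obtain e0 where e0: "e0 \<in> A" "k p e0 \<noteq> 0" by blast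
    define A' where "A' = A - {e0}"
    define k' where "k' = (\<lambda>q e. k q e - k q e0 * k p e / k p e0)"
    have "card B < card A'" "finite A'" using insert e0 by (auto simp: A'_def)
    then obtain z where z: "\<exists>e\<in>A'. z e \<noteq> 0" "\<forall>q\<in>B. (\<Sum>e\<in>A'. k' q e * z e) = 0"
      using insert.IH[of A' k'] by auto
    define y where "y = z(e0 := - (\<Sum>e\<in>A'. k p e * z e) / k p e0)"
    have y_sum: "(\<Sum>e\<in>A. k q e * y e) =
        (\<Sum>e\<in>A'. k q e * z e) - k q e0 * (\<Sum>e\<in>A'. k p e * z e) / k p e0" for q
    proof -
      have "(\<Sum>e\<in>A. k q e * y e) = k q e0 * y e0 + (\<Sum>e\<in>A'. k q e * y e)"
        unfolding A'_def using e0 insert.prems by (simp add: sum.remove)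
      also have "(\<Sum>e\<in>A'. k q e * y e) = (\<Sum>e\<in>A'. k q e * z e)"
        by (intro sum.cong) (auto simp: A'_def y_def)
      finally show ?thesis by (simp add: y_def)
    qed
    have "(\<Sum>e\<in>A. k q e * y e) = 0" if "q \<in> insert p B" for q
    proof (cases "q = p")
      case True
      then show ?thesis using e0 by (simp add: y_sum)
    next
      case False
      then have "(\<Sum>e\<in>A'. k' q e * z e) = 0" using z that by auto
      moreover have "(\<Sum>e\<in>A'. k' q e * z e) =
        (\<Sum>e\<in>A'. k q e * z e) - k q e0 * (\<Sum>e\<in>A'. k p e * z e) / k p e0"
        unfolding k'_def by (simp add: left_diff_distrib sum_subtractf sum_distrib_left sum_divide_distrib mult.assoc)
      ultimately show ?thesis by (simp add: y_sum)
    qed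
    moreover have "\<exists>e\<in>A. y e \<noteq> 0" using z(1) by (auto simp: A'_def y_def)
    ultimately show ?thesis by blast
  qed
qed

section \<open>Cuts, loads and matchings in finite graphs\<close>

text \<open>The first nonzero entry among levels 0 to \<open>m\<close>, if any, is positive. The
  phrasing by levels matches the dual programs, where a constraint is in force at level
  \<open>i\<close> as long as it was tight at all lower levels.\<close>

definition lex_nonneg :: "nat \<Rightarrow> (nat \<Rightarrow> real) \<Rightarrow> bool" where
  "lex_nonneg m a \<longleftrightarrow> (\<forall>i\<le>m. (\<forall>l<i. a l = 0) \<longrightarrow> a i \<ge> 0)"

lemma lex_nonnegD: "lex_nonneg m a \<Longrightarrow> i \<le> m \<Longrightarrow> (\<And>l. l < i \<Longrightarrow> a l = 0) \<Longrightarrow> a i \<ge> 0"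
  unfolding lex_nonneg_def by blast

lemma lex_nonneg_cong:
  assumes "\<And>l. l \<le> m \<Longrightarrow> a l = b l"
  shows "lex_nonneg m a \<longleftrightarrow> lex_nonneg m b"
proof -
  have "(\<forall>l<i. a l = 0) \<longleftrightarrow> (\<forall>l<i. b l = 0)" if "i \<le> m" for i using assms that by simp
  then show ?thesis unfolding lex_nonneg_def using assms by simp
qed

lemma lex_nonneg_zero: "lex_nonneg m (\<lambda>_. 0)"
  unfolding lex_nonneg_def by simp

lemma lex_nonneg_scale: "lex_nonneg m a \<Longrightarrow> t \<ge> 0 \<Longrightarrow> lex_nonneg m (\<lambda>l. a l * t)"
  unfolding lex_nonneg_def by (cases "t = 0") auto

text \<open>As long as the sums vanish, both summands vanish as well: at the first level where they
  might not, both are nonnegative.\<close>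

lemma lex_nonneg_add:
  assumes "lex_nonneg m a" "lex_nonneg m b"
  shows "lex_nonneg m (\<lambda>l. a l + b l)"
  unfolding lex_nonneg_def
proof (intro allI impI)
  fix i assume i: "i \<le> m" "\<forall>l<i. a l + b l = 0"
  have "a l = 0 \<and> b l = 0" if "l < i" for l
    using that
  proof (induction l rule: less_induct)
    case (less l)
    then have "a l \<ge> 0" "b l \<ge> 0"
      using assms i(1) unfolding lex_nonneg_def by auto
    moreover have "a l + b l = 0" using i less by auto
    ultimately show ?case by linarith
  qed
  then have "a i \<ge> 0" "b i \<ge> 0" using assms i(1) unfolding lex_nonneg_def by auto
  then show "a i + b i \<ge> 0" by simp
qed

lemma lex_nonneg_sum:
  assumes "finite J" "\<And>j. j \<in> J \<Longrightarrow> lex_nonneg m (a j)"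
  shows "lex_nonneg m (\<lambda>l. \<Sum>j\<in>J. a j l)"
  using assms by (induction J rule: finite_induct) (auto intro: lex_nonneg_zero lex_nonneg_add)

lemma singleton_in_singletons: "{v} \<in> singletons V \<longleftrightarrow> v \<in> V"
  unfolding singletons_def by auto

lemma finite_singletons: "finite V \<Longrightarrow> finite (singletons V)"
  unfolding singletons_def by simp

locale finite_graph =
  fixes V :: "'v set" and E :: "'v set set"
  assumes simple: "simple_graph V E"
begin

lemma finite_V: "finite V"
  and edge_subset: "e \<in> E \<Longrightarrow> e \<subseteq> V"
  and edge_card: "e \<in> E \<Longrightarrow> card e = 2"
  using simple unfolding simple_graph_def by auto

lemma finite_E: "finite E"
  by (rule finite_subset[of _ "Pow V"]) (use edge_subset finite_V in auto)

lemma finite_edge: "e \<in> E \<Longrightarrow> finite e"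
  using edge_subset finite_V finite_subset by metis

lemma edge_endpoints:
  assumes "e \<in> E"
  obtains a b where "e = {a, b}" "a \<noteq> b" "a \<in> V" "b \<in> V"
proof -
  obtain a b where "e = {a, b}" "a \<noteq> b" using edge_card[OF assms] card_2_iff by metis
  then show ?thesis using that edge_subset[OF assms] by auto
qed

lemma edge_other_endpoint:
  assumes "e \<in> E" "a \<in> e"
  obtains b where "e = {a, b}" "a \<noteq> b" "b \<in> V" "a \<in> V"
  using edge_endpoints[OF assms(1)] assms(2) by (metis empty_iff insert_commute insert_iff)

lemma edge_cut_pair:
  assumes "{a, b} \<in> E" "a \<noteq> b"
  shows "{a, b} \<in> edge_cut E S \<longleftrightarrow> (a \<in> S) \<noteq> (b \<in> S)"
proof -
  have "{a, b} \<inter> S = (if a \<in> S then {a} else {}) \<union> (if b \<in> S then {b} else {})" by auto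
  then show ?thesis unfolding edge_cut_def using assms by auto
qed

lemma edge_cut_iff:
  "e \<in> edge_cut E S \<longleftrightarrow> e \<in> E \<and> e \<inter> S \<noteq> {} \<and> \<not> e \<subseteq> S"
proof (cases "e \<in> E")
  case True
  obtain a b where "e = {a, b}" "a \<noteq> b" using edge_endpoints[OF True] by metis
  then show ?thesis using True edge_cut_pair[of a b S] by auto
qed (auto simp: edge_cut_def)

lemma edge_cut_subset: "edge_cut E S \<subseteq> E"
  unfolding edge_cut_def by auto

lemma finite_edge_cut: "finite (edge_cut E S)"
  using finite_subset[OF edge_cut_subset finite_E] .

lemma edge_cut_singleton: "edge_cut E {v} = {e \<in> E. v \<in> e}"
proof -
  have "\<not> e \<subseteq> {v}" if "e \<in> E" for e
    using edge_card[OF that] by (metis card.empty card_1_singleton_iff numeral_2_eq_2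
        One_nat_def n_not_Suc_n subset_singletonD zero_neq_numeral is_singletonI is_singleton_altdef)
  then show ?thesis by (auto simp: edge_cut_iff)
qed

definition inside :: "'v set \<Rightarrow> 'v set set" where
  "inside S = {e \<in> E. e \<subseteq> S}"

lemma finite_inside: "finite (inside S)"
  unfolding inside_def using finite_E by simp

lemma edge_cut_split:
  assumes "T \<subseteq> S"
  shows "edge_cut E T = (inside S \<inter> edge_cut E T) \<union> (edge_cut E S \<inter> edge_cut E T)"
    and "(inside S \<inter> edge_cut E T) \<inter> (edge_cut E S \<inter> edge_cut E T) = {}"
proof -
  have eq: "edge_cut E S = {e \<in> E. e \<inter> S \<noteq> {} \<and> \<not> e \<subseteq> S}" for S using edge_cut_iff by auto
  show "edge_cut E T = (inside S \<inter> edge_cut E T) \<union> (edge_cut E S \<inter> edge_cut E T)"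
    and "(inside S \<inter> edge_cut E T) \<inter> (edge_cut E S \<inter> edge_cut E T) = {}"
    unfolding inside_def eq using assms by blast+
qed

definition endpoint :: "'v set \<Rightarrow> 'v set \<Rightarrow> 'v" where
  "endpoint S f = the_elem (f \<inter> S)"

lemma endpoint:
  assumes "f \<in> edge_cut E S"
  shows "f \<inter> S = {endpoint S f}" and "endpoint S f \<in> S" and "endpoint S f \<in> f"
proof -
  have "card (f \<inter> S) = 1" using assms unfolding edge_cut_def by simp
  then obtain v where "f \<inter> S = {v}" using card_1_singletonE by blast
  then show *: "f \<inter> S = {endpoint S f}" unfolding endpoint_def by simp
  then show "endpoint S f \<in> S" "endpoint S f \<in> f" by auto
qed

lemma endpoint_subset_cut:
  assumes "f \<in> edge_cut E S" "T \<subseteq> S"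
  shows "f \<in> edge_cut E T \<longleftrightarrow> endpoint S f \<in> T"
proof -
  have "f \<inter> T = {endpoint S f} \<inter> T" using endpoint(1)[OF assms(1)] assms(2) by auto
  moreover have "f \<in> E" "\<not> f \<subseteq> S" using assms(1) edge_cut_iff by auto
  ultimately show ?thesis unfolding edge_cut_iff using assms(2) by auto
qed

text \<open>The index set is a parameter, so that it can be exchanged wherever the weights vanish on
  the difference.\<close>

definition load :: "'v set set \<Rightarrow> ('v set \<Rightarrow> real) \<Rightarrow> 'v set \<Rightarrow> real" where
  "load I a e = (\<Sum>S | S \<in> I \<and> e \<in> edge_cut E S. a S)"

lemma dual_load_eq: "dual_load V E \<F> x \<Pi> e = load (dual_index V E \<F> x) \<Pi> e"
  unfolding dual_load_def load_def ..

lemma load_alt: "finite I \<Longrightarrow> load I a e = (\<Sum>S\<in>I. if e \<in> edge_cut E S then a S else 0)"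
  unfolding load_def by (rule sum.mono_neutral_cong_left) auto

lemma load_mono_neutral:
  assumes "finite I" "J \<subseteq> I" "\<And>S. S \<in> I - J \<Longrightarrow> e \<in> edge_cut E S \<Longrightarrow> a S = 0"
  shows "load I a e = load J a e"
  unfolding load_def by (rule sum.mono_neutral_right) (use assms in auto)

lemma load_cong:
  assumes "\<And>S. S \<in> I \<Longrightarrow> e \<in> edge_cut E S \<Longrightarrow> a S = b S"
  shows "load I a e = load I b e"
  unfolding load_def by (rule sum.cong) (use assms in auto)

lemma load_diff: "load I (\<lambda>S. a S - b S) e = load I a e - load I b e"
  unfolding load_def by (simp add: sum_subtractf)

text \<open>Exchange of summation. With \<open>y\<close> primal and \<open>a\<close> dual, this is
  the identity behind all duality arguments below.\<close>

lemma sum_load: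
  assumes "finite I" "finite A"
  shows "(\<Sum>e\<in>A. y e * load I a e) = (\<Sum>S\<in>I. a S * (\<Sum>e\<in>A \<inter> edge_cut E S. y e))"
proof -
  have "(\<Sum>e\<in>A. y e * load I a e) = (\<Sum>e\<in>A. \<Sum>S\<in>I. if e \<in> edge_cut E S then y e * a S else 0)"
    using assms by (simp add: load_alt sum_distrib_left if_distrib cong: if_cong)
  also have "\<dots> = (\<Sum>S\<in>I. \<Sum>e\<in>A. if e \<in> edge_cut E S then y e * a S else 0)"
    by (rule sum.swap)
  also have "\<dots> = (\<Sum>S\<in>I. a S * (\<Sum>e\<in>A \<inter> edge_cut E S. y e))"
    using assms by (intro sum.cong) (auto simp: sum.inter_restrict sum_distrib_left mult.commute
      intro!: sum.cong)
  finally show ?thesis .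
qed

lemma sum_load_cuts:
  assumes "finite I"
  shows "(\<Sum>e\<in>E. y e * load I a e) = (\<Sum>S\<in>I. a S * (\<Sum>e\<in>edge_cut E S. y e))"
proof -
  have "E \<inter> edge_cut E S = edge_cut E S" for S using edge_cut_subset by auto
  then show ?thesis using sum_load[OF assms finite_E] by simp
qed

section \<open>Matchings, critical matchings and parity\<close>

definition matching_on :: "'v set \<Rightarrow> 'v set set \<Rightarrow> bool" where
  "matching_on W M \<longleftrightarrow> M \<subseteq> E \<and> \<Union>M = W \<and> (\<forall>e\<in>M. \<forall>e'\<in>M. \<forall>v. v \<in> e \<longrightarrow> v \<in> e' \<longrightarrow> e = e')"

lemma matching_onD:
  assumes "matching_on W M"
  shows "M \<subseteq> E" "\<Union>M = W" "e \<in> M \<Longrightarrow> e' \<in> M \<Longrightarrow> v \<in> e \<Longrightarrow> v \<in> e' \<Longrightarrow> e = e'"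
  using assms unfolding matching_on_def by simp_all

lemma matching_onI:
  assumes "M \<subseteq> E" "\<Union>M = W" "\<And>e e' v. e \<in> M \<Longrightarrow> e' \<in> M \<Longrightarrow> v \<in> e \<Longrightarrow> v \<in> e' \<Longrightarrow> e = e'"
  shows "matching_on W M"
  unfolding matching_on_def using assms by simp

text \<open>For singletons \<open>T\<close> the condition on cuts says that \<open>M\<close> is a matching covering \<open>S - {u}\<close>.\<close>

definition critical_matching :: "'v set set \<Rightarrow> 'v set \<Rightarrow> 'v \<Rightarrow> 'v set set \<Rightarrow> bool" where
  "critical_matching \<F> S u M \<longleftrightarrow> M \<subseteq> inside S \<and>
     (\<forall>T \<in> singletons S \<union> \<F>. T \<subseteq> S \<longrightarrow> card (M \<inter> edge_cut E T) = (if u \<in> T then 0 else 1))"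

lemma critical_matchingD:
  assumes "critical_matching \<F> S u M"
  shows "M \<subseteq> inside S"
    and "T \<in> singletons S \<union> \<F> \<Longrightarrow> T \<subseteq> S \<Longrightarrow> card (M \<inter> edge_cut E T) = (if u \<in> T then 0 else 1)"
  using assms unfolding critical_matching_def by blast+

lemma critical_matching_finite: "critical_matching \<F> S u M \<Longrightarrow> finite M"
  using critical_matchingD(1) finite_inside finite_subset by metis

lemma critical_matching_on:
  assumes M: "critical_matching \<F> S u M" and "u \<in> S"
  shows "matching_on (S - {u}) M"
proof -
  have ME: "M \<subseteq> E" and MS: "\<And>e. e \<in> M \<Longrightarrow> e \<subseteq> S"
    using critical_matchingD(1)[OF M] unfolding inside_def by auto
  have at: "M \<inter> edge_cut E {v} = {e \<in> M. v \<in> e}" for v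
    using ME by (auto simp: edge_cut_singleton)
  have card: "card {e \<in> M. v \<in> e} = (if u = v then 0 else 1)" if "v \<in> S" for v
    using critical_matchingD(2)[OF M, of "{v}"] that unfolding at by (auto simp: singletons_def)
  have sub: "e \<subseteq> S - {u}" if "e \<in> M" for e
    using card[OF \<open>u \<in> S\<close>] critical_matching_finite[OF M] that MS[OF that] by auto
  have ex: "\<exists>e. {e \<in> M. v \<in> e} = {e}" if "v \<in> S - {u}" for v
  proof -
    have "card {e \<in> M. v \<in> e} = 1" using card[of v] that by auto
    then show ?thesis by (metis card_1_singletonE)
  qed
  show ?thesis
  proof (rule matching_onI[OF ME])
    fix e e' v assume e: "e \<in> M" "e' \<in> M" "v \<in> e" "v \<in> e'"
    then have "v \<in> S - {u}" using sub[of e] by auto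
    then obtain e0 where e0: "{e \<in> M. v \<in> e} = {e0}" using ex by meson
    have "e \<in> {e \<in> M. v \<in> e}" "e' \<in> {e \<in> M. v \<in> e}" using e by auto
    then show "e = e'" unfolding e0 by simp
  next
    show "\<Union>M = S - {u}"
    proof (intro set_eqI iffI)
      fix v assume "v \<in> S - {u}"
      then obtain e0 where "{e \<in> M. v \<in> e} = {e0}" using ex by meson
      then have "e0 \<in> {e \<in> M. v \<in> e}" by simp
      then show "v \<in> \<Union>M" by auto
    qed (use sub in auto)
  qed
qed

text \<open>A weighting of the cut of \<open>S\<close> is continued into \<open>S\<close> along the critical matchings of the
  endpoints in \<open>S\<close>.\<close>

definition extension ::
  "'v set \<Rightarrow> ('v \<Rightarrow> 'v set set) \<Rightarrow> ('v set \<Rightarrow> real) \<Rightarrow> 'v set \<Rightarrow> real" where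
  "extension S M z e = (\<Sum>f\<in>edge_cut E S. z f * (if e \<in> M (endpoint S f) then 1 else 0))"

text \<open>Every cut edge \<open>f\<close> of S contributes \<open>z f\<close> exactly once:
  directly if its endpoint in S lies in T, and otherwise through the single edge by which the
  critical matching of that endpoint crosses T.\<close>

lemma extension_cut:
  assumes M: "\<And>u. u \<in> S \<Longrightarrow> critical_matching \<F> S u (M u)" and T: "T \<in> singletons S \<union> \<F>" "T \<subseteq> S"
  shows "(\<Sum>e\<in>inside S \<inter> edge_cut E T. extension S M z e) + (\<Sum>f\<in>edge_cut E S \<inter> edge_cut E T. z f)
       = (\<Sum>f\<in>edge_cut E S. z f)"
proof -
  let ?A = "inside S \<inter> edge_cut E T"
  have "(\<Sum>e\<in>?A. extension S M z e) =
      (\<Sum>f\<in>edge_cut E S. \<Sum>e\<in>?A. z f * (if e \<in> M (endpoint S f) then 1 else 0))"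
    unfolding extension_def by (rule sum.swap)
  also have "\<dots> = (\<Sum>f\<in>edge_cut E S. z f * (if endpoint S f \<in> T then 0 else 1))"
  proof (rule sum.cong[OF refl])
    fix f assume f: "f \<in> edge_cut E S"
    note cm = M[OF endpoint(2)[OF f]]
    have "(\<Sum>e\<in>?A. z f * (if e \<in> M (endpoint S f) then 1 else 0)) =
      z f * (\<Sum>e\<in>?A. if e \<in> M (endpoint S f) then 1 else 0)" by (simp add: sum_distrib_left)
    also have "(\<Sum>e\<in>?A. if e \<in> M (endpoint S f) then 1 else (0::real)) = card (?A \<inter> M (endpoint S f))"
      using finite_inside by (simp add: sum.If_cases Int_def)
    also have "?A \<inter> M (endpoint S f) = M (endpoint S f) \<inter> edge_cut E T"
      using critical_matchingD(1)[OF cm] by auto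
    finally show "(\<Sum>e\<in>?A. z f * (if e \<in> M (endpoint S f) then 1 else 0)) =
        z f * (if endpoint S f \<in> T then 0 else 1)"
      using critical_matchingD(2)[OF cm T] by simp
  qed
  finally have 1: "(\<Sum>e\<in>?A. extension S M z e) =
    (\<Sum>f\<in>edge_cut E S. z f * (if endpoint S f \<in> T then 0 else 1))" .
  have 2: "(\<Sum>f\<in>edge_cut E S \<inter> edge_cut E T. z f) =
    (\<Sum>f\<in>edge_cut E S. z f * (if endpoint S f \<in> T then 1 else 0))"
    using finite_edge_cut endpoint_subset_cut[OF _ T(2)]
    by (auto simp: sum.inter_restrict intro!: sum.cong)
  show ?thesis unfolding 1 2 by (subst sum.distrib[symmetric]) (auto intro: sum.cong)
qed

lemma matching_on_Un:
  assumes M: "matching_on A M" and N: "matching_on B N" and "A \<inter> B = {}"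
  shows "matching_on (A \<union> B) (M \<union> N)"
proof (rule matching_onI)
  show "M \<union> N \<subseteq> E" "\<Union>(M \<union> N) = A \<union> B" using matching_onD(1,2)[OF M] matching_onD(1,2)[OF N] by auto
  fix e e' v assume e: "e \<in> M \<union> N" "e' \<in> M \<union> N" "v \<in> e" "v \<in> e'"
  show "e = e'"
  proof (cases "v \<in> A")
    case True
    then have "v \<notin> \<Union>N" using assms(3) matching_onD(2)[OF N] by auto
    then show ?thesis using e matching_onD(3)[OF M, of e e' v] by auto
  next
    case False
    then have "v \<notin> \<Union>M" using matching_onD(2)[OF M] by auto
    then show ?thesis using e matching_onD(3)[OF N, of e e' v] by auto
  qed
qed

text \<open>The edges of \<open>M\<close> partition \<open>W\<close>, so the size of the
  intersection of T and W is a sum of numbers 0, 1 or 2, and the ones come from the edges in the cut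
  of \<open>T\<close>.\<close>

lemma matching_on_parity:
  assumes M: "matching_on W M" and "finite W"
  shows "even (card (M \<inter> edge_cut E T)) \<longleftrightarrow> even (card (T \<inter> W))"
proof -
  note sub = matching_onD(1)[OF M]
  have fin: "finite M" using sub finite_E finite_subset by blast
  have "T \<inter> W = (\<Union>e\<in>M. e \<inter> T)" using matching_onD(2)[OF M] by auto
  moreover have "card (\<Union>e\<in>M. e \<inter> T) = (\<Sum>e\<in>M. card (e \<inter> T))"
  proof (rule card_UN_disjoint[OF fin])
    show "\<forall>i\<in>M. finite (i \<inter> T)" using sub finite_edge by auto
    show "\<forall>i\<in>M. \<forall>j\<in>M. i \<noteq> j \<longrightarrow> i \<inter> T \<inter> (j \<inter> T) = {}"
      using matching_onD(3)[OF M] by auto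
  qed
  ultimately have "card (T \<inter> W) = (\<Sum>e\<in>M. card (e \<inter> T))" by simp
  also have "even \<dots> \<longleftrightarrow> even (card {e \<in> M. odd (card (e \<inter> T))})"
    by (rule even_sum_iff[OF fin])
  also have "{e \<in> M. odd (card (e \<inter> T))} = M \<inter> edge_cut E T"
  proof -
    have "odd (card (e \<inter> T)) \<longleftrightarrow> card (e \<inter> T) = 1" if "e \<in> M" for e
    proof -
      have "card (e \<inter> T) \<le> card e" using finite_edge sub that by (intro card_mono) auto
      then have "card (e \<inter> T) \<le> 2" using edge_card[of e] sub that by auto
      then have "card (e \<inter> T) = 0 \<or> card (e \<inter> T) = 1 \<or> card (e \<inter> T) = 2" by linarith
      then show ?thesis by auto
    qed
    then show ?thesis using sub unfolding edge_cut_def by auto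
  qed
  finally show ?thesis by simp
qed

lemma matching_on_singleton_cut:
  assumes "matching_on W M" "v \<in> W"
  shows "card (M \<inter> edge_cut E {v}) = 1"
proof -
  obtain e where e: "e \<in> M" "v \<in> e" using matching_onD(2)[OF assms(1)] assms(2) by auto
  then have "M \<inter> edge_cut E {v} = {e}"
    using matching_onD(1,3)[OF assms(1)] by (auto simp: edge_cut_singleton)
  then show ?thesis by simp
qed

end

section \<open>Lexicographically minimal optima\<close>

locale cpm_instance = finite_graph V E for V :: "'v set" and E :: "'v set set" +
  fixes c :: "'v set \<Rightarrow> int" and \<sigma> :: "'v set \<Rightarrow> nat"
  assumes has_perfect_matching: "\<exists>A. perfect_matching V E A"
    and sigma_bij: "bij_betw \<sigma> E {1..card E}"
begin

abbreviation "m \<equiv> card E"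

abbreviation "lc \<equiv> level_cost c \<sigma>"

definition cost :: "nat \<Rightarrow> ('v set \<Rightarrow> real) \<Rightarrow> real" where
  "cost l y = (\<Sum>e\<in>E. lc l e * y e)"

lemma cost_sigma:
  assumes "e \<in> E"
  shows "cost (\<sigma> e) y = y e" and "\<sigma> e \<le> m" and "\<sigma> e \<ge> 1"
proof -
  show s: "\<sigma> e \<le> m" "\<sigma> e \<ge> 1" using sigma_bij assms by (auto simp: bij_betw_def)
  have "lc (\<sigma> e) e' = (if e' = e then 1 else 0)" if "e' \<in> E" for e'
    using s sigma_bij assms that unfolding level_cost_def bij_betw_def inj_on_def by auto
  then have "cost (\<sigma> e) y = (\<Sum>e'\<in>E. if e' = e then y e' else 0)"
    unfolding cost_def by (intro sum.cong) auto
  also have "\<dots> = y e" using finite_E assms by simp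
  finally show "cost (\<sigma> e) y = y e" .
qed

lemma inv_sigma:
  assumes "1 \<le> k" "k \<le> m"
  shows "inv_into E \<sigma> k \<in> E" and "\<sigma> (inv_into E \<sigma> k) = k"
proof -
  have "k \<in> \<sigma> ` E" using sigma_bij assms unfolding bij_betw_def by auto
  then show "inv_into E \<sigma> k \<in> E" "\<sigma> (inv_into E \<sigma> k) = k"
    by (auto intro: inv_into_into f_inv_into_f)
qed

lemma cost_Suc: "Suc k \<le> m \<Longrightarrow> cost (Suc k) y = y (inv_into E \<sigma> (Suc k))"
  using cost_sigma(1)[OF inv_sigma(1)[of "Suc k"]] inv_sigma(2)[of "Suc k"] by simp

lemma cost_0: "cost 0 y = (\<Sum>e\<in>E. of_int (c e) * y e)"
  unfolding cost_def level_cost_def by simp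

lemma linear_form_cost: "linear_form E (cost l)"
  unfolding cost_def by (rule linear_form_sum_coeff)

lemma cost_add_scale: "cost l (\<lambda>e. x e + t * y e) = cost l x + t * cost l y"
  using linear_form_apply_add[OF linear_form_cost, of l x "\<lambda>e. t * y e"]
    linear_form_apply_scale[OF linear_form_cost, of l t y] by simp

section \<open>Existence of lexicographically minimal optima\<close>

lemma P_feasible_le_1:
  assumes "P_feasible V E \<F> x"
  shows "x e \<le> 1" and "x e \<ge> 0"
proof -
  show 0: "x e \<ge> 0" for e using assms unfolding P_feasible_def by (cases "e \<in> E") auto
  show "x e \<le> 1"
  proof (cases "e \<in> E")
    case True
    obtain a b where ab: "e = {a, b}" "a \<in> V" using edge_endpoints[OF True] by metis
    have "x e \<le> (\<Sum>e\<in>edge_cut E {a}. x e)"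
      using ab True 0 by (intro member_le_sum finite_edge_cut) (auto simp: edge_cut_singleton)
    then show ?thesis using assms ab unfolding P_feasible_def by auto
  qed (use assms in \<open>auto simp: P_feasible_def\<close>)
qed

lemma perfect_matching_on: "perfect_matching V E A \<Longrightarrow> matching_on V A"
proof (rule matching_onI)
  assume A: "perfect_matching V E A"
  then show sub: "A \<subseteq> E" unfolding perfect_matching_def by simp
  have ex1: "\<exists>!e. e \<in> A \<and> v \<in> e" if "v \<in> V" for v using A that unfolding perfect_matching_def by simp
  show "\<Union>A = V"
  proof (intro set_eqI iffI)
    fix v assume "v \<in> V"
    then show "v \<in> \<Union>A" using ex1_implies_ex[OF ex1] by auto
  qed (use sub edge_subset in auto)
  fix e e' v assume e: "e \<in> A" "e' \<in> A" "v \<in> e" "v \<in> e'"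
  then have "v \<in> V" using sub edge_subset by auto
  from ex1[OF this] show "e = e'" using e by (elim ex1E) metis
qed

lemma sum_incidence_vector:
  assumes "B \<subseteq> E"
  shows "(\<Sum>e\<in>B. incidence_vector A e) = card (A \<inter> B)"
proof -
  have "finite B" using assms finite_E finite_subset by blast
  then show ?thesis unfolding incidence_vector_def by (simp add: sum.If_cases Int_commute)
qed

text \<open>By parity a perfect matching crosses the cut of an odd set an odd number of times, hence
  at least once.\<close>

lemma incidence_vector_feasible:
  assumes A: "perfect_matching V E A" and F: "laminar_odd_family V \<F>"
  shows "P_feasible V E \<F> (incidence_vector A)"
proof -
  note mA = perfect_matching_on[OF A]
  have "A \<subseteq> E" using A unfolding perfect_matching_def by simp
  moreover have "card (A \<inter> edge_cut E S) \<ge> 1" if "S \<in> \<F>" for S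
  proof -
    have "S \<inter> V = S" "odd (card S)" using F that unfolding laminar_odd_family_def by auto
    then have "odd (card (A \<inter> edge_cut E S))"
      using matching_on_parity[OF mA finite_V, of S] by simp
    then show ?thesis by (metis One_nat_def Suc_leI even_zero neq0_conv)
  qed
  ultimately show ?thesis
    unfolding P_feasible_def sum_incidence_vector[OF edge_cut_subset]
    using matching_on_singleton_cut[OF mA] by (auto simp: incidence_vector_def)
qed

text \<open>This class is closed under passing to the minimizers of a linear form, which carries
  existence through all levels of the lexicographic minimization.\<close>

definition polyhedral :: "(('v set \<Rightarrow> real) \<Rightarrow> bool) \<Rightarrow> bool" where
  "polyhedral P \<longleftrightarrow> (\<exists>C. finite C \<and> (\<forall>(f, b)\<in>C. linear_form E f) \<and>
     (\<forall>x. P x \<longleftrightarrow> (\<forall>e. e \<notin> E \<longrightarrow> x e = 0) \<and> satisfies C x))"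

lemma polyhedral_P_feasible:
  assumes "finite \<F>"
  shows "polyhedral (P_feasible V E \<F>)"
proof -
  define C :: "((('v set \<Rightarrow> real) \<Rightarrow> real) \<times> real) set" where
    "C = (\<lambda>u. (\<lambda>x. \<Sum>e\<in>edge_cut E {u}. x e, 1)) ` V \<union>
         (\<lambda>u. (\<lambda>x. - (\<Sum>e\<in>edge_cut E {u}. x e), -1)) ` V \<union>
         (\<lambda>S. (\<lambda>x. - (\<Sum>e\<in>edge_cut E S. x e), -1)) ` \<F> \<union>
         (\<lambda>e. (\<lambda>x. - x e, 0)) ` E"
  have cut: "linear_form E (\<lambda>x. \<Sum>e\<in>edge_cut E S. x e)" for S
    using edge_cut_subset by (intro linear_form_intros finite_edge_cut finite_E) auto
  have "\<forall>(f, b)\<in>C. linear_form E f"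
    unfolding C_def using cut by (auto intro!: linear_form_uminus linear_form_coord finite_E)
  moreover have "finite C" unfolding C_def using assms finite_V finite_E by simp
  moreover have "P_feasible V E \<F> x \<longleftrightarrow> (\<forall>e. e \<notin> E \<longrightarrow> x e = 0) \<and> satisfies C x" for x
    unfolding P_feasible_def satisfies_def C_def ball_Un ball_simps
    by (auto intro: antisym)
  ultimately show ?thesis unfolding polyhedral_def by blast
qed

text \<open>Feasible vectors have entries between 0 and 1, which bounds every linear form. The
  minimizers are cut out by one more inequality, \<open>g\<close> at most its minimum.\<close>

lemma polyhedral_arg_min:
  assumes P: "polyhedral P" and feas: "\<And>x. P x \<Longrightarrow> P_feasible V E \<F> x" and x0: "P x0"
    and g: "linear_form E g"
  shows "\<exists>x. is_arg_min g P x" and "polyhedral (is_arg_min g P)"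
proof -
  from P obtain C where C: "finite C" "\<And>f b. (f, b) \<in> C \<Longrightarrow> linear_form E f"
    "\<And>x. P x \<longleftrightarrow> (\<forall>e. e \<notin> E \<longrightarrow> x e = 0) \<and> satisfies C x" unfolding polyhedral_def by blast
  \<comment> \<open>The functionals in \<open>C\<close> only see coordinates in \<open>E\<close>, so
    a solution of \<open>C\<close> may be set to zero elsewhere.\<close>
  define restr :: "('v set \<Rightarrow> real) \<Rightarrow> 'v set \<Rightarrow> real" where "restr = (\<lambda>x e. if e \<in> E then x e else 0)"
  have restr_f: "f (restr x) = f x" if "linear_form E f" for f x
    using linear_form_cong[OF that, of "restr x" x] by (simp add: restr_def)
  have restr_P: "P (restr x)" if "satisfies C x" for x
  proof -
    have "f (restr x) \<le> b" if "(f, b) \<in> C" for f b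
      using restr_f[OF C(2)[OF that], of x] \<open>satisfies C x\<close> that unfolding satisfies_def by auto
    then show ?thesis unfolding C(3) satisfies_def by (auto simp: restr_def)
  qed
  obtain a where a: "\<And>x. g x = (\<Sum>e\<in>E. a e * x e)" using g unfolding linear_form_def by blast
  have bdd: "- (\<Sum>e\<in>E. \<bar>a e\<bar>) \<le> g x" if "satisfies C x" for x
  proof -
    have F: "P_feasible V E \<F> (restr x)" using feas[OF restr_P[OF that]] .
    have "g x = g (restr x)" using restr_f[OF g] by simp
    also have "\<dots> = (\<Sum>e\<in>E. a e * restr x e)" by (rule a)
    also have "\<dots> \<ge> (\<Sum>e\<in>E. - \<bar>a e\<bar>)"
    proof (rule sum_mono)
      fix e
      have "\<bar>a e * restr x e\<bar> \<le> \<bar>a e\<bar> * 1"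
        unfolding abs_mult using P_feasible_le_1[OF F, of e] by (intro mult_left_mono) auto
      then show "- \<bar>a e\<bar> \<le> a e * restr x e" by linarith
    qed
    finally show ?thesis by (simp add: sum_negf)
  qed
  have "satisfies C x0" using x0 C(3) by blast
  then have "\<exists>x. satisfies C x \<and> (\<forall>y. satisfies C y \<longrightarrow> g x \<le> g y)"
    using lp_attains_bounded[OF finite_E C(1) _ g _ bdd] C(2) by blast
  then obtain x where x: "satisfies C x" "\<And>y. satisfies C y \<Longrightarrow> g x \<le> g y" by blast
  have min: "is_arg_min g P (restr x)"
    unfolding is_arg_min_linorder using restr_P[OF x(1)] x(2) restr_f[OF g] C(3) by auto
  then show "\<exists>x. is_arg_min g P x" by blast
  define C' where "C' = insert (g, g x) C"
  have "is_arg_min g P y \<longleftrightarrow> P y \<and> g y \<le> g x" for y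
    using min restr_f[OF g] unfolding is_arg_min_linorder by (auto intro: order_trans)
  then have "is_arg_min g P y \<longleftrightarrow> (\<forall>e. e \<notin> E \<longrightarrow> y e = 0) \<and> satisfies C' y" for y
    unfolding C(3) C'_def satisfies_def by auto
  moreover have "finite C'" "\<forall>(f, b)\<in>C'. linear_form E f" using C g unfolding C'_def by auto
  ultimately show "polyhedral (is_arg_min g P)" unfolding polyhedral_def by blast
qed

lemma P_lex_optimal_feasible: "P_lex_optimal V E c \<sigma> \<F> k x \<Longrightarrow> P_feasible V E \<F> x"
  by (induction k arbitrary: x) (auto simp: P_optimal_def is_arg_min_def)

lemma P_optimal_cost: "P_optimal V E c \<F> = is_arg_min (cost 0) (P_feasible V E \<F>)"
  unfolding P_optimal_def by (simp add: cost_0[abs_def])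

lemma P_lex_optimal_exists:
  assumes F: "laminar_odd_family V \<F>" and "k \<le> m"
  shows "polyhedral (P_lex_optimal V E c \<sigma> \<F> k) \<and> (\<exists>x. P_lex_optimal V E c \<sigma> \<F> k x)"
  using \<open>k \<le> m\<close>
proof (induction k)
  case 0
  have "finite \<F>" using F finite_V unfolding laminar_odd_family_def
    by (metis Pow_iff finite_Pow_iff finite_subset subsetI)
  then have "polyhedral (P_feasible V E \<F>)" by (rule polyhedral_P_feasible)
  moreover obtain A where "P_feasible V E \<F> (incidence_vector A)"
    using has_perfect_matching incidence_vector_feasible[OF _ F] by blast
  ultimately show ?case
    using polyhedral_arg_min[OF _ _ _ linear_form_cost] by (auto simp: P_optimal_cost)
next
  case (Suc k)
  then obtain x0 where "P_lex_optimal V E c \<sigma> \<F> k x0" "polyhedral (P_lex_optimal V E c \<sigma> \<F> k)" by auto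
  moreover have "linear_form E (\<lambda>x. x (inv_into E \<sigma> (Suc k)))"
    using Suc.prems by (intro linear_form_coord finite_E inv_sigma) auto
  ultimately show ?case
    using polyhedral_arg_min[OF _ P_lex_optimal_feasible] by auto
qed

lemma lex_min_optimal_exists: "laminar_odd_family V \<F> \<Longrightarrow> \<exists>x. lex_min_optimal V E c \<sigma> \<F> x"
  unfolding lex_min_optimal_def using P_lex_optimal_exists by blast

lemma lex_min_optimal_feasible: "lex_min_optimal V E c \<sigma> \<F> x \<Longrightarrow> P_feasible V E \<F> x"
  unfolding lex_min_optimal_def by (rule P_lex_optimal_feasible)

text \<open>If \<open>x\<close> passes the test up to level \<open>k\<close>, then another feasible
  vector passes it exactly when its costs up to \<open>k\<close> agree with those of
  \<open>x\<close>. Nested minimization thus becomes one comparison per level among all feasible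
  vectors.\<close>

lemma P_lex_optimal_iff:
  assumes "k \<le> m"
  shows "P_lex_optimal V E c \<sigma> \<F> k x \<longleftrightarrow> P_feasible V E \<F> x \<and>
    (\<forall>i\<le>k. \<forall>y. P_feasible V E \<F> y \<longrightarrow> (\<forall>l<i. cost l y = cost l x) \<longrightarrow> cost i x \<le> cost i y)"
  using assms
proof (induction k arbitrary: x)
  case 0
  then show ?case by (simp add: P_optimal_cost is_arg_min_linorder)
next
  case (Suc k)
  let ?P = "P_feasible V E \<F>"
  let ?B = "\<lambda>i x. \<forall>y. ?P y \<longrightarrow> (\<forall>l<i. cost l y = cost l x) \<longrightarrow> cost i x \<le> cost i y"
  have IH: "P_lex_optimal V E c \<sigma> \<F> k y \<longleftrightarrow> ?P y \<and> (\<forall>i\<le>k. ?B i y)" for y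
    using Suc by simp
  have step: "P_lex_optimal V E c \<sigma> \<F> (Suc k) x \<longleftrightarrow>
    (?P x \<and> (\<forall>i\<le>k. ?B i x)) \<and> (\<forall>y. ?P y \<and> (\<forall>i\<le>k. ?B i y) \<longrightarrow> cost (Suc k) x \<le> cost (Suc k) y)"
    unfolding P_lex_optimal.simps is_arg_min_linorder IH using cost_Suc[OF Suc.prems] by simp
  have "(\<forall>i\<le>k. ?B i y) \<longleftrightarrow> (\<forall>l\<le>k. cost l y = cost l x)" if xy: "?P x" "?P y" "\<forall>i\<le>k. ?B i x" for y
  proof
    assume y: "\<forall>i\<le>k. ?B i y"
    have "cost l y = cost l x" if "l \<le> k" for l
      using that
    proof (induction l rule: less_induct)
      case (less l)
      then have eq: "\<forall>j<l. cost j y = cost j x" by auto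
      have "cost l x \<le> cost l y" using xy eq less.prems by blast
      moreover have "cost l y \<le> cost l x" using xy y eq less.prems by metis
      ultimately show ?case by simp
    qed
    then show "\<forall>l\<le>k. cost l y = cost l x" by blast
  next
    assume eq: "\<forall>l\<le>k. cost l y = cost l x"
    show "\<forall>i\<le>k. ?B i y"
    proof (intro allI impI)
      fix i y' assume i: "i \<le> k" "?P y'" "\<forall>l<i. cost l y' = cost l y"
      then have "\<forall>l<i. cost l y' = cost l x" using eq by auto
      then have "cost i x \<le> cost i y'" using xy i by blast
      then show "cost i y \<le> cost i y'" using eq i by simp
    qed
  qed
  then show ?case unfolding step by (auto simp: le_Suc_eq less_Suc_eq_le)
qed

lemma lex_min_optimalD:
  assumes "lex_min_optimal V E c \<sigma> \<F> x" "P_feasible V E \<F> y" "i \<le> m"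
    "\<And>l. l < i \<Longrightarrow> cost l y = cost l x"
  shows "cost i x \<le> cost i y"
  using assms P_lex_optimal_iff[of m \<F> x] unfolding lex_min_optimal_def by blast

text \<open>The cost vector of level \<open>\<sigma> e\<close> is the unit vector of
  \<open>e\<close>.\<close>

lemma equal_costs_imp_equal:
  assumes "\<And>l. l \<le> m \<Longrightarrow> cost l x = cost l y" "\<And>e. e \<notin> E \<Longrightarrow> x e = 0" "\<And>e. e \<notin> E \<Longrightarrow> y e = 0"
  shows "x = y"
proof
  fix e show "x e = y e"
    using assms(1)[of "\<sigma> e"] cost_sigma[of e] assms(2,3) by (cases "e \<in> E") auto
qed

lemma lex_min_optimal_unique:
  assumes "lex_min_optimal V E c \<sigma> \<F> x" "lex_min_optimal V E c \<sigma> \<F> y"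
  shows "x = y"
proof (rule equal_costs_imp_equal)
  fix l show "l \<le> m \<Longrightarrow> cost l x = cost l y"
  proof (induction l rule: less_induct)
    case (less l)
    then have "cost l x \<le> cost l y" "cost l y \<le> cost l x"
      using assms lex_min_optimal_feasible by (auto intro!: lex_min_optimalD)
    then show ?case by simp
  qed
qed (use assms lex_min_optimal_feasible in \<open>auto simp: P_feasible_def\<close>)

end

section \<open>The dual programs\<close>

text \<open>A ratio test: only constraints with zero slack restrict the direction, the others
  tolerate a short step. The bound covers all smaller steps, so that several such bounds can be
  combined by a minimum.\<close>

lemma small_step_exists:
  fixes s d :: "'j \<Rightarrow> real"
  assumes "finite J" "\<And>j. j \<in> J \<Longrightarrow> s j \<ge> 0" "\<And>j. j \<in> J \<Longrightarrow> s j = 0 \<Longrightarrow> d j \<ge> 0"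
  shows "\<exists>t0>0. \<forall>t. 0 < t \<and> t \<le> t0 \<longrightarrow> (\<forall>j\<in>J. s j + t * d j \<ge> 0)"
  using assms
proof (induction J rule: finite_induct)
  case empty
  then show ?case by (intro exI[of _ 1]) simp
next
  case (insert j J)
  then obtain t0 where t0: "t0 > 0" "\<And>t k. 0 < t \<Longrightarrow> t \<le> t0 \<Longrightarrow> k \<in> J \<Longrightarrow> s k + t * d k \<ge> 0" by auto
  have "\<exists>t1>0. \<forall>t. 0 < t \<and> t \<le> t1 \<longrightarrow> s j + t * d j \<ge> 0"
  proof (cases "d j \<ge> 0")
    case True
    then show ?thesis using insert.prems by (intro exI[of _ 1]) auto
  next
    case False
    then have "s j > 0" using insert.prems by (metis insertI1 less_eq_real_def)
    have "s j + t * d j \<ge> 0" if "0 < t" "t \<le> s j / (- d j)" for t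
    proof -
      have "t * (- d j) \<le> s j" using that False by (simp add: field_simps)
      then show ?thesis by simp
    qed
    then show ?thesis using \<open>s j > 0\<close> False by (intro exI[of _ "s j / (- d j)"]) (auto simp: divide_pos_neg)
  qed
  then obtain t1 where "t1 > 0" "\<And>t. 0 < t \<Longrightarrow> t \<le> t1 \<Longrightarrow> s j + t * d j \<ge> 0" by auto
  then show ?case using t0 by (intro exI[of _ "min t0 t1"]) auto
qed

context cpm_instance
begin

lemma D_feasible_iff:
  "D_feasible V E \<F> x w \<gamma> L M N Q (r, \<Pi>) \<longleftrightarrow>
     (\<forall>S \<in> dual_index V E \<F> x - L. r S + \<Pi> S \<ge> \<gamma> S) \<and>
     (\<forall>S \<in> dual_index V E \<F> x - M. - r S + \<Pi> S \<le> \<gamma> S) \<and>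
     (\<forall>e \<in> supp E x. load (dual_index V E \<F> x) \<Pi> e = w e) \<and>
     (\<forall>e \<in> E - (supp E x \<union> N). load (dual_index V E \<F> x) \<Pi> e \<le> w e) \<and>
     (\<forall>S \<in> tight_sets E \<F> x - Q. \<Pi> S \<ge> 0)"
  unfolding D_feasible_def dual_load_eq by simp

lemma finite_dual_index: "finite \<F> \<Longrightarrow> finite (dual_index V E \<F> x)"
  unfolding dual_index_def tight_sets_def using finite_V by (auto intro: finite_singletons)

text \<open>The pairs satisfying \<open>D_feasible\<close> with right-hand side \<open>0\<close> form the recession cone of the
  dual program.\<close>

definition recession_nonneg ::
  "'v set set \<Rightarrow> ('v set \<Rightarrow> real) \<Rightarrow> 'v set set \<Rightarrow> 'v set set \<Rightarrow> 'v set set \<Rightarrow> 'v set set \<Rightarrow> bool" where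
  "recession_nonneg \<F> x L M N Q \<longleftrightarrow>
     (\<forall>\<rho> \<pi>. D_feasible V E \<F> x (\<lambda>_. 0) (\<lambda>_. 0) L M N Q (\<rho>, \<pi>) \<longrightarrow>
       0 \<le> (\<Sum>S\<in>dual_index V E \<F> x. 1 / real (card S) * \<rho> S))"

text \<open>With nothing dropped, the first two groups of constraints force \<open>\<rho>\<close> to
  dominate the absolute value of \<open>\<pi>\<close>.\<close>

lemma recession_nonneg_init: "recession_nonneg \<F> x {} {} {} {}"
  unfolding recession_nonneg_def D_feasible_iff
proof (intro allI impI sum_nonneg)
  fix \<rho> \<pi> :: "'v set \<Rightarrow> real" and S
  assume "(\<forall>S\<in>dual_index V E \<F> x - {}. 0 \<le> \<rho> S + \<pi> S) \<and>
       (\<forall>S\<in>dual_index V E \<F> x - {}. - \<rho> S + \<pi> S \<le> 0) \<and>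
       (\<forall>e\<in>supp E x. load (dual_index V E \<F> x) \<pi> e = 0) \<and>
       (\<forall>e\<in>E - (supp E x \<union> {}). load (dual_index V E \<F> x) \<pi> e \<le> 0) \<and>
       (\<forall>S\<in>tight_sets E \<F> x - {}. 0 \<le> \<pi> S)" "S \<in> dual_index V E \<F> x"
  then have "0 \<le> \<rho> S + \<pi> S" "- \<rho> S + \<pi> S \<le> 0" by auto
  then have "\<rho> S \<ge> 0" by linarith
  then show "0 \<le> 1 / real (card S) * \<rho> S" by simp
qed

lemma load_add_scale: "load I (\<lambda>S. a S + t * b S) e = load I a e + t * load I b e"
  unfolding load_def by (simp add: sum.distrib sum_distrib_left)

text \<open>Only constraints that are slack at the optimum \<open>(r, \<Pi>)\<close> are newly
  dropped. A direction of the enlarged cone is therefore feasible for a short step from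
  \<open>(r, \<Pi>)\<close>, and optimality makes its objective value nonnegative.\<close>

lemma recession_nonneg_step:
  fixes r \<Pi> x :: "'v set \<Rightarrow> real" and \<F> :: "'v set set"
  defines "I \<equiv> dual_index V E \<F> x"
  assumes fin: "finite \<F>" and opt: "D_optimal V E \<F> x w \<gamma> L M N Q (r, \<Pi>)"
  shows "recession_nonneg \<F> x
    (L \<union> {S \<in> I. r S + \<Pi> S \<noteq> \<gamma> S}) (M \<union> {S \<in> I. - r S + \<Pi> S \<noteq> \<gamma> S})
    (N \<union> {e \<in> E. load I \<Pi> e \<noteq> w e}) (Q \<union> {S \<in> tight_sets E \<F> x. \<Pi> S \<noteq> 0})"
  unfolding recession_nonneg_def
proof (intro allI impI)
  fix \<rho> \<pi>
  assume dir: "D_feasible V E \<F> x (\<lambda>_. 0) (\<lambda>_. 0)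
    (L \<union> {S \<in> I. r S + \<Pi> S \<noteq> \<gamma> S}) (M \<union> {S \<in> I. - r S + \<Pi> S \<noteq> \<gamma> S})
    (N \<union> {e \<in> E. load I \<Pi> e \<noteq> w e}) (Q \<union> {S \<in> tight_sets E \<F> x. \<Pi> S \<noteq> 0}) (\<rho>, \<pi>)"
  have finI: "finite I" unfolding I_def using finite_dual_index[OF fin] .
  have feas: "D_feasible V E \<F> x w \<gamma> L M N Q (r, \<Pi>)"
    and min: "\<And>r' \<Pi>'. D_feasible V E \<F> x w \<gamma> L M N Q (r', \<Pi>') \<Longrightarrow>
      (\<Sum>S\<in>I. 1 / real (card S) * r S) \<le> (\<Sum>S\<in>I. 1 / real (card S) * r' S)"
    using opt unfolding D_optimal_def is_arg_min_linorder I_def by auto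
  note feas' = feas[unfolded D_feasible_iff, folded I_def]
  note dir' = dir[unfolded D_feasible_iff, folded I_def]
  have 1: "\<exists>t0>0. \<forall>t. 0 < t \<and> t \<le> t0 \<longrightarrow> (\<forall>S\<in>I - L. (r S + \<Pi> S - \<gamma> S) + t * (\<rho> S + \<pi> S) \<ge> 0)"
    by (rule small_step_exists) (use feas' dir' finI in auto)
  have 2: "\<exists>t0>0. \<forall>t. 0 < t \<and> t \<le> t0 \<longrightarrow> (\<forall>S\<in>I - M. (r S - \<Pi> S + \<gamma> S) + t * (\<rho> S - \<pi> S) \<ge> 0)"
  proof (rule small_step_exists)
    fix S assume S: "S \<in> I - M"
    have "- r S + \<Pi> S \<le> \<gamma> S" using feas' S by simp
    then show "r S - \<Pi> S + \<gamma> S \<ge> 0" by simp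
    assume "r S - \<Pi> S + \<gamma> S = 0"
    then have "S \<in> I - (M \<union> {S \<in> I. - r S + \<Pi> S \<noteq> \<gamma> S})" using S by auto
    then have "- \<rho> S + \<pi> S \<le> 0" using dir' by blast
    then show "0 \<le> \<rho> S - \<pi> S" by simp
  qed (use finI in auto)
  have 3: "\<exists>t0>0. \<forall>t. 0 < t \<and> t \<le> t0 \<longrightarrow>
    (\<forall>e\<in>E - (supp E x \<union> N). (w e - load I \<Pi> e) + t * (- load I \<pi> e) \<ge> 0)"
    by (rule small_step_exists) (use feas' dir' finite_E in auto)
  have 4: "\<exists>t0>0. \<forall>t. 0 < t \<and> t \<le> t0 \<longrightarrow> (\<forall>S\<in>tight_sets E \<F> x - Q. \<Pi> S + t * \<pi> S \<ge> 0)"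
    by (rule small_step_exists) (use feas' dir' fin in \<open>auto simp: tight_sets_def\<close>)
  from 1 obtain t1 where t1: "t1 > 0"
    "\<forall>t. 0 < t \<and> t \<le> t1 \<longrightarrow> (\<forall>S\<in>I - L. (r S + \<Pi> S - \<gamma> S) + t * (\<rho> S + \<pi> S) \<ge> 0)" by blast
  from 2 obtain t2 where t2: "t2 > 0"
    "\<forall>t. 0 < t \<and> t \<le> t2 \<longrightarrow> (\<forall>S\<in>I - M. (r S - \<Pi> S + \<gamma> S) + t * (\<rho> S - \<pi> S) \<ge> 0)" by blast
  from 3 obtain t3 where t3: "t3 > 0" "\<forall>t. 0 < t \<and> t \<le> t3 \<longrightarrow>
    (\<forall>e\<in>E - (supp E x \<union> N). (w e - load I \<Pi> e) + t * (- load I \<pi> e) \<ge> 0)" by blast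
  from 4 obtain t4 where t4: "t4 > 0"
    "\<forall>t. 0 < t \<and> t \<le> t4 \<longrightarrow> (\<forall>S\<in>tight_sets E \<F> x - Q. \<Pi> S + t * \<pi> S \<ge> 0)" by blast
  define t where "t = min (min t1 t2) (min t3 t4)"
  have t: "0 < t" "t \<le> t1" "t \<le> t2" "t \<le> t3" "t \<le> t4" unfolding t_def using t1 t2 t3 t4 by auto
  have "D_feasible V E \<F> x w \<gamma> L M N Q (\<lambda>S. r S + t * \<rho> S, \<lambda>S. \<Pi> S + t * \<pi> S)"
    unfolding D_feasible_iff I_def[symmetric] load_add_scale
  proof (intro conjI ballI)
    fix S assume "S \<in> I - L"
    then have "(r S + \<Pi> S - \<gamma> S) + t * (\<rho> S + \<pi> S) \<ge> 0" using t1 t by blast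
    then show "\<gamma> S \<le> r S + t * \<rho> S + (\<Pi> S + t * \<pi> S)" by (simp add: algebra_simps)
  next
    fix S assume "S \<in> I - M"
    then have "(r S - \<Pi> S + \<gamma> S) + t * (\<rho> S - \<pi> S) \<ge> 0" using t2 t by blast
    then show "- (r S + t * \<rho> S) + (\<Pi> S + t * \<pi> S) \<le> \<gamma> S" by (simp add: algebra_simps)
  next
    fix e assume "e \<in> supp E x"
    then show "load I \<Pi> e + t * load I \<pi> e = w e" using feas' dir' by simp
  next
    fix e assume "e \<in> E - (supp E x \<union> N)"
    then have "(w e - load I \<Pi> e) + t * (- load I \<pi> e) \<ge> 0" using t3 t by blast
    then show "load I \<Pi> e + t * load I \<pi> e \<le> w e" by simp
  next
    fix S assume "S \<in> tight_sets E \<F> x - Q"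
    then show "0 \<le> \<Pi> S + t * \<pi> S" using t4 t by blast
  qed
  from min[OF this] have "0 \<le> t * (\<Sum>S\<in>I. 1 / real (card S) * \<rho> S)"
    by (simp add: algebra_simps sum.distrib sum_distrib_left add_divide_distrib)
  then show "0 \<le> (\<Sum>S\<in>dual_index V E \<F> x. 1 / real (card S) * \<rho> S)"
    using t(1) unfolding I_def[symmetric] by (simp add: zero_le_mult_iff)
qed

lemma linear_form_load: "finite I \<Longrightarrow> linear_form I (\<lambda>a. load I a e)"
  unfolding load_def by (intro linear_form_intros) auto

text \<open>A Farkas certificate of infeasibility of the dual program at level \<open>i\<close> is a direction along
  which \<open>x\<close> can be moved without changing the costs at the levels below \<open>i\<close>, while the cost at
  level \<open>i\<close> decreases.\<close>

lemma dual_potential_exists: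
  fixes D :: "nat \<Rightarrow> 'v set \<Rightarrow> real" and x :: "'v set \<Rightarrow> real" and \<F> :: "'v set set"
  defines "I \<equiv> dual_index V E \<F> x"
  assumes fin: "finite \<F>" and big: "\<And>S. S \<in> \<F> \<Longrightarrow> card S \<noteq> 1"
    and lex: "lex_min_optimal V E c \<sigma> \<F> x" and i: "i \<le> m"
    and tight: "\<And>l e. l < i \<Longrightarrow> e \<in> supp E x \<union> (E - N) \<Longrightarrow> load I (D l) e = lc l e"
    and zero: "\<And>l S. l < i \<Longrightarrow> S \<in> tight_sets E \<F> x - Q \<Longrightarrow> D l S = 0"
  shows "\<exists>\<Pi>. (\<forall>e \<in> supp E x. load I \<Pi> e = lc i e) \<and>
     (\<forall>e \<in> E - (supp E x \<union> N). load I \<Pi> e \<le> lc i e) \<and>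
     (\<forall>S \<in> tight_sets E \<F> x - Q. \<Pi> S \<ge> 0)"
proof (rule ccontr)
  assume infeas: "\<not> ?thesis"
  have finI: "finite I" unfolding I_def using finite_dual_index[OF fin] .
  note feas = lex_min_optimal_feasible[OF lex]
  define U where "U = supp E x \<union> (E - N)"
  define W where "W = tight_sets E \<F> x - Q"
  have UE: "U \<subseteq> E" and sE: "supp E x \<subseteq> E" and sU: "supp E x \<subseteq> U"
    unfolding U_def supp_def by auto
  have WI: "W \<subseteq> I" unfolding W_def I_def dual_index_def by auto
  have finU: "finite U" "finite (supp E x)" "finite W"
    using UE sE WI finite_E finI finite_subset by blast+
  \<comment> \<open>Farkas needs inequalities: tag 0 marks upper bounds on loads, tag 1 the reverse
    bounds on the support, tag 2 nonnegativity on \<open>W\<close>.\<close>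
  define J :: "(nat \<times> 'v set) set" where
    "J = Pair 0 ` U \<union> Pair 1 ` supp E x \<union> Pair 2 ` W"
  define f :: "nat \<times> 'v set \<Rightarrow> ('v set \<Rightarrow> real) \<Rightarrow> real" where
    "f = (\<lambda>(k, s) a. if k = 0 then load I a s else if k = 1 then - load I a s else - a s)"
  define b :: "nat \<times> 'v set \<Rightarrow> real" where
    "b = (\<lambda>(k, s). if k = 0 then lc i s else if k = 1 then - lc i s else 0)"
  have inf: "\<nexists>a. \<forall>j\<in>J. f j a \<le> b j"
  proof
    assume "\<exists>a. \<forall>j\<in>J. f j a \<le> b j"
    then obtain a where a: "\<And>j. j \<in> J \<Longrightarrow> f j a \<le> b j" by blast
    have 0: "load I a e \<le> lc i e" if "e \<in> U" for e
      using a[of "(0, e)"] that unfolding J_def f_def b_def by auto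
    have 1: "lc i e \<le> load I a e" if "e \<in> supp E x" for e
      using a[of "(1, e)"] that unfolding J_def f_def b_def by auto
    have 2: "0 \<le> a S" if "S \<in> W" for S
      using a[of "(2, S)"] that unfolding J_def f_def b_def by auto
    have "load I a e = lc i e" if "e \<in> supp E x" for e using 0[of e] 1[of e] sU that by force
    moreover have "load I a e \<le> lc i e" if "e \<in> E - (supp E x \<union> N)" for e
      using 0[of e] that unfolding U_def by auto
    ultimately show False using infeas 2 unfolding W_def by blast
  qed
  have "\<exists>z. (\<forall>j\<in>J. z j \<ge> 0) \<and> (\<forall>a. (\<Sum>j\<in>J. z j * f j a) = 0) \<and> (\<Sum>j\<in>J. z j * b j) < 0"
  proof (rule farkas[OF finI _ _ inf])
    show "finite J" unfolding J_def using finU by simp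
    fix j assume "j \<in> J"
    then show "linear_form I (f j)"
      using WI finI unfolding J_def f_def
      by (auto intro!: linear_form_load linear_form_uminus linear_form_coord)
  qed
  then obtain z where z: "\<And>j. j \<in> J \<Longrightarrow> z j \<ge> 0" "\<And>a. (\<Sum>j\<in>J. z j * f j a) = 0"
    "(\<Sum>j\<in>J. z j * b j) < 0" by blast
  have sumJ: "(\<Sum>j\<in>J. h j) = (\<Sum>e\<in>U. h (0, e)) + (\<Sum>e\<in>supp E x. h (1, e)) + (\<Sum>S\<in>W. h (2, S))"
    for h :: "nat \<times> 'v set \<Rightarrow> real"
    unfolding J_def using finU
    by (subst sum.union_disjoint, simp, simp, force)+ (simp add: sum.reindex inj_on_def)
  \<comment> \<open>The net multipliers of the edges form the primal direction; off the support only
    multipliers of tag 0 remain, so it is nonnegative there.\<close>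
  define y where "y = (\<lambda>e. (if e \<in> U then z (0, e) else 0) - (if e \<in> supp E x then z (1, e) else 0))"
  have ysum: "(\<Sum>e\<in>E. y e * h e) = (\<Sum>e\<in>U. z (0, e) * h e) - (\<Sum>e\<in>supp E x. z (1, e) * h e)"
    for h :: "'v set \<Rightarrow> real"
  proof -
    have "(\<Sum>e\<in>E. y e * h e) = (\<Sum>e\<in>E. (if e \<in> U then z (0, e) * h e else 0)) -
        (\<Sum>e\<in>E. (if e \<in> supp E x then z (1, e) * h e else 0))"
      unfolding y_def by (subst sum_subtractf[symmetric]) (auto intro!: sum.cong simp: algebra_simps)
    moreover have "E \<inter> U = U" "E \<inter> supp E x = supp E x" using UE sE by auto
    ultimately show ?thesis using finite_E by (simp add: sum.inter_restrict[symmetric])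
  qed
  have yload: "(\<Sum>e\<in>E. y e * load I a e) = (\<Sum>S\<in>W. z (2, S) * a S)" for a
    using z(2)[of a] unfolding sumJ ysum f_def by (simp add: sum_negf)
  \<comment> \<open>The identity \<open>yload\<close> is tested at the indicator vector of
    \<open>T\<close>.\<close>
  have ycut: "(\<Sum>e\<in>edge_cut E T. y e) = (if T \<in> W then z (2, T) else 0)" if "T \<in> I" for T
  proof -
    define a :: "'v set \<Rightarrow> real" where "a = (\<lambda>S. if S = T then 1 else 0)"
    have "(\<Sum>e\<in>E. y e * load I a e) = (\<Sum>S\<in>I. if S = T then (\<Sum>e\<in>edge_cut E S. y e) else 0)"
      unfolding sum_load_cuts[OF finI] a_def by (intro sum.cong) auto
    also have "\<dots> = (\<Sum>e\<in>edge_cut E T. y e)" using finI that by simp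
    finally have "(\<Sum>e\<in>edge_cut E T. y e) = (\<Sum>S\<in>W. z (2, S) * a S)" using yload by simp
    also have "\<dots> = (\<Sum>S\<in>W. if S = T then z (2, S) else 0)" unfolding a_def by (intro sum.cong) auto
    also have "\<dots> = (if T \<in> W then z (2, T) else 0)" using finU by simp
    finally show ?thesis .
  qed
  have ycost: "cost l y = (\<Sum>e\<in>E. y e * lc l e)" for l unfolding cost_def by (simp add: mult.commute)
  have neg: "cost i y < 0"
    using z(3) unfolding sumJ ycost ysum b_def by (simp add: sum_negf)
  \<comment> \<open>Complementarity at the lower levels: \<open>y\<close> lives on \<open>U\<close>,
    where \<open>D l\<close> is tight, and \<open>D l\<close> vanishes on \<open>W\<close>.\<close>
  have level: "cost l y = 0" if "l < i" for l
  proof -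
    have "cost l y = (\<Sum>e\<in>E. y e * load I (D l) e)"
      unfolding ycost using tight[OF that] sU unfolding y_def U_def by (intro sum.cong) auto
    also have "\<dots> = (\<Sum>S\<in>W. z (2, S) * D l S)" by (rule yload)
    also have "\<dots> = 0" using zero[OF that] unfolding W_def by simp
    finally show ?thesis .
  qed
  have off: "y e = 0" if "e \<notin> E" for e using that UE sE unfolding y_def by auto
  have ynn: "y e \<ge> 0" if "e \<notin> supp E x" for e
    using that z(1)[of "(0, e)"] unfolding y_def J_def by auto
  have "\<exists>t0>0. \<forall>t. 0 < t \<and> t \<le> t0 \<longrightarrow> (\<forall>e\<in>E. x e + t * y e \<ge> 0)"
    by (rule small_step_exists[OF finite_E])
      (use feas ynn in \<open>auto simp: P_feasible_def supp_def\<close>)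
  then obtain t1 where t1: "t1 > 0" "\<forall>t. 0 < t \<and> t \<le> t1 \<longrightarrow> (\<forall>e\<in>E. x e + t * y e \<ge> 0)" by blast
  have "\<exists>t0>0. \<forall>t. 0 < t \<and> t \<le> t0 \<longrightarrow>
    (\<forall>S\<in>\<F>. ((\<Sum>e\<in>edge_cut E S. x e) - 1) + t * (\<Sum>e\<in>edge_cut E S. y e) \<ge> 0)"
  proof (rule small_step_exists[OF fin])
    fix S assume S: "S \<in> \<F>"
    show "(\<Sum>e\<in>edge_cut E S. x e) - 1 \<ge> 0" using feas S unfolding P_feasible_def by auto
    assume "(\<Sum>e\<in>edge_cut E S. x e) - 1 = 0"
    then have "S \<in> I" using S unfolding I_def dual_index_def tight_sets_def by auto
    then show "(\<Sum>e\<in>edge_cut E S. y e) \<ge> 0" using ycut z(1)[of "(2, S)"] unfolding J_def by auto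
  qed
  then obtain t2 where t2: "t2 > 0" "\<forall>t. 0 < t \<and> t \<le> t2 \<longrightarrow>
    (\<forall>S\<in>\<F>. ((\<Sum>e\<in>edge_cut E S. x e) - 1) + t * (\<Sum>e\<in>edge_cut E S. y e) \<ge> 0)" by blast
  define t where "t = min t1 t2"
  have t: "0 < t" "t \<le> t1" "t \<le> t2" unfolding t_def using t1 t2 by auto
  have cut_add: "(\<Sum>e\<in>edge_cut E S. x e + t * y e) =
      (\<Sum>e\<in>edge_cut E S. x e) + t * (\<Sum>e\<in>edge_cut E S. y e)" for S
    by (simp add: sum.distrib sum_distrib_left)
  have "P_feasible V E \<F> (\<lambda>e. x e + t * y e)"
    unfolding P_feasible_def cut_add
  proof (intro conjI allI ballI impI)
    show "x e + t * y e = 0" if "e \<notin> E" for e using that off feas unfolding P_feasible_def by auto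
    show "0 \<le> x e + t * y e" if "e \<in> E" for e using that t1 t by blast
    show "1 \<le> (\<Sum>e\<in>edge_cut E S. x e) + t * (\<Sum>e\<in>edge_cut E S. y e)" if "S \<in> \<F>" for S
    proof -
      have "((\<Sum>e\<in>edge_cut E S. x e) - 1) + t * (\<Sum>e\<in>edge_cut E S. y e) \<ge> 0"
        using that t2 t by blast
      then show ?thesis by simp
    qed
    show "(\<Sum>e\<in>edge_cut E {u}. x e) + t * (\<Sum>e\<in>edge_cut E {u}. y e) = 1" if "u \<in> V" for u
    proof -
      \<comment> \<open>No singleton may occur in \<open>W\<close>: otherwise the degree at
        \<open>u\<close> could increase along \<open>y\<close>.\<close>
      have "{u} \<in> I" "{u} \<notin> W" using that big[of "{u}"]
        unfolding I_def W_def dual_index_def tight_sets_def by (auto simp: singletons_def)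
      then show ?thesis using ycut that feas unfolding P_feasible_def by auto
    qed
  qed
  from lex_min_optimalD[OF lex this i] level have "cost i x \<le> cost i x + t * cost i y"
    by (simp add: cost_add_scale)
  then show False using neg t(1) by (simp add: zero_le_mult_iff)
qed

text \<open>The potential settles the constraints on loads, the recession condition gives
  boundedness, and \<open>lp_attains\<close> combines the two.\<close>

lemma D_optimal_exists:
  fixes x :: "'v set \<Rightarrow> real" and \<F> :: "'v set set"
  defines "I \<equiv> dual_index V E \<F> x"
  assumes fin: "finite \<F>" and pot: "(\<forall>e \<in> supp E x. load I \<Pi>0 e = w e) \<and>
     (\<forall>e \<in> E - (supp E x \<union> N). load I \<Pi>0 e \<le> w e) \<and>
     (\<forall>S \<in> tight_sets E \<F> x - Q. \<Pi>0 S \<ge> 0)"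
    and rec: "recession_nonneg \<F> x L M N Q"
  shows "\<exists>r \<Pi>. D_optimal V E \<F> x w \<gamma> L M N Q (r, \<Pi>)"
proof -
  have finI: "finite I" unfolding I_def using finite_dual_index[OF fin] .
  have WI: "tight_sets E \<F> x \<subseteq> I" unfolding I_def dual_index_def by auto
  \<comment> \<open>The pair \<open>(r, \<Pi>)\<close> becomes a single vector: \<open>True\<close>
    selects \<open>r\<close>, \<open>False\<close> selects \<open>\<Pi>\<close>.\<close>
  define X where "X = (UNIV :: bool set) \<times> I"
  have finX: "finite X" unfolding X_def using finI by simp
  have coord: "linear_form X (\<lambda>z. z (k, S))" if "S \<in> I" for k S
    using that finX by (intro linear_form_coord) (auto simp: X_def)
  have ld: "linear_form X (\<lambda>z. load I (\<lambda>S. z (k, S)) e)" for k e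
    unfolding load_def using finI by (intro linear_form_sum coord) auto
  define C :: "(((bool \<times> 'v set \<Rightarrow> real) \<Rightarrow> real) \<times> real) set" where
    "C = (\<lambda>S. (\<lambda>z. - (z (True, S) + z (False, S)), - \<gamma> S)) ` (I - L) \<union>
         (\<lambda>S. (\<lambda>z. - z (True, S) + z (False, S), \<gamma> S)) ` (I - M) \<union>
         (\<lambda>e. (\<lambda>z. load I (\<lambda>S. z (False, S)) e, w e)) ` supp E x \<union>
         (\<lambda>e. (\<lambda>z. - load I (\<lambda>S. z (False, S)) e, - w e)) ` supp E x \<union>
         (\<lambda>e. (\<lambda>z. load I (\<lambda>S. z (False, S)) e, w e)) ` (E - (supp E x \<union> N)) \<union>
         (\<lambda>S. (\<lambda>z. - z (False, S), 0)) ` (tight_sets E \<F> x - Q)"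
  define g where "g = (\<lambda>z :: bool \<times> 'v set \<Rightarrow> real. \<Sum>S\<in>I. 1 / real (card S) * z (True, S))"
  have neg_le: "- a - b \<le> - g \<longleftrightarrow> g \<le> a + b" for a b g :: real by auto
  have neg_le0: "- a \<le> b \<longleftrightarrow> 0 \<le> a + b" for a b :: real by auto
  have sat: "satisfies C z \<longleftrightarrow> D_feasible V E \<F> x w \<gamma> L M N Q (\<lambda>S. z (True, S), \<lambda>S. z (False, S))" for z
    unfolding satisfies_def C_def D_feasible_iff I_def[symmetric] ball_Un ball_simps
    by (auto intro: antisym simp: neg_le)
  have "\<exists>z. satisfies C z \<and> (\<forall>y. satisfies C y \<longrightarrow> g z \<le> g y)"
  proof (rule lp_attains[OF finX])
    show "finite C" unfolding C_def using finI WI finite_E finite_subset[of "tight_sets E \<F> x" I]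
      by (auto simp: supp_def)
    show "linear_form X f" if "(f, b) \<in> C" for f b
      using that WI unfolding C_def
      by (auto intro!: linear_form_uminus linear_form_add linear_form_diff coord ld)
    show "linear_form X g" unfolding g_def by (intro linear_form_sum linear_form_scale coord finI)
    \<comment> \<open>Taking \<open>r\<close> as the sum of the absolute values of
      \<open>\<gamma>\<close> and \<open>\<Pi>0\<close> satisfies both groups of constraints on
      \<open>r\<close>.\<close>
    show "satisfies C (\<lambda>(k, S). if k then \<bar>\<gamma> S\<bar> + \<bar>\<Pi>0 S\<bar> else \<Pi>0 S)"
      unfolding sat D_feasible_iff I_def[symmetric] using pot by auto
    fix d assume d: "\<And>f b. (f, b) \<in> C \<Longrightarrow> f d \<le> 0"
    have "\<forall>(f, b)\<in>C. f d \<le> 0" using d by auto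
    then have "D_feasible V E \<F> x (\<lambda>_. 0) (\<lambda>_. 0) L M N Q (\<lambda>S. d (True, S), \<lambda>S. d (False, S))"
      unfolding C_def D_feasible_iff I_def[symmetric] ball_Un ball_simps
      by (auto intro!: antisym simp: neg_le0)
    then show "0 \<le> g d" using rec unfolding recession_nonneg_def g_def I_def by blast
  qed
  then obtain z where z: "satisfies C z" "\<And>y. satisfies C y \<Longrightarrow> g z \<le> g y" by blast
  have "D_optimal V E \<F> x w \<gamma> L M N Q (\<lambda>S. z (True, S), \<lambda>S. z (False, S))"
    unfolding D_optimal_def is_arg_min_linorder
  proof (intro conjI allI impI)
    show "D_feasible V E \<F> x w \<gamma> L M N Q (\<lambda>S. z (True, S), \<lambda>S. z (False, S))"
      using z(1) sat by simp
    fix q assume q: "D_feasible V E \<F> x w \<gamma> L M N Q q"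
    obtain r \<Pi> where rP: "q = (r, \<Pi>)" by force
    then have "satisfies C (\<lambda>(k, S). if k then r S else \<Pi> S)" using q unfolding sat by simp
    from z(2)[OF this] show "(case (\<lambda>S. z (True, S), \<lambda>S. z (False, S)) of (r, \<Pi>) \<Rightarrow>
        \<Sum>S\<in>dual_index V E \<F> x. 1 / real (card S) * r S) \<le>
      (case q of (r, \<Pi>) \<Rightarrow> \<Sum>S\<in>dual_index V E \<F> x. 1 / real (card S) * r S)"
      unfolding rP g_def I_def by simp
  qed
  then show ?thesis by blast
qed

text \<open>\<open>R l\<close> is the vector \<open>r\<close> found at level \<open>l\<close>.\<close>

definition dual_phase ::
  "'v set set \<Rightarrow> (nat \<Rightarrow> 'v set \<Rightarrow> real) \<Rightarrow> ('v set \<Rightarrow> real) \<Rightarrow> nat \<Rightarrow> 'v set set \<Rightarrow> 'v set set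
     \<Rightarrow> 'v set set \<Rightarrow> 'v set set \<Rightarrow> (nat \<Rightarrow> 'v set \<Rightarrow> real) \<Rightarrow> (nat \<Rightarrow> 'v set \<Rightarrow> real) \<Rightarrow> bool" where
  "dual_phase \<F> \<Gamma> x i L M N Q D R \<longleftrightarrow> (let I = dual_index V E \<F> x in
     (\<forall>l S. S \<notin> I \<or> l \<ge> i \<longrightarrow> D l S = 0) \<and>
     (\<forall>l<i. \<forall>S\<in>I. (\<forall>k<l. R k S + D k S = \<Gamma> k S) \<longrightarrow> R l S + D l S \<ge> \<Gamma> l S) \<and>
     (\<forall>l<i. \<forall>S\<in>I. (\<forall>k<l. - R k S + D k S = \<Gamma> k S) \<longrightarrow> - R l S + D l S \<le> \<Gamma> l S) \<and>
     (\<forall>l<i. \<forall>e\<in>supp E x. load I (D l) e = lc l e) \<and>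
     (\<forall>l<i. \<forall>e\<in>E. (\<forall>k<l. load I (D k) e = lc k e) \<longrightarrow> load I (D l) e \<le> lc l e) \<and>
     (\<forall>l<i. \<forall>S\<in>tight_sets E \<F> x. (\<forall>k<l. D k S = 0) \<longrightarrow> D l S \<ge> 0) \<and>
     L = {S \<in> I. \<exists>l<i. R l S + D l S \<noteq> \<Gamma> l S} \<and>
     M = {S \<in> I. \<exists>l<i. - R l S + D l S \<noteq> \<Gamma> l S} \<and>
     N = {e \<in> E. \<exists>l<i. load I (D l) e \<noteq> lc l e} \<and>
     Q = {S \<in> tight_sets E \<F> x. \<exists>l<i. D l S \<noteq> 0} \<and>
     recession_nonneg \<F> x L M N Q)"

lemma dual_phase_init: "dual_phase \<F> \<Gamma> x 0 {} {} {} {} (\<lambda>_ _. 0) R"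
  unfolding dual_phase_def Let_def using recession_nonneg_init by simp

text \<open>Since \<open>L\<close>, \<open>M\<close>, \<open>N\<close>, \<open>Q\<close> consist of
  the indices that were not tight at some lower level, "not dropped" means "tight so far". The
  constraints in force at level \<open>i\<close> therefore extend the lexicographic inequalities by
  one level.\<close>

lemma dual_phase_step:
  assumes fin: "finite \<F>" and inv: "dual_phase \<F> \<Gamma> x i L M N Q D R"
    and opt: "D_optimal V E \<F> x (lc i) (\<Gamma> i) L M N Q (r, \<Pi>)"
    and L': "L' = L \<union> {S \<in> dual_index V E \<F> x. r S + \<Pi> S \<noteq> \<Gamma> i S}"
    and M': "M' = M \<union> {S \<in> dual_index V E \<F> x. - r S + \<Pi> S \<noteq> \<Gamma> i S}"
    and N': "N' = N \<union> {e \<in> E. dual_load V E \<F> x \<Pi> e \<noteq> lc i e}"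
    and Q': "Q' = Q \<union> {S \<in> tight_sets E \<F> x. \<Pi> S \<noteq> 0}"
    and D': "D' = D(i := (\<lambda>S. if S \<in> dual_index V E \<F> x then \<Pi> S else 0))"
  shows "dual_phase \<F> \<Gamma> x (Suc i) L' M' N' Q' D' (R(i := r))"
proof -
  let ?I = "dual_index V E \<F> x"
  have TI: "tight_sets E \<F> x \<subseteq> ?I" unfolding dual_index_def by auto
  have feas: "D_feasible V E \<F> x (lc i) (\<Gamma> i) L M N Q (r, \<Pi>)"
    using opt unfolding D_optimal_def is_arg_min_linorder by auto
  note feas' = feas[unfolded D_feasible_iff]
  note inv' = inv[unfolded dual_phase_def Let_def]
  have Di: "D' i S = \<Pi> S" if "S \<in> ?I" for S using that D' by simp
  have Dl: "D' l = D l" if "l \<noteq> i" for l using that D' by simp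
  have load_i: "load ?I (D' i) e = load ?I \<Pi> e" for e by (rule load_cong) (simp add: Di)
  have Lq: "L = {S \<in> ?I. \<exists>l<i. R l S + D l S \<noteq> \<Gamma> l S}"
    and Mq: "M = {S \<in> ?I. \<exists>l<i. - R l S + D l S \<noteq> \<Gamma> l S}"
    and Nq: "N = {e \<in> E. \<exists>l<i. load ?I (D l) e \<noteq> lc l e}"
    and Qq: "Q = {S \<in> tight_sets E \<F> x. \<exists>l<i. D l S \<noteq> 0}" using inv' by blast+
  show ?thesis
    unfolding dual_phase_def Let_def
  proof (intro conjI allI impI ballI)
    fix l S assume "S \<notin> ?I \<or> Suc i \<le> l"
    then show "D' l S = 0" using inv' D' by (cases "l = i") auto
  next
    fix l S assume l: "l < Suc i" "S \<in> ?I" "\<forall>k<l. (R(i := r)) k S + D' k S = \<Gamma> k S"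
    then show "(R(i := r)) l S + D' l S \<ge> \<Gamma> l S"
    proof (cases "l = i")
      case True
      then have "S \<notin> L" using l Dl unfolding Lq by auto
      then show ?thesis using feas' l True Di by auto
    qed (use inv' Dl in auto)
  next
    fix l S assume l: "l < Suc i" "S \<in> ?I" "\<forall>k<l. - (R(i := r)) k S + D' k S = \<Gamma> k S"
    then show "- (R(i := r)) l S + D' l S \<le> \<Gamma> l S"
    proof (cases "l = i")
      case True
      then have "S \<notin> M" using l Dl unfolding Mq by auto
      then show ?thesis using feas' l True Di by auto
    qed (use inv' Dl in auto)
  next
    fix l e assume l: "l < Suc i" "e \<in> supp E x"
    then show "load ?I (D' l) e = lc l e" using feas' load_i inv' Dl by (cases "l = i") auto
  next
    fix l e assume l: "l < Suc i" "e \<in> E" "\<forall>k<l. load ?I (D' k) e = lc k e"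
    then show "load ?I (D' l) e \<le> lc l e"
    proof (cases "l = i")
      case True
      then have "e \<notin> N" using l Dl unfolding Nq by auto
      then show ?thesis using feas' l True load_i by (cases "e \<in> supp E x") auto
    qed (use inv' Dl in auto)
  next
    fix l S assume l: "l < Suc i" "S \<in> tight_sets E \<F> x" "\<forall>k<l. D' k S = 0"
    then show "D' l S \<ge> 0"
    proof (cases "l = i")
      case True
      then have "S \<notin> Q" using l Dl unfolding Qq by auto
      then show ?thesis using feas' l True Di TI by auto
    qed (use inv' Dl in auto)
  next
    show "L' = {S \<in> ?I. \<exists>l<Suc i. (R(i := r)) l S + D' l S \<noteq> \<Gamma> l S}"
      unfolding L' Lq using Di Dl by (auto simp: Ex_less_Suc cong: conj_cong)
    show "M' = {S \<in> ?I. \<exists>l<Suc i. - (R(i := r)) l S + D' l S \<noteq> \<Gamma> l S}"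
      unfolding M' Mq using Di Dl by (auto simp: Ex_less_Suc cong: conj_cong)
    show "N' = {e \<in> E. \<exists>l<Suc i. load ?I (D' l) e \<noteq> lc l e}"
      unfolding N' Nq dual_load_eq using load_i Dl by (auto simp: Ex_less_Suc cong: conj_cong)
    show "Q' = {S \<in> tight_sets E \<F> x. \<exists>l<Suc i. D' l S \<noteq> 0}"
      unfolding Q' Qq using Di Dl TI by (auto simp: Ex_less_Suc cong: conj_cong)
    show "recession_nonneg \<F> x L' M' N' Q'"
      unfolding L' M' N' Q' dual_load_eq using recession_nonneg_step[OF fin opt] .
  qed
qed

lemma dual_phase_progress:
  assumes fin: "finite \<F>" and big: "\<And>S. S \<in> \<F> \<Longrightarrow> card S \<noteq> 1"
    and lex: "lex_min_optimal V E c \<sigma> \<F> x" and "i \<le> m" and inv: "dual_phase \<F> \<Gamma> x i L M N Q D R"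
  shows "\<exists>r \<Pi>. D_optimal V E \<F> x (lc i) (\<Gamma> i) L M N Q (r, \<Pi>)"
proof -
  note inv' = inv[unfolded dual_phase_def Let_def]
  have "\<exists>\<Pi>. (\<forall>e \<in> supp E x. load (dual_index V E \<F> x) \<Pi> e = lc i e) \<and>
     (\<forall>e \<in> E - (supp E x \<union> N). load (dual_index V E \<F> x) \<Pi> e \<le> lc i e) \<and>
     (\<forall>S \<in> tight_sets E \<F> x - Q. \<Pi> S \<ge> 0)"
    by (rule dual_potential_exists[OF fin big lex \<open>i \<le> m\<close>, where D = D]) (use inv' in auto)
  then obtain \<Pi> where pot: "(\<forall>e \<in> supp E x. load (dual_index V E \<F> x) \<Pi> e = lc i e) \<and>
     (\<forall>e \<in> E - (supp E x \<union> N). load (dual_index V E \<F> x) \<Pi> e \<le> lc i e) \<and>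
     (\<forall>S \<in> tight_sets E \<F> x - Q. \<Pi> S \<ge> 0)" by (rule exE)
  have "recession_nonneg \<F> x L M N Q" using inv' by blast
  from D_optimal_exists[OF fin pot this] show ?thesis .
qed

end

section \<open>Extremality of the duals\<close>

context cpm_instance
begin

text \<open>Besides tight critical matchings, \<open>\<Gamma>\<close> has to be lexicographically
  dual feasible inside the members, because there it competes with the new duals. The size bound
  keeps members apart from the singletons in the index set.\<close>

definition critical_family :: "'v set set \<Rightarrow> (nat \<Rightarrow> 'v set \<Rightarrow> real) \<Rightarrow> bool" where
  "critical_family \<F> \<Gamma> \<longleftrightarrow> laminar_odd_family V \<F> \<and> (\<forall>S\<in>\<F>. card S \<ge> 3) \<and>
     (\<forall>S\<in>\<F>. lex_nonneg m (\<lambda>l. \<Gamma> l S)) \<and>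
     (\<forall>S\<in>\<F>. \<forall>e\<in>inside S. lex_nonneg m (\<lambda>l. lc l e - load (singletons V \<union> \<F>) (\<Gamma> l) e)) \<and>
     (\<forall>S\<in>\<F>. \<forall>u\<in>S. \<exists>M. critical_matching \<F> S u M \<and>
        (\<forall>e\<in>M. \<forall>l\<le>m. load (singletons V \<union> \<F>) (\<Gamma> l) e = lc l e))"

lemma critical_family_finite: "critical_family \<F> \<Gamma> \<Longrightarrow> finite \<F>"
  unfolding critical_family_def laminar_odd_family_def
  using finite_V by (metis Pow_iff finite_Pow_iff finite_subset subsetI)

lemma critical_family_init: "critical_family {} (\<lambda>_ _. 0)"
  unfolding critical_family_def laminar_odd_family_def laminar_def by simp

end

text \<open>The state after the for loop: levels 0 to \<open>m\<close> are solved, hence the index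
  \<open>Suc m\<close>.\<close>

locale dual_phase_done = cpm_instance V E c \<sigma>
  for V :: "'v set" and E :: "'v set set" and c :: "'v set \<Rightarrow> int" and \<sigma> :: "'v set \<Rightarrow> nat" +
  fixes \<F> :: "'v set set" and \<Gamma> D R :: "nat \<Rightarrow> 'v set \<Rightarrow> real" and x :: "'v set \<Rightarrow> real"
    and L M N Q :: "'v set set"
  assumes critical: "critical_family \<F> \<Gamma>" and lex_min: "lex_min_optimal V E c \<sigma> \<F> x"
    and phase: "dual_phase \<F> \<Gamma> x (Suc m) L M N Q D R"
begin

abbreviation "idx \<equiv> singletons V \<union> \<F>"
abbreviation "dix \<equiv> dual_index V E \<F> x"

lemma finite_F: "finite \<F>" using critical_family_finite[OF critical] .

lemma finite_idx: "finite idx" using finite_F finite_V by (simp add: finite_singletons)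

lemma dix_subset: "dix \<subseteq> idx" unfolding dual_index_def tight_sets_def by auto

lemma F_subset: "S \<in> \<F> \<Longrightarrow> S \<subseteq> V" and F_odd: "S \<in> \<F> \<Longrightarrow> odd (card S)"
  and F_card: "S \<in> \<F> \<Longrightarrow> card S \<ge> 3" and F_laminar: "laminar \<F>"
  using critical unfolding critical_family_def laminar_odd_family_def by auto

lemma F_not_singleton: "S \<in> \<F> \<Longrightarrow> S \<notin> singletons V"
  using F_card unfolding singletons_def by force

lemma feasible: "P_feasible V E \<F> x" using lex_min_optimal_feasible[OF lex_min] .

lemma x_nonneg: "x e \<ge> 0" and x_le_1: "x e \<le> 1" and x_off: "e \<notin> E \<Longrightarrow> x e = 0"
  and x_degree: "v \<in> V \<Longrightarrow> (\<Sum>e\<in>edge_cut E {v}. x e) = 1"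
  and x_cut: "S \<in> \<F> \<Longrightarrow> (\<Sum>e\<in>edge_cut E S. x e) \<ge> 1"
  using P_feasible_le_1[OF feasible] feasible unfolding P_feasible_def by auto

lemma D_off: "S \<notin> dix \<Longrightarrow> D l S = 0" and D_above: "l > m \<Longrightarrow> D l S = 0"
  using phase unfolding dual_phase_def Let_def by auto

lemma dix_cut: "S \<in> dix \<Longrightarrow> (\<Sum>e\<in>edge_cut E S. x e) = 1"
  unfolding dual_index_def tight_sets_def singletons_def using x_degree by auto

lemma load_dix: "load dix (D l) e = load idx (D l) e"
  by (rule load_mono_neutral[OF finite_idx dix_subset, symmetric]) (use D_off in auto)

lemma supp_tight: "l \<le> m \<Longrightarrow> e \<in> supp E x \<Longrightarrow> load idx (D l) e = lc l e"
  using phase unfolding dual_phase_def Let_def load_dix[symmetric] by auto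

lemma slack_lex_nonneg:
  assumes "e \<in> E"
  shows "lex_nonneg m (\<lambda>l. lc l e - load idx (D l) e)"
proof -
  have "\<forall>l<Suc m. (\<forall>k<l. load dix (D k) e = lc k e) \<longrightarrow> load dix (D l) e \<le> lc l e"
    using phase assms unfolding dual_phase_def Let_def by blast
  then show ?thesis unfolding lex_nonneg_def load_dix by (auto simp: less_Suc_eq_le)
qed

lemma D_lex_nonneg:
  assumes "S \<in> \<F>"
  shows "lex_nonneg m (\<lambda>l. D l S)"
proof (cases "S \<in> tight_sets E \<F> x")
  case True
  then have "\<forall>l<Suc m. (\<forall>k<l. D k S = 0) \<longrightarrow> D l S \<ge> 0"
    using phase unfolding dual_phase_def Let_def by blast
  then show ?thesis unfolding lex_nonneg_def by (auto simp: less_Suc_eq_le)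
next
  case False
  then have "D l S = 0" for l
    using D_off F_not_singleton[OF assms] unfolding dual_index_def by auto
  then show ?thesis using lex_nonneg_zero by simp
qed

definition below :: "'v set \<Rightarrow> 'v set set" where
  "below S = {T \<in> idx. T \<subset> S}"

lemma finite_below: "finite (below S)"
  unfolding below_def using finite_idx by simp

lemma below_index: "S \<in> \<F> \<Longrightarrow> T \<in> below S \<Longrightarrow> T \<in> singletons S \<union> \<F> \<and> T \<subseteq> S"
  unfolding below_def singletons_def by auto

text \<open>By laminarity, a set whose cut contains an edge inside S is a proper subset of
  S.\<close>

lemma load_inside:
  assumes "S \<in> \<F>" "e \<in> inside S"
  shows "load idx a e = load (below S) a e"
proof (rule load_mono_neutral[OF finite_idx])
  show "below S \<subseteq> idx" unfolding below_def by auto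
  fix T assume T: "T \<in> idx - below S" "e \<in> edge_cut E T"
  have e: "e \<subseteq> S" "e \<inter> T \<noteq> {}" "\<not> e \<subseteq> T"
    using T(2) assms(2) unfolding inside_def edge_cut_iff by auto
  have "T \<subseteq> S \<or> S \<subseteq> T \<or> S \<inter> T = {}"
    using T(1) F_laminar assms(1) unfolding laminar_def singletons_def by auto
  then have "T \<subset> S" using e by auto
  then show "a T = 0" using T(1) unfolding below_def by auto
qed

text \<open>Otherwise at the first level \<open>i\<close> where the two differ, moving \<open>D\<^sub>i\<close> inside \<open>S\<close> towards
  \<open>\<Gamma>\<^sub>i\<close> and compensating at \<open>S\<close> would improve the objective: the weight \<open>1 / |T|\<close> exceeds \<open>1 / |S|\<close>
  for \<open>T \<subset> S\<close>.\<close>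

lemma extremal_agreement:
  assumes S: "S \<in> \<F>" and pos: "D l0 S \<noteq> 0" and "i \<le> m" "T \<in> below S"
  shows "D i T = \<Gamma> i T"
  using assms(3,4)
proof (induction i arbitrary: T rule: less_induct)
  case (less i)
  let ?J = "below S"
  have i: "i \<le> m" by (rule less.prems)
  have agree: "D l T = \<Gamma> l T" if "l < i" "T \<in> ?J" for l T using less.IH[OF that(1)] that i by simp
  have S_dix: "S \<in> dix" using pos D_off by blast
  have S_tight: "S \<in> tight_sets E \<F> x"
    using S_dix F_not_singleton[OF S] unfolding dual_index_def by auto
  have xS: "(\<Sum>e\<in>edge_cut E S. x e) = 1" using dix_cut[OF S_dix] .
  have "\<forall>u\<in>S. \<exists>M. critical_matching \<F> S u M \<and> (\<forall>e\<in>M. \<forall>l\<le>m. load idx (\<Gamma> l) e = lc l e)"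
    using critical S unfolding critical_family_def by blast
  then obtain K where K: "\<And>u. u \<in> S \<Longrightarrow> critical_matching \<F> S u (K u)"
    "\<And>u e l. u \<in> S \<Longrightarrow> e \<in> K u \<Longrightarrow> l \<le> m \<Longrightarrow> load idx (\<Gamma> l) e = lc l e" by metis
  have K_inside: "e \<in> inside S" if "u \<in> S" "e \<in> K u" for u e
    using critical_matchingD(1)[OF K(1)] that by blast
  have loads: "load idx (\<Gamma> l) e = load idx (D l) e" if "l < i" "e \<in> inside S" for l e
    unfolding load_inside[OF S that(2)] by (rule load_cong) (use agree that in auto)
  \<comment> \<open>Lexicographic slack of \<open>\<Gamma>\<close> bounds level \<open>i\<close>
    only where it vanishes at all lower levels; there it coincides with the slack of
    \<open>D\<close> by induction.\<close>
  have G_slack: "load idx (\<Gamma> i) e \<le> lc i e" if "e \<in> inside S" "\<And>l. l < i \<Longrightarrow> load idx (D l) e = lc l e" for e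
  proof -
    have "lex_nonneg m (\<lambda>l. lc l e - load idx (\<Gamma> l) e)"
      using critical S that(1) unfolding critical_family_def by blast
    from lex_nonnegD[OF this i] show ?thesis using loads[OF _ that(1)] that(2) by simp
  qed
  \<comment> \<open>The converse transfer: edges of \<open>K u\<close> are tight for
    \<open>\<Gamma>\<close>, so below level \<open>i\<close> they are tight for \<open>D\<close>
    too.\<close>
  have D_slack: "load idx (D i) e \<le> lc i e" if "u \<in> S" "e \<in> K u" for u e
  proof -
    have e: "e \<in> inside S" using K_inside[OF that] .
    then have "e \<in> E" unfolding inside_def by simp
    from lex_nonnegD[OF slack_lex_nonneg[OF this] i] show ?thesis
      using loads[OF _ e] K(2)[OF that] i by simp
  qed
  \<comment> \<open>A competitor for \<open>x\<close> inside S: the values of \<open>x\<close> on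
    the cut of S, continued along matchings tight for \<open>\<Gamma>\<close>. Every cut inside S
    gets total weight 1 from it.\<close>
  define w where "w = extension S K x"
  have w_nonneg: "w e \<ge> 0" for e
    unfolding w_def extension_def using x_nonneg by (intro sum_nonneg) auto
  have w_zero: "\<exists>u\<in>S. e \<in> K u" if "w e \<noteq> 0" for e
  proof (rule ccontr)
    assume not: "\<not> ?thesis"
    have "w e = 0" unfolding w_def extension_def
      by (intro sum.neutral ballI) (use not endpoint(2) in auto)
    then show False using that by simp
  qed
  define X where "X = (\<lambda>T. \<Sum>e\<in>edge_cut E T. x e)"
  have cut_eq: "(\<Sum>e\<in>inside S \<inter> edge_cut E T. x e - w e) = X T - 1" if "T \<in> ?J" for T
  proof -
    have T: "T \<in> singletons S \<union> \<F>" "T \<subseteq> S" using below_index[OF S that] by auto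
    have "(\<Sum>e\<in>inside S \<inter> edge_cut E T. w e) + (\<Sum>f\<in>edge_cut E S \<inter> edge_cut E T. x f) = 1"
      using extension_cut[OF K(1) T, of x] xS unfolding w_def by simp
    moreover have "X T = (\<Sum>e\<in>inside S \<inter> edge_cut E T. x e) + (\<Sum>f\<in>edge_cut E S \<inter> edge_cut E T. x f)"
      unfolding X_def by (subst edge_cut_split(1)[OF T(2)], subst sum.union_disjoint)
        (use edge_cut_split(2)[OF T(2)] finite_inside finite_edge_cut in auto)
    ultimately show ?thesis by (simp add: sum_subtractf)
  qed
  have key: "(\<Sum>e\<in>inside S. (x e - w e) * load idx a e) = (\<Sum>T\<in>?J. a T * (X T - 1))" for a
  proof -
    have "(\<Sum>e\<in>inside S. (x e - w e) * load idx a e) = (\<Sum>e\<in>inside S. (x e - w e) * load ?J a e)"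
      using load_inside[OF S] by (intro sum.cong) auto
    also have "\<dots> = (\<Sum>T\<in>?J. a T * (X T - 1))"
      unfolding sum_load[OF finite_below finite_inside] using cut_eq by (intro sum.cong) auto
    finally show ?thesis .
  qed
  have J_cut: "X T \<ge> 1" if "T \<in> ?J" for T
  proof -
    have "T \<in> singletons V \<or> T \<in> \<F>" using that unfolding below_def by auto
    then show ?thesis unfolding X_def singletons_def using x_degree x_cut by auto
  qed
  have J_not_dix: "D l T = 0" if "T \<in> ?J" "X T \<noteq> 1" for l T
    using dix_cut[of T] D_off that unfolding X_def by blast
  \<comment> \<open>\<open>p1\<close> pairs \<open>x\<close> with the slack of
    \<open>\<Gamma> i\<close>, \<open>p2\<close> pairs \<open>w\<close> with the slack of
    \<open>D i\<close>, and \<open>p3\<close> pairs \<open>\<Gamma> i\<close> with the excess of the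
    cuts of \<open>x\<close>. The opposite pairings vanish, so these nonnegative terms add up to
    zero and all of them are zero.\<close>
  define p1 where "p1 = (\<lambda>e. x e * (lc i e - load idx (\<Gamma> i) e))"
  define p2 where "p2 = (\<lambda>e. w e * (lc i e - load idx (D i) e))"
  define p3 where "p3 = (\<lambda>T. \<Gamma> i T * (X T - 1))"
  have p1: "p1 e \<ge> 0" if "e \<in> inside S" for e
  proof (cases "x e = 0")
    case False
    then have "e \<in> supp E x" using that unfolding supp_def inside_def by simp
    then have "load idx (\<Gamma> i) e \<le> lc i e" using G_slack[OF that] supp_tight i by simp
    then show ?thesis unfolding p1_def using x_nonneg by simp
  qed (simp add: p1_def)
  have p2: "p2 e \<ge> 0" for e
  proof (cases "w e = 0")
    case False
    then show ?thesis using w_zero[OF False] D_slack w_nonneg unfolding p2_def by fastforce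
  qed (simp add: p2_def)
  have p3: "p3 T \<ge> 0" if "T \<in> ?J" for T
  proof (cases "X T = 1")
    case False
    have "T \<notin> singletons V" using False x_degree unfolding X_def singletons_def by auto
    then have "T \<in> \<F>" using that unfolding below_def by auto
    then have "lex_nonneg m (\<lambda>l. \<Gamma> l T)" using critical unfolding critical_family_def by blast
    from lex_nonnegD[OF this i] have "\<Gamma> i T \<ge> 0" using agree[OF _ that] J_not_dix[OF that False] by force
    then show ?thesis unfolding p3_def using J_cut[OF that] by simp
  qed (simp add: p3_def)
  have x_D: "x e * (lc i e - load idx (D i) e) = 0" if "e \<in> inside S" for e
    using supp_tight[OF i, of e] that unfolding supp_def inside_def by (cases "x e = 0") auto
  have w_G: "w e * (lc i e - load idx (\<Gamma> i) e) = 0" for e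
  proof (cases "w e = 0")
    case False
    then show ?thesis using w_zero[OF False] K(2) i by auto
  qed simp
  have "(\<Sum>e\<in>inside S. (x e - w e) * load idx (D i) e) = 0"
    unfolding key using J_not_dix by (intro sum.neutral) auto
  moreover have "(\<Sum>e\<in>inside S. (x e - w e) * load idx (\<Gamma> i) e) = (\<Sum>T\<in>?J. p3 T)"
    unfolding key p3_def ..
  moreover have "(\<Sum>e\<in>inside S. p1 e) + (\<Sum>e\<in>inside S. p2 e) =
    (\<Sum>e\<in>inside S. (x e - w e) * load idx (D i) e) - (\<Sum>e\<in>inside S. (x e - w e) * load idx (\<Gamma> i) e)"
  proof -
    have "p1 e + p2 e = (x e - w e) * load idx (D i) e - (x e - w e) * load idx (\<Gamma> i) e"
      if "e \<in> inside S" for e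
      using x_D[OF that] w_G[of e] unfolding p1_def p2_def by (auto simp: algebra_simps)
    then show ?thesis unfolding sum.distrib[symmetric] sum_subtractf[symmetric] by (intro sum.cong) auto
  qed
  ultimately have "(\<Sum>e\<in>inside S. p1 e) + (\<Sum>e\<in>inside S. p2 e) + (\<Sum>T\<in>?J. p3 T) = 0" by simp
  moreover have "(\<Sum>e\<in>inside S. p1 e) \<ge> 0" "(\<Sum>e\<in>inside S. p2 e) \<ge> 0" "(\<Sum>T\<in>?J. p3 T) \<ge> 0"
    using p1 p2 p3 by (auto intro: sum_nonneg)
  ultimately have sums: "(\<Sum>e\<in>inside S. p1 e) = 0" "(\<Sum>e\<in>inside S. p2 e) = 0" "(\<Sum>T\<in>?J. p3 T) = 0"
    by linarith+
  have z1: "p1 e = 0" if "e \<in> inside S" for e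
    using sums(1) p1 that finite_inside by (subst (asm) sum_nonneg_eq_0_iff) auto
  have z2: "p2 e = 0" if "e \<in> inside S" for e
    using sums(2) p2 that finite_inside by (subst (asm) sum_nonneg_eq_0_iff) auto
  have z3: "p3 T = 0" if "T \<in> ?J" for T
    using sums(3) p3 that finite_below by (subst (asm) sum_nonneg_eq_0_iff) auto
  \<comment> \<open>\<open>d\<close> is the move from \<open>D i\<close> to
    \<open>\<Gamma> i\<close>; \<open>tot\<close> is the amount that has to be compensated at
    S.\<close>
  define d where "d = (\<lambda>T. \<Gamma> i T - D i T)"
  define tot where "tot = (\<Sum>T\<in>?J. d T)"
  have d_not_dix: "d T = 0" if "T \<in> ?J" "T \<notin> dix" for T
  proof -
    have "X T \<noteq> 1"
      using that x_degree unfolding X_def dual_index_def tight_sets_def below_def by auto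
    then show ?thesis using z3[OF that(1)] D_off[OF that(2)] unfolding p3_def d_def by simp
  qed
  have K_load: "(\<Sum>e\<in>K u. load idx a e) = (\<Sum>T\<in>?J. a T * (if u \<in> T then 0 else 1))" if u: "u \<in> S" for u a
  proof -
    have fK: "finite (K u)" using critical_matching_finite[OF K(1)[OF u]] .
    have "(\<Sum>e\<in>K u. load idx a e) = (\<Sum>e\<in>K u. 1 * load ?J a e)"
      using load_inside[OF S K_inside[OF u]] by simp
    also have "\<dots> = (\<Sum>T\<in>?J. a T * (\<Sum>e\<in>K u \<inter> edge_cut E T. 1))"
      by (rule sum_load[OF finite_below fK])
    also have "\<dots> = (\<Sum>T\<in>?J. a T * (if u \<in> T then 0 else 1))"
      using critical_matchingD(2)[OF K(1)[OF u]] below_index[OF S] by (intro sum.cong) auto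
    finally show ?thesis .
  qed
  \<comment> \<open>Summing loads over \<open>K u\<close> counts each set inside S that avoids
    \<open>u\<close> exactly once. The defect is the slack of \<open>D i\<close> on
    \<open>K u\<close>, which is zero if a support edge leaves S at \<open>u\<close>.\<close>
  have delta: "(\<Sum>T\<in>?J. if u \<in> T then d T else 0) = tot - (\<Sum>e\<in>K u. lc i e - load idx (D i) e)" if u: "u \<in> S" for u
  proof -
    have "(\<Sum>e\<in>K u. lc i e - load idx (D i) e) = (\<Sum>e\<in>K u. load idx (\<Gamma> i) e) - (\<Sum>e\<in>K u. load idx (D i) e)"
      unfolding sum_subtractf[symmetric] using K(2)[OF u] i by (intro sum.cong) auto
    also have "\<dots> = (\<Sum>T\<in>?J. d T * (if u \<in> T then 0 else 1))"
      unfolding K_load[OF u] d_def sum_subtractf[symmetric] by (intro sum.cong) (auto simp: algebra_simps)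
    finally show ?thesis unfolding tot_def
      by (simp add: sum_subtractf[symmetric]) (auto intro!: sum.cong)
  qed
  have delta_le: "(\<Sum>T\<in>?J. if u \<in> T then d T else 0) \<le> tot" if u: "u \<in> S" for u
  proof -
    have "0 \<le> (\<Sum>e\<in>K u. lc i e - load idx (D i) e)" using D_slack[OF u] by (intro sum_nonneg) auto
    then show ?thesis using delta[OF u] by simp
  qed
  have delta_eq: "(\<Sum>T\<in>?J. if u \<in> T then d T else 0) = tot"
    if f: "f \<in> edge_cut E S" "f \<in> supp E x" "u = endpoint S f" for u f
  proof -
    have u: "u \<in> S" using endpoint(2)[OF f(1)] f(3) by simp
    have "lc i e - load idx (D i) e = 0" if e: "e \<in> K u" for e
    proof -
      have "x f \<le> w e"
      proof -
        have "x f = x f * (if e \<in> K (endpoint S f) then 1 else 0)" using e f(3) by simp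
        also have "\<dots> \<le> w e" unfolding w_def extension_def
          using f(1) x_nonneg finite_edge_cut by (intro member_le_sum) auto
        finally show ?thesis .
      qed
      moreover have "x f > 0" using f(2) x_nonneg[of f] unfolding supp_def by auto
      ultimately have "w e > 0" by simp
      then show ?thesis using z2[OF K_inside[OF u e]] unfolding p2_def by auto
    qed
    then show ?thesis using delta[OF u] by simp
  qed
  \<comment> \<open>The improving direction: inside S the deviation and its charge shrink together.
    The value -tot at S restores tightness of the support edges in the cut of S, at the price of the
    absolute value of \<open>tot\<close>.\<close>
  define \<pi> where "\<pi> = (\<lambda>T. if T \<in> ?J then d T else if T = S then - tot else 0)"
  define \<rho> where "\<rho> = (\<lambda>T. if T \<in> ?J then - \<bar>d T\<bar> else if T = S then \<bar>tot\<bar> else 0)"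
  have S_notJ: "S \<notin> ?J" unfolding below_def by auto
  have \<pi>_off: "\<pi> T = 0" if "T \<in> idx - dix" for T
    using d_not_dix that S_dix unfolding \<pi>_def by auto
  have load_\<pi>: "load dix \<pi> e = load idx \<pi> e" for e
    by (rule load_mono_neutral[OF finite_idx dix_subset, symmetric]) (use \<pi>_off in auto)
  have inside_\<pi>: "load idx \<pi> e = load idx (\<Gamma> i) e - load idx (D i) e" if "e \<in> inside S" for e
    unfolding load_inside[OF S that] load_diff[symmetric]
    by (rule load_cong) (auto simp: \<pi>_def d_def)
  have cut_\<pi>: "load idx \<pi> e = (\<Sum>T\<in>?J. if endpoint S e \<in> T then d T else 0) - tot" if e: "e \<in> edge_cut E S" for e
  proof -
    have "load idx \<pi> e = load (insert S ?J) \<pi> e"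
      by (rule load_mono_neutral[OF finite_idx]) (use S in \<open>auto simp: below_def \<pi>_def\<close>)
    also have "\<dots> = \<pi> S + (\<Sum>T\<in>?J. if e \<in> edge_cut E T then \<pi> T else 0)"
      using finite_below S_notJ e by (simp add: load_alt)
    also have "(\<Sum>T\<in>?J. if e \<in> edge_cut E T then \<pi> T else 0) =
        (\<Sum>T\<in>?J. if endpoint S e \<in> T then d T else 0)"
      using endpoint_subset_cut[OF e] below_index[OF S] by (intro sum.cong) (auto simp: \<pi>_def)
    finally show ?thesis using S_notJ by (simp add: \<pi>_def)
  qed
  have out_\<pi>: "load idx \<pi> e = 0" if "e \<in> E" "e \<notin> inside S" "e \<notin> edge_cut E S" for e
  proof -
    have "e \<inter> S = {}" using that edge_cut_iff unfolding inside_def by auto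
    then have "\<pi> T = 0" if "e \<in> edge_cut E T" for T
      using that S unfolding \<pi>_def below_def edge_cut_iff by auto
    then show ?thesis unfolding load_def by (intro sum.neutral) auto
  qed
  have phase': "\<forall>l<Suc m. \<forall>S\<in>dix. (\<forall>k<l. R k S + D k S = \<Gamma> k S) \<longrightarrow> R l S + D l S \<ge> \<Gamma> l S"
     "\<forall>l<Suc m. \<forall>S\<in>dix. (\<forall>k<l. - R k S + D k S = \<Gamma> k S) \<longrightarrow> - R l S + D l S \<le> \<Gamma> l S"
     "L = {S \<in> dix. \<exists>l<Suc m. R l S + D l S \<noteq> \<Gamma> l S}"
     "M = {S \<in> dix. \<exists>l<Suc m. - R l S + D l S \<noteq> \<Gamma> l S}"
     "N = {e \<in> E. \<exists>l<Suc m. load dix (D l) e \<noteq> lc l e}"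
     "Q = {S \<in> tight_sets E \<F> x. \<exists>l<Suc m. D l S \<noteq> 0}"
     "recession_nonneg \<F> x L M N Q"
    using phase unfolding dual_phase_def Let_def by blast+
  have l0: "l0 < Suc m" using D_above pos by (metis not_less_eq)
  have "D_feasible V E \<F> x (\<lambda>_. 0) (\<lambda>_. 0) L M N Q (\<rho>, \<pi>)"
    unfolding D_feasible_iff load_\<pi>
  proof (intro conjI ballI)
    fix T assume T: "T \<in> dix - L"
    then have R: "R l T + D l T = \<Gamma> l T" if "l \<le> m" for l
      using that unfolding phase'(3) by (auto simp: less_Suc_eq_le)
    have "d T \<ge> 0" if J: "T \<in> ?J"
    proof -
      \<comment> \<open>Below level \<open>i\<close> the duals agree, so tightness of the lower
        bound forces \<open>R\<close> to vanish and the upper bound to be tight too. It is thus in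
        force at level \<open>i\<close> and fixes the sign of \<open>d T\<close>.\<close>
      have "R l T = 0" if "l < i" for l using R[of l] agree[OF that J] i that by simp
      then have "- R k T + D k T = \<Gamma> k T" if "k < i" for k using agree[OF that J] that by simp
      then have "- R i T + D i T \<le> \<Gamma> i T" using phase'(2) T i by (simp add: less_Suc_eq_le)
      then show ?thesis using R[OF i] unfolding d_def by simp
    qed
    then show "0 \<le> \<rho> T + \<pi> T" unfolding \<rho>_def \<pi>_def by auto
  next
    fix T assume T: "T \<in> dix - M"
    then have R: "- R l T + D l T = \<Gamma> l T" if "l \<le> m" for l
      using that unfolding phase'(4) by (auto simp: less_Suc_eq_le)
    have "d T \<le> 0" if J: "T \<in> ?J"
    proof -
      have "R l T = 0" if "l < i" for l using R[of l] agree[OF that J] i that by simp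
      then have "R k T + D k T = \<Gamma> k T" if "k < i" for k using agree[OF that J] that by simp
      then have "R i T + D i T \<ge> \<Gamma> i T" using phase'(1) T i by (simp add: less_Suc_eq_le)
      then show ?thesis using R[OF i] unfolding d_def by simp
    qed
    then show "- \<rho> T + \<pi> T \<le> 0" unfolding \<rho>_def \<pi>_def by auto
  next
    fix e assume e: "e \<in> supp E x"
    then have eE: "e \<in> E" "x e \<noteq> 0" unfolding supp_def by auto
    consider "e \<in> inside S" | "e \<in> edge_cut E S" | "e \<notin> inside S" "e \<notin> edge_cut E S" by blast
    then show "load idx \<pi> e = 0"
    proof cases
      case 1
      then show ?thesis using z1[OF 1] eE supp_tight[OF i e] inside_\<pi>[OF 1] unfolding p1_def by simp
    next
      case 2
      then show ?thesis using cut_\<pi>[OF 2] delta_eq[OF 2 e refl] by simp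
    next
      case 3
      then show ?thesis using out_\<pi>[OF eE(1)] by simp
    qed
  next
    fix e assume e: "e \<in> E - (supp E x \<union> N)"
    then have tight: "load idx (D l) e = lc l e" if "l \<le> m" for l
      using that unfolding phase'(5) load_dix by (auto simp: less_Suc_eq_le)
    consider "e \<in> inside S" | "e \<in> edge_cut E S" | "e \<notin> inside S" "e \<notin> edge_cut E S" by blast
    then show "load idx \<pi> e \<le> 0"
    proof cases
      case 1
      then show ?thesis using inside_\<pi>[OF 1] tight[OF i] G_slack[OF 1] tight i by simp
    next
      case 2
      then show ?thesis using cut_\<pi>[OF 2] delta_le[OF endpoint(2)[OF 2]] by simp
    next
      case 3
      then show ?thesis using out_\<pi> e by simp
    qed
  next
    fix T assume T: "T \<in> tight_sets E \<F> x - Q"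
    then have TF: "T \<in> \<F>" unfolding tight_sets_def by auto
    have D0: "D l T = 0" if "l \<le> m" for l
      using T that unfolding phase'(6) by (auto simp: less_Suc_eq_le)
    \<comment> \<open>Since \<open>D\<close> is nonzero at S, the set S belongs to \<open>Q\<close>,
      and its possibly negative value -tot is admissible.\<close>
    have "T \<noteq> S" using D0 pos l0 by (auto simp: less_Suc_eq_le)
    moreover have "d T \<ge> 0" if J: "T \<in> ?J"
    proof -
      have "lex_nonneg m (\<lambda>l. \<Gamma> l T)" using critical TF unfolding critical_family_def by blast
      from lex_nonnegD[OF this i] have "\<Gamma> i T \<ge> 0" using agree[OF _ J] D0 i by force
      then show ?thesis using D0[OF i] unfolding d_def by simp
    qed
    ultimately show "0 \<le> \<pi> T" unfolding \<pi>_def by auto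
  qed
  then have "0 \<le> (\<Sum>T\<in>dix. 1 / real (card T) * \<rho> T)"
    using phase'(7) unfolding recession_nonneg_def by blast
  also have "\<dots> = (\<Sum>T\<in>insert S ?J. 1 / real (card T) * \<rho> T)"
  proof -
    have 1: "(\<Sum>T\<in>dix. 1 / real (card T) * \<rho> T) = (\<Sum>T\<in>idx. 1 / real (card T) * \<rho> T)"
      by (rule sum.mono_neutral_left[OF finite_idx dix_subset])
        (use d_not_dix S_dix in \<open>auto simp: \<rho>_def\<close>)
    have "(\<Sum>T\<in>insert S ?J. 1 / real (card T) * \<rho> T) = (\<Sum>T\<in>idx. 1 / real (card T) * \<rho> T)"
      by (rule sum.mono_neutral_left[OF finite_idx])
        (use S in \<open>auto simp: \<rho>_def below_def\<close>)
    then show ?thesis using 1 by simp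
  qed
  also have "\<dots> = \<bar>tot\<bar> / real (card S) - (\<Sum>T\<in>?J. \<bar>d T\<bar> / real (card T))"
    using finite_below S_notJ by (simp add: \<rho>_def sum_negf)
  finally have ineq: "(\<Sum>T\<in>?J. \<bar>d T\<bar> / real (card T)) \<le> \<bar>tot\<bar> / real (card S)" by simp
  have finS: "finite S" using F_subset[OF S] finite_V finite_subset by blast
  \<comment> \<open>The triangle inequality bounds the price at S by the deviations charged at rate
    1/|S|. The gain uses the larger rates 1/|T|, so no deviation can be nonzero.\<close>
  have "\<bar>tot\<bar> / real (card S) \<le> (\<Sum>T\<in>?J. \<bar>d T\<bar>) / real (card S)"
    unfolding tot_def by (intro divide_right_mono sum_abs) simp
  then have le0: "(\<Sum>T\<in>?J. \<bar>d T\<bar> / real (card T) - \<bar>d T\<bar> / real (card S)) \<le> 0"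
    using ineq by (simp add: sum_subtractf sum_divide_distrib)
  have cardT: "0 < card T \<and> card T < card S" if "T \<in> ?J" for T
  proof -
    have "T \<subset> S" "T \<noteq> {}" using that F_odd[of T] unfolding below_def singletons_def by auto
    then show ?thesis using psubset_card_mono[OF finS] finite_subset[OF _ finS, of T] by (auto simp: card_gt_0_iff)
  qed
  have each: "\<bar>d T\<bar> / real (card T) - \<bar>d T\<bar> / real (card S) \<ge> 0" if "T \<in> ?J" for T
    using cardT[OF that] by (simp add: frac_le)
  have "\<bar>d T\<bar> / real (card T) - \<bar>d T\<bar> / real (card S) = 0"
  proof -
    have "(\<Sum>T\<in>?J. \<bar>d T\<bar> / real (card T) - \<bar>d T\<bar> / real (card S)) = 0"
      using le0 sum_nonneg[of ?J "\<lambda>T. \<bar>d T\<bar> / real (card T) - \<bar>d T\<bar> / real (card S)"] each by force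
    then show ?thesis using sum_nonneg_eq_0_iff[OF finite_below each] less.prems(2) by auto
  qed
  then have "\<bar>d T\<bar> * (real (card S) - real (card T)) = 0"
    using cardT[OF less.prems(2)] by (simp add: field_simps)
  then have "d T = 0" using cardT[OF less.prems(2)] by simp
  then show "D i T = \<Gamma> i T" unfolding d_def by simp
qed

end

section \<open>Half-integrality\<close>

text \<open>Isolates what the analysis of \<open>x\<close> uses: \<open>Et\<close> are the edges
  tight at all levels. Uniqueness ranges over real vectors of any sign, which makes the kernel of
  the linear system trivial.\<close>

locale critical_structure = finite_graph V E for V :: "'v set" and E :: "'v set set" +
  fixes H :: "'v set set" and Et :: "'v set set" and x :: "'v set \<Rightarrow> real"
  assumes H_subset: "S \<in> H \<Longrightarrow> S \<subseteq> V" and H_odd: "S \<in> H \<Longrightarrow> odd (card S)" and H_laminar: "laminar H"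
    and Et_subset: "Et \<subseteq> E" and x_nonneg: "x e \<ge> 0" and x_off: "e \<notin> Et \<Longrightarrow> x e = 0"
    and x_cut: "T \<in> singletons V \<union> H \<Longrightarrow> (\<Sum>e\<in>edge_cut E T. x e) = 1"
    and x_unique: "(\<And>e. e \<notin> Et \<Longrightarrow> y e = 0) \<Longrightarrow>
      (\<And>T. T \<in> singletons V \<union> H \<Longrightarrow> (\<Sum>e\<in>edge_cut E T. y e) = 1) \<Longrightarrow> y = x"
    and H_critical: "S \<in> H \<Longrightarrow> u \<in> S \<Longrightarrow> \<exists>K. critical_matching H S u K \<and> K \<subseteq> Et"
begin

lemma finite_H: "finite H"
  by (rule finite_subset[of _ "Pow V"]) (use H_subset finite_V in auto)

section \<open>Contraction of the maximal sets\<close>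

definition top_set :: "'v set \<Rightarrow> bool" where
  "top_set S \<longleftrightarrow> S \<in> H \<and> (\<forall>T\<in>H. S \<subseteq> T \<longrightarrow> T = S)"

lemma top_set_exists: "S \<in> H \<Longrightarrow> \<exists>S'. top_set S' \<and> S \<subseteq> S'"
  using finite_has_maximal2[OF finite_H, of S] unfolding top_set_def by metis

lemma top_set_H: "top_set S \<Longrightarrow> S \<in> H"
  unfolding top_set_def by simp

lemma top_set_unique:
  assumes "top_set S" "top_set S'" "v \<in> S" "v \<in> S'"
  shows "S = S'"
proof -
  have "S \<subseteq> S' \<or> S' \<subseteq> S \<or> S \<inter> S' = {}"
    using assms H_laminar unfolding top_set_def laminar_def by blast
  then have "S \<subseteq> S' \<or> S' \<subseteq> S" using assms(3,4) by auto
  then show ?thesis using assms(1,2) unfolding top_set_def by metis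
qed

text \<open>Contracting the maximal sets of \<open>H\<close> leaves a multigraph with vertices \<open>nodes\<close> and
  edges \<open>outer\<close>.\<close>

definition nodes :: "'v set set" where
  "nodes = {S. top_set S} \<union> {{v} | v. v \<in> V \<and> v \<notin> \<Union>H}"

definition outer :: "'v set set" where
  "outer = {e \<in> Et. \<not> (\<exists>S. top_set S \<and> e \<subseteq> S)}"

lemma nodes_index: "p \<in> nodes \<Longrightarrow> p \<in> singletons V \<union> H"
  unfolding nodes_def singletons_def top_set_def by auto

lemma finite_nodes: "finite nodes"
  by (rule finite_subset[of _ "singletons V \<union> H"])
    (use nodes_index finite_H finite_V finite_singletons in auto)

lemma node_exists: "v \<in> V \<Longrightarrow> \<exists>p\<in>nodes. v \<in> p"
proof (cases "v \<in> \<Union>H")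
  case True
  then obtain S where "top_set S" "v \<in> S" using top_set_exists by blast
  then show ?thesis unfolding nodes_def by auto
qed (auto simp: nodes_def)

lemma node_unique:
  assumes "p \<in> nodes" "q \<in> nodes" "v \<in> p" "v \<in> q"
  shows "p = q"
  using assms top_set_unique top_set_H unfolding nodes_def by auto

lemma node_edge_not_inside:
  assumes "p \<in> nodes" "e \<in> edge_cut E p" "top_set S"
  shows "\<not> e \<subseteq> S"
proof
  assume "e \<subseteq> S"
  have "S \<in> nodes" using assms(3) unfolding nodes_def by simp
  obtain v where v: "v \<in> e" "v \<in> p" using assms(2) edge_cut_iff by auto
  then have "p = S" using node_unique[OF assms(1) \<open>S \<in> nodes\<close>] \<open>e \<subseteq> S\<close> by auto
  then show False using assms(2) \<open>e \<subseteq> S\<close> edge_cut_iff by auto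
qed

lemma node_edge_outer: "p \<in> nodes \<Longrightarrow> e \<in> edge_cut E p \<Longrightarrow> e \<in> Et \<Longrightarrow> e \<in> outer"
  using node_edge_not_inside unfolding outer_def by auto

definition K :: "'v set \<Rightarrow> 'v \<Rightarrow> 'v set set" where
  "K S u = (SOME K. critical_matching H S u K \<and> K \<subseteq> Et)"

lemma K:
  assumes "S \<in> H" "u \<in> S"
  shows "critical_matching H S u (K S u)" and "K S u \<subseteq> Et"
  using someI_ex[OF H_critical[OF assms]] unfolding K_def by auto

text \<open>Continues a vector on the contracted graph into the contracted sets by critical
  matchings. The choice in \<open>SOME\<close> is determined, since an edge lies inside at most one
  maximal set.\<close>

definition lift :: "('v set \<Rightarrow> real) \<Rightarrow> 'v set \<Rightarrow> real" where
  "lift y e = (if e \<in> Et then if e \<in> outer then y e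
     else let S = (SOME S. top_set S \<and> e \<subseteq> S) in extension S (K S) y e else 0)"

lemma lift_inside:
  assumes "top_set S" "e \<in> inside S"
  shows "lift y e = extension S (K S) y e"
proof -
  have e: "e \<in> E" "e \<subseteq> S" using assms(2) unfolding inside_def by auto
  obtain v where v: "v \<in> e" using edge_endpoints[OF e(1)] by blast
  have "(SOME S. top_set S \<and> e \<subseteq> S) = S"
    by (rule some_equality) (use assms(1) e v top_set_unique in blast)+
  moreover have "e \<notin> outer" using assms(1) e unfolding outer_def by auto
  moreover have "extension S (K S) y e = 0" if "e \<notin> Et"
  proof -
    have "e \<notin> K S (endpoint S f)" if "f \<in> edge_cut E S" for f
      using K(2)[OF top_set_H[OF assms(1)] endpoint(2)[OF that]] \<open>e \<notin> Et\<close> by auto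
    then show ?thesis unfolding extension_def by (intro sum.neutral) auto
  qed
  ultimately show ?thesis unfolding lift_def by (simp add: Let_def)
qed

lemma lift_node_edge:
  assumes "\<And>e. e \<notin> outer \<Longrightarrow> y e = 0" "p \<in> nodes" "e \<in> edge_cut E p"
  shows "lift y e = y e"
  using node_edge_outer[OF assms(2,3)] assms(1)[of e] unfolding lift_def outer_def by auto

text \<open>A cut inside a maximal set inherits the value of that set's cut by
  \<open>extension_cut\<close>; any other index is a singleton outside all members, which is a
  node.\<close>

lemma lift_cut:
  assumes y: "\<And>e. e \<notin> outer \<Longrightarrow> y e = 0" and t: "\<And>p. p \<in> nodes \<Longrightarrow> (\<Sum>e\<in>edge_cut E p. y e) = t"
    and T: "T \<in> singletons V \<union> H"
  shows "(\<Sum>e\<in>edge_cut E T. lift y e) = t"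
proof (cases "\<exists>S. top_set S \<and> T \<subseteq> S")
  case True
  then obtain S where S: "top_set S" "T \<subseteq> S" by blast
  have Sn: "S \<in> nodes" using S unfolding nodes_def by simp
  have SH: "S \<in> H" using top_set_H[OF S(1)] .
  have TS: "T \<in> singletons S \<union> H" using T S(2) unfolding singletons_def by auto
  have "(\<Sum>e\<in>edge_cut E T. lift y e) =
      (\<Sum>e\<in>inside S \<inter> edge_cut E T. lift y e) + (\<Sum>f\<in>edge_cut E S \<inter> edge_cut E T. lift y f)"
    by (subst edge_cut_split(1)[OF S(2)], subst sum.union_disjoint)
      (use edge_cut_split(2)[OF S(2)] finite_inside finite_edge_cut in auto)
  also have "(\<Sum>e\<in>inside S \<inter> edge_cut E T. lift y e) =
      (\<Sum>e\<in>inside S \<inter> edge_cut E T. extension S (K S) y e)"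
    using lift_inside[OF S(1)] by (intro sum.cong) auto
  also have "(\<Sum>f\<in>edge_cut E S \<inter> edge_cut E T. lift y f) = (\<Sum>f\<in>edge_cut E S \<inter> edge_cut E T. y f)"
    using lift_node_edge[OF y Sn] by (intro sum.cong) auto
  also have "(\<Sum>e\<in>inside S \<inter> edge_cut E T. extension S (K S) y e) +
      (\<Sum>f\<in>edge_cut E S \<inter> edge_cut E T. y f) = (\<Sum>f\<in>edge_cut E S. y f)"
    by (rule extension_cut[OF K(1)[OF SH] TS S(2)])
  also have "\<dots> = t" using t[OF Sn] .
  finally show ?thesis .
next
  case False
  then have "T \<notin> H" using top_set_exists by blast
  then obtain v where v: "T = {v}" "v \<in> V" using T unfolding singletons_def by auto
  have "v \<notin> \<Union>H" using False v top_set_exists by blast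
  then have Tn: "T \<in> nodes" using v unfolding nodes_def by auto
  have "(\<Sum>e\<in>edge_cut E T. lift y e) = (\<Sum>e\<in>edge_cut E T. y e)"
    using lift_node_edge[OF y Tn] by (intro sum.cong) auto
  then show ?thesis using t[OF Tn] by simp
qed

lemma lift_off: "e \<notin> Et \<Longrightarrow> lift y e = 0"
  unfolding lift_def by simp

lemma contracted_unique:
  assumes "\<And>e. e \<notin> outer \<Longrightarrow> y e = 0" "\<And>p. p \<in> nodes \<Longrightarrow> (\<Sum>e\<in>edge_cut E p. y e) = 1"
  shows "lift y = x"
  using lift_cut[OF assms] lift_off by (intro x_unique) auto

definition x_out :: "'v set \<Rightarrow> real" where
  "x_out e = (if e \<in> outer then x e else 0)"

lemma x_out_node: "p \<in> nodes \<Longrightarrow> e \<in> edge_cut E p \<Longrightarrow> x_out e = x e"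
  unfolding x_out_def using node_edge_outer x_off by (cases "e \<in> Et") auto

lemma x_out_cut: "p \<in> nodes \<Longrightarrow> (\<Sum>e\<in>edge_cut E p. x_out e) = 1"
  using x_cut[OF nodes_index] x_out_node by (metis (mono_tags, lifting) sum.cong)

lemma lift_x_out: "lift x_out = x"
  by (rule contracted_unique) (use x_out_cut in \<open>auto simp: x_out_def\<close>)

text \<open>The restriction of \<open>x\<close> to the outer edges lifts to a solution, which by
  uniqueness is \<open>x\<close> again. So \<open>x\<close> inside a maximal set is determined by
  its values on the cut.\<close>

lemma x_inside:
  assumes "top_set S" "e \<in> inside S"
  shows "x e = extension S (K S) x e"
proof -
  have Sn: "S \<in> nodes" using assms unfolding nodes_def by simp
  have "x e = extension S (K S) x_out e" using lift_inside[OF assms, of x_out] lift_x_out by simp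
  also have "\<dots> = extension S (K S) x e"
    unfolding extension_def using x_out_node[OF Sn] by (intro sum.cong) auto
  finally show ?thesis .
qed

lemma contracted_solution:
  assumes "\<And>e. e \<notin> outer \<Longrightarrow> y e = 0" "\<And>p. p \<in> nodes \<Longrightarrow> (\<Sum>e\<in>edge_cut E p. y e) = 1" "e \<in> outer"
  shows "y e = x e"
proof -
  have "lift y e = x e" using contracted_unique[OF assms(1,2)] by simp
  then show ?thesis using assms(3) unfolding lift_def outer_def by auto
qed

text \<open>Adding \<open>z\<close> to the outer part of \<open>x\<close> would give a second
  solution.\<close>

lemma contracted_kernel:
  fixes z :: "'v set \<Rightarrow> real"
  assumes "\<And>e. e \<notin> outer \<Longrightarrow> z e = 0" "\<And>p. p \<in> nodes \<Longrightarrow> (\<Sum>e\<in>edge_cut E p. z e) = 0" "e \<in> outer"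
  shows "z e = 0"
proof -
  have "(\<lambda>e. x_out e + z e) e = x e"
    by (rule contracted_solution) (use assms x_out_cut in \<open>auto simp: x_out_def sum.distrib\<close>)
  then show ?thesis using assms(3) unfolding x_out_def by simp
qed

lemma outer_two_nodes:
  assumes "e \<in> outer"
  shows "card {p \<in> nodes. e \<in> edge_cut E p} = 2"
proof -
  have e: "e \<in> E" "\<And>S. top_set S \<Longrightarrow> \<not> e \<subseteq> S" using assms Et_subset unfolding outer_def by auto
  obtain a b where ab: "e = {a, b}" "a \<noteq> b" "a \<in> V" "b \<in> V" using edge_endpoints[OF e(1)] by metis
  obtain p q where p: "p \<in> nodes" "a \<in> p" and q: "q \<in> nodes" "b \<in> q" using node_exists ab by metis
  have bp: "b \<notin> p" and aq: "a \<notin> q"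
    using p q e(2) ab unfolding nodes_def by auto
  have "{p \<in> nodes. e \<in> edge_cut E p} = {p, q}"
  proof (intro set_eqI iffI)
    fix r assume "r \<in> {p \<in> nodes. e \<in> edge_cut E p}"
    then have r: "r \<in> nodes" "a \<in> r \<or> b \<in> r" unfolding edge_cut_iff ab by auto
    then show "r \<in> {p, q}" using node_unique p q by blast
  next
    fix r assume "r \<in> {p, q}"
    then show "r \<in> {p \<in> nodes. e \<in> edge_cut E p}"
      using p q bp aq e(1) unfolding edge_cut_iff ab by auto
  qed
  moreover have "p \<noteq> q" using bp q by auto
  ultimately show ?thesis by simp
qed

section \<open>Half-integrality of the solution\<close>

lemma x_le_1: "x e \<le> 1"
proof (cases "e \<in> Et")
  case True
  then obtain a b where ab: "e = {a, b}" "a \<in> V" using edge_endpoints Et_subset by (metis subsetD)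
  have "x e \<le> (\<Sum>e\<in>edge_cut E {a}. x e)"
    using ab True Et_subset x_nonneg
    by (intro member_le_sum finite_edge_cut) (auto simp: edge_cut_singleton)
  then show ?thesis using x_cut[of "{a}"] ab by (simp add: singleton_in_singletons)
qed (simp add: x_off)

text \<open>By triviality of the kernel, there are at most as many fractional outer edges as nodes they
  meet. Since each such node meets at least two of them, it meets exactly two, and then replacing
  \<open>x e\<close> by \<open>1 - x e\<close> on the fractional edges gives another solution.\<close>

lemma outer_half_integral:
  assumes "e0 \<in> outer"
  shows "x e0 = 0 \<or> x e0 = 1 / 2 \<or> x e0 = 1"
proof -
  define Ef where "Ef = {e \<in> outer. 0 < x e \<and> x e < 1}"
  define Nf where "Nf = {p \<in> nodes. Ef \<inter> edge_cut E p \<noteq> {}}"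
  have finE: "finite Ef" by (rule finite_subset[OF _ finite_E]) (use Et_subset in \<open>auto simp: Ef_def outer_def\<close>)
  have finN: "finite Nf" unfolding Nf_def using finite_nodes by simp
  have not_Ef: "x e = 0 \<or> x e = 1" if "p \<in> nodes" "e \<in> edge_cut E p" "e \<notin> Ef" for p e
  proof (cases "x e = 0")
    case False
    then have "e \<in> outer" using node_edge_outer[OF that(1,2)] x_off by blast
    then show ?thesis using that(3) x_nonneg[of e] x_le_1[of e] False unfolding Ef_def by auto
  qed simp
  \<comment> \<open>A node has total weight 1, so next to a fractional edge there is no room for an
    edge of value 1.\<close>
  have rest: "x f = 0" if p: "p \<in> Nf" and f: "f \<in> edge_cut E p" "f \<notin> Ef" for p f
  proof (rule ccontr)
    assume "x f \<noteq> 0"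
    have pn: "p \<in> nodes" using p unfolding Nf_def by simp
    then have f1: "x f = 1" using not_Ef[OF _ f] \<open>x f \<noteq> 0\<close> by blast
    obtain e where e: "e \<in> Ef" "e \<in> edge_cut E p" using p unfolding Nf_def by auto
    have "e \<noteq> f" using e f by auto
    then have "x e + x f = (\<Sum>g\<in>{e, f}. x g)" by simp
    also have "\<dots> \<le> (\<Sum>g\<in>edge_cut E p. x g)"
      by (rule sum_mono2[OF finite_edge_cut]) (use e f x_nonneg in auto)
    also have "\<dots> = 1" using x_cut[OF nodes_index[OF pn]] .
    finally show False using f1 e(1) unfolding Ef_def by simp
  qed
  have sum_Ef: "(\<Sum>e\<in>Ef \<inter> edge_cut E p. x e) = 1" if p: "p \<in> Nf" for p
  proof -
    have "(\<Sum>e\<in>Ef \<inter> edge_cut E p. x e) = (\<Sum>e\<in>edge_cut E p. x e)"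
      by (rule sum.mono_neutral_left[OF finite_edge_cut]) (use rest[OF p] in auto)
    then show ?thesis using x_cut nodes_index p unfolding Nf_def by auto
  qed
  have ge2: "card (Ef \<inter> edge_cut E p) \<ge> 2" if p: "p \<in> Nf" for p
  proof (rule ccontr)
    assume "\<not> ?thesis"
    moreover have "card (Ef \<inter> edge_cut E p) \<noteq> 0" using p finE unfolding Nf_def by auto
    ultimately have "card (Ef \<inter> edge_cut E p) = 1" by linarith
    then obtain e where e: "Ef \<inter> edge_cut E p = {e}" using card_1_singletonE by blast
    then have "x e < 1" unfolding Ef_def by auto
    then show False using sum_Ef[OF p] unfolding e by simp
  qed
  \<comment> \<open>Handshake count in the contracted graph, where every outer edge meets exactly
    two nodes.\<close>
  have count: "(\<Sum>p\<in>Nf. card (Ef \<inter> edge_cut E p)) = 2 * card Ef"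
  proof -
    have "(\<Sum>p\<in>Nf. card (Ef \<inter> edge_cut E p)) = (\<Sum>p\<in>nodes. card (Ef \<inter> edge_cut E p))"
      by (rule sum.mono_neutral_left[OF finite_nodes]) (auto simp: Nf_def)
    also have "\<dots> = (\<Sum>p\<in>nodes. \<Sum>e\<in>Ef. if e \<in> edge_cut E p then 1 else 0)"
      using finE by (simp add: sum.If_cases Int_def)
    also have "\<dots> = (\<Sum>e\<in>Ef. \<Sum>p\<in>nodes. if e \<in> edge_cut E p then 1 else 0)" by (rule sum.swap)
    also have "\<dots> = (\<Sum>e\<in>Ef. 2)"
    proof (rule sum.cong[OF refl])
      fix e assume "e \<in> Ef"
      then have "card {p \<in> nodes. e \<in> edge_cut E p} = 2" using outer_two_nodes unfolding Ef_def by auto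
      then show "(\<Sum>p\<in>nodes. if e \<in> edge_cut E p then 1 else 0) = (2::nat)"
        using finite_nodes by (simp add: sum.If_cases Int_def)
    qed
    finally show ?thesis by simp
  qed
  have le: "card Ef \<le> card Nf"
  proof (rule ccontr)
    assume "\<not> ?thesis"
    then have "card Nf < card Ef" by simp
    from underdetermined_system[OF finN finE this, of "\<lambda>p e. if e \<in> edge_cut E p then 1 else 0"]
    obtain z :: "'v set \<Rightarrow> real" and e where z: "e \<in> Ef" "z e \<noteq> 0"
      "\<And>p. p \<in> Nf \<Longrightarrow> (\<Sum>e\<in>Ef. (if e \<in> edge_cut E p then 1 else 0) * z e) = 0" by blast
    define z' where "z' = (\<lambda>e. if e \<in> Ef then z e else 0)"
    have "(\<Sum>e\<in>edge_cut E p. z' e) = 0" if "p \<in> nodes" for p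
    proof (cases "p \<in> Nf")
      case True
      have "(\<Sum>e\<in>edge_cut E p. z' e) = (\<Sum>e\<in>Ef \<inter> edge_cut E p. z e)"
        unfolding z'_def using finite_edge_cut by (simp add: sum.If_cases Int_def conj_commute)
      also have "\<dots> = (\<Sum>e\<in>Ef. (if e \<in> edge_cut E p then 1 else 0) * z e)"
        using finE by (auto simp: sum.inter_restrict intro!: sum.cong)
      finally show ?thesis using z(3)[OF True] by simp
    next
      case False
      then have "Ef \<inter> edge_cut E p = {}" using that unfolding Nf_def by auto
      then show ?thesis unfolding z'_def by (intro sum.neutral) auto
    qed
    moreover have "z' e = 0" if "e \<notin> outer" for e using that unfolding z'_def Ef_def by auto
    ultimately have "z' e = 0" using contracted_kernel[of z' e] z(1) unfolding Ef_def by auto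
    then show False using z unfolding z'_def by simp
  qed
  have eq2: "card (Ef \<inter> edge_cut E p) = 2" if p: "p \<in> Nf" for p
  proof (rule ccontr)
    assume "card (Ef \<inter> edge_cut E p) \<noteq> 2"
    then have "card (Ef \<inter> edge_cut E p) > 2" using ge2[OF p] by simp
    then have "(\<Sum>p\<in>Nf. 2) < (\<Sum>p\<in>Nf. card (Ef \<inter> edge_cut E p))"
      using ge2 p finN by (intro sum_strict_mono_ex1) auto
    then show False using count le by simp
  qed
  define y where "y = (\<lambda>e. if e \<in> Ef then 1 - x e else x_out e)"
  have Ef_out: "Ef \<subseteq> outer" unfolding Ef_def by auto
  have "(\<Sum>e\<in>edge_cut E p. y e) = 1" if p: "p \<in> nodes" for p
  proof (cases "p \<in> Nf")
    case True
    have "(\<Sum>e\<in>edge_cut E p. y e) = (\<Sum>e\<in>Ef \<inter> edge_cut E p. y e)"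
      using rest[OF True] by (intro sum.mono_neutral_right finite_edge_cut) (auto simp: y_def x_out_def)
    also have "\<dots> = (\<Sum>e\<in>Ef \<inter> edge_cut E p. 1 - x e)" by (intro sum.cong) (auto simp: y_def)
    also have "\<dots> = 1" using sum_Ef[OF True] eq2[OF True] by (simp add: sum_subtractf)
    finally show ?thesis .
  next
    case False
    then have "Ef \<inter> edge_cut E p = {}" using p unfolding Nf_def by auto
    then have "(\<Sum>e\<in>edge_cut E p. y e) = (\<Sum>e\<in>edge_cut E p. x_out e)"
      by (intro sum.cong) (auto simp: y_def)
    then show ?thesis using x_out_cut[OF p] by simp
  qed
  moreover have "y e = 0" if "e \<notin> outer" for e using that Ef_out unfolding y_def x_out_def by auto
  ultimately have "y e0 = x e0" using contracted_solution[of y e0] assms by blast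
  then show ?thesis
    using x_nonneg[of e0] x_le_1[of e0] assms unfolding y_def Ef_def by (auto split: if_splits)
qed

text \<open>Inside a maximal set, \<open>x e\<close> is a sum of values on the outer cut edges.
  Twice this sum is an integer between 0 and 2.\<close>

lemma half_integral: "x e = 0 \<or> x e = 1 / 2 \<or> x e = 1"
proof (cases "e \<in> Et \<and> e \<notin> outer")
  case True
  then obtain S where S: "top_set S" "e \<subseteq> S" unfolding outer_def by auto
  have Sn: "S \<in> nodes" using S unfolding nodes_def by simp
  have e: "e \<in> inside S" using True S Et_subset unfolding inside_def by auto
  have "2 * x f \<in> \<int>" if "f \<in> edge_cut E S" for f
  proof -
    have "x f = 0 \<or> x f = 1 / 2 \<or> x f = 1"
      using node_edge_outer[OF Sn that] outer_half_integral x_off by blast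
    then have "2 * x f = 0 \<or> 2 * x f = 1 \<or> 2 * x f = 2" by linarith
    then show ?thesis by (elim disjE) (simp_all only: Ints_0 Ints_1 Ints_numeral)
  qed
  then have "(\<Sum>f\<in>edge_cut E S. 2 * x f * (if e \<in> K S (endpoint S f) then 1 else 0)) \<in> \<int>"
    by (intro Ints_sum) simp
  moreover have "2 * x e = (\<Sum>f\<in>edge_cut E S. 2 * x f * (if e \<in> K S (endpoint S f) then 1 else 0))"
    by (subst x_inside[OF S(1) e]) (simp add: extension_def sum_distrib_left mult.assoc)
  ultimately have "2 * x e \<in> \<int>" by simp
  then obtain k :: int where k: "2 * x e = of_int k" by (auto elim: Ints_cases)
  have "0 \<le> k" "k \<le> 2" using k x_nonneg[of e] x_le_1[of e] by linarith+
  then have "k = 0 \<or> k = 1 \<or> k = 2" by auto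
  then show ?thesis using k by auto
next
  case False
  then show ?thesis using outer_half_integral x_off by blast
qed

text \<open>By \<open>x_inside\<close> every edge of this matching carries at least the value
  \<open>x f\<close>.\<close>

lemma critical_in_support:
  assumes S: "top_set S" and f: "f \<in> edge_cut E S" "x f > 0"
  shows "K S (endpoint S f) \<subseteq> supp E x"
proof
  fix e assume e: "e \<in> K S (endpoint S f)"
  note cm = K(1)[OF top_set_H[OF S] endpoint(2)[OF f(1)]]
  have ein: "e \<in> inside S" using critical_matchingD(1)[OF cm] e by auto
  have "x f = x f * (if e \<in> K S (endpoint S f) then 1 else 0)" using e by simp
  also have "\<dots> \<le> extension S (K S) x e" unfolding extension_def
    using f(1) x_nonneg finite_edge_cut by (intro member_le_sum) auto
  also have "\<dots> = x e" using x_inside[OF S ein] by simp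
  finally show "e \<in> supp E x" using f(2) ein unfolding supp_def inside_def by auto
qed

end

section \<open>Cycles\<close>

lemma is_cycle_rotate:
  assumes "is_cycle A vs"
  shows "is_cycle A (rotate k vs)"
proof -
  let ?n = "length vs"
  have n: "?n \<ge> 3" "distinct vs" and edges: "\<And>i. i < ?n \<Longrightarrow> {vs ! i, vs ! (Suc i mod ?n)} \<in> A"
    using assms unfolding is_cycle_def by auto
  have "{rotate k vs ! i, rotate k vs ! (Suc i mod ?n)} \<in> A" if "i < ?n" for i
  proof -
    have "?n > 0" using n by linarith
    then have "Suc i mod ?n < ?n" by simp
    then have "rotate k vs ! (Suc i mod ?n) = vs ! ((k + Suc i mod ?n) mod ?n)"
      by (simp add: nth_rotate)
    also have "(k + Suc i mod ?n) mod ?n = Suc ((k + i) mod ?n) mod ?n"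
      by (simp add: mod_simps)
    finally have "rotate k vs ! (Suc i mod ?n) = vs ! (Suc ((k + i) mod ?n) mod ?n)" .
    moreover have "rotate k vs ! i = vs ! ((k + i) mod ?n)" using that by (simp add: nth_rotate)
    moreover have "(k + i) mod ?n < ?n" using \<open>?n > 0\<close> by simp
    ultimately show ?thesis using edges by simp
  qed
  then show ?thesis using n unfolding is_cycle_def by simp
qed

lemma is_cycle_start:
  assumes "is_cycle A vs" "a \<in> set vs"
  shows "\<exists>ws. is_cycle A (a # ws) \<and> set (a # ws) = set vs \<and> length (a # ws) = length vs"
proof -
  obtain k where k: "k < length vs" "vs ! k = a" using assms(2) by (auto simp: in_set_conv_nth)
  have "rotate k vs ! 0 = a" using k by (subst nth_rotate) auto
  moreover have "rotate k vs \<noteq> []" using k by auto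
  ultimately obtain ws where ws: "rotate k vs = a # ws" by (cases "rotate k vs") auto
  have "set (a # ws) = set vs" "length (a # ws) = length vs"
    unfolding ws[symmetric] by simp_all
  then show ?thesis using is_cycle_rotate[OF assms(1), of k] ws by auto
qed

lemma is_cycle_two_neighbours:
  assumes "is_cycle A vs" "v \<in> set vs"
  shows "\<exists>a\<in>set vs. \<exists>b\<in>set vs. a \<noteq> b \<and> a \<noteq> v \<and> b \<noteq> v \<and> {v, a} \<in> A \<and> {v, b} \<in> A"
proof -
  obtain ws where ws: "is_cycle A (v # ws)" "set (v # ws) = set vs"
    using is_cycle_start[OF assms] by auto
  then have len: "length ws \<ge> 2" and dist: "distinct (v # ws)"
    and edges: "\<And>i. i \<le> length ws \<Longrightarrow> {(v # ws) ! i, (v # ws) ! (Suc i mod Suc (length ws))} \<in> A"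
    unfolding is_cycle_def by (auto simp: less_Suc_eq_le)
  let ?a = "ws ! 0" and ?b = "ws ! (length ws - 1)"
  have "Suc 0 mod Suc (length ws) = Suc 0" using len by (intro mod_less) linarith
  then have 1: "{v, ?a} \<in> A" using edges[of 0] len by (simp only: nth_Cons_0 nth_Cons_Suc)
  have 2: "{?b, v} \<in> A"
  proof -
    have "(v # ws) ! length ws = ?b" using len by (cases "length ws") auto
    then show ?thesis using edges[of "length ws"] by simp
  qed
  have in_set: "?a \<in> set ws" "?b \<in> set ws" using len by (auto intro: nth_mem)
  then have in_vs: "?a \<in> set vs" "?b \<in> set vs" using ws(2) by auto
  have "?a \<noteq> v" "?b \<noteq> v" using in_set dist by auto
  moreover have "?a \<noteq> ?b" using dist len by (subst nth_eq_iff_index_eq) auto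
  moreover have "{v, ?b} \<in> A" using 2 by (simp add: insert_commute)
  ultimately show ?thesis using 1 in_vs by (intro bexI[of _ ?a] bexI[of _ ?b]) auto
qed

text \<open>Traverse the cycle from a vertex outside \<open>P\<close>: the first entry into
  \<open>P\<close> and the step after the last visit give the two edges.\<close>

lemma is_cycle_crossing:
  assumes "is_cycle A vs" "P \<inter> set vs \<noteq> {}" "\<not> set vs \<subseteq> P"
  shows "\<exists>e\<in>A. \<exists>e'\<in>A. e \<noteq> e' \<and> e \<subseteq> set vs \<and> e' \<subseteq> set vs \<and> e \<inter> P \<noteq> {} \<and> e' \<inter> P \<noteq> {} \<and>
    \<not> e \<subseteq> P \<and> \<not> e' \<subseteq> P"
proof -
  obtain a where a: "a \<in> set vs" "a \<notin> P" using assms(3) by auto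
  obtain ws where ws: "is_cycle A (a # ws)" "set (a # ws) = set vs"
    using is_cycle_start[OF assms(1) a(1)] by auto
  define us where "us = a # ws"
  define n where "n = length us"
  have len: "n \<ge> 3" and dist: "distinct us" and us0: "us ! 0 = a"
    and edges: "\<And>i. i < n \<Longrightarrow> {us ! i, us ! (Suc i mod n)} \<in> A"
    using ws(1) unfolding is_cycle_def us_def n_def by auto
  have set_us: "set us = set vs" using ws(2) unfolding us_def .
  have in_vs: "us ! i \<in> set vs" if "i < n" for i
    using nth_mem[of i us] that unfolding n_def set_us by simp
  obtain k where k: "k < n" "us ! k \<in> P"
    using assms(2) unfolding set_us[symmetric] n_def by (auto simp: in_set_conv_nth)
  define i where "i = (LEAST i. us ! i \<in> P)"
  have i: "us ! i \<in> P" unfolding i_def using k(2) by (rule LeastI)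
  have i_le: "i \<le> k" unfolding i_def using k(2) by (rule Least_le)
  have i_min: "us ! j \<notin> P" if "j < i" for j using that not_less_Least unfolding i_def by blast
  have i_pos: "i \<noteq> 0" using i us0 a by metis
  define j where "j = Max {j. j < n \<and> us ! j \<in> P}"
  have fin: "finite {j. j < n \<and> us ! j \<in> P}" by simp
  have "j \<in> {j. j < n \<and> us ! j \<in> P}" unfolding j_def by (rule Max_in[OF fin]) (use k in auto)
  then have j: "j < n" "us ! j \<in> P" by auto
  have j_max: "l \<le> j" if "l < n" "us ! l \<in> P" for l
    unfolding j_def using that by (intro Max_ge fin) auto
  let ?e = "{us ! (i - 1), us ! i}" and ?e' = "{us ! j, us ! (Suc j mod n)}"
  have nxt: "us ! (Suc j mod n) \<notin> P"
  proof (cases "Suc j = n")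
    case True
    then show ?thesis using us0 a by simp
  next
    case False
    then have "Suc j < n" using j by simp
    then show ?thesis using j_max[of "Suc j"] by auto
  qed
  have prv: "us ! (i - 1) \<notin> P" using i_min i_pos by simp
  have i_n: "i < n" using i_le k by simp
  have sj: "Suc j mod n < n" using len by (intro mod_less_divisor) simp
  have "?e \<in> A" using edges[of "i - 1"] i_pos i_n by (simp add: mod_less)
  moreover have "?e' \<in> A" using edges[OF j(1)] .
  moreover have "?e \<noteq> ?e'"
  proof
    \<comment> \<open>If the two crossings coincided, the cycle would consist of two vertices only;
      this is where length at least 3 matters.\<close>
    assume eq: "?e = ?e'"
    then have "us ! i = us ! j" "us ! (i - 1) = us ! (Suc j mod n)"
      using i prv j nxt by (metis doubleton_eq_iff)+
    then have "i = j" "i - 1 = Suc j mod n"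
      using dist i_n j sj unfolding n_def by (auto simp: nth_eq_iff_index_eq)
    then show False using i_pos len j by (cases "Suc j = n") auto
  qed
  moreover have "?e \<subseteq> set vs" "?e' \<subseteq> set vs" using in_vs i_n j sj by auto
  moreover have "?e \<inter> P \<noteq> {}" "?e' \<inter> P \<noteq> {}" "\<not> ?e \<subseteq> P" "\<not> ?e' \<subseteq> P" using i j prv nxt by auto
  ultimately show ?thesis by (intro bexI[of _ ?e] bexI[of _ ?e']) simp_all
qed

lemma is_cycle_connected:
  assumes "is_cycle A vs" "P \<inter> set vs \<noteq> {}" "\<And>e. e \<in> A \<Longrightarrow> e \<inter> P \<noteq> {} \<Longrightarrow> e \<subseteq> P"
  shows "set vs \<subseteq> P"
  using is_cycle_crossing[OF assms(1,2)] assms(3) by blast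

text \<open>Close up a longest path.\<close>

lemma is_cycle_exists:
  assumes fin: "finite (\<Union>A)" and "v0 \<in> \<Union>A"
    and two: "\<And>v. v \<in> \<Union>A \<Longrightarrow> \<exists>a b. a \<noteq> b \<and> {v, a} \<in> A \<and> {v, b} \<in> A \<and> a \<noteq> v \<and> b \<noteq> v"
  shows "\<exists>vs. is_cycle A vs"
proof -
  define P where "P = (\<lambda>vs. vs \<noteq> [] \<and> distinct vs \<and> set vs \<subseteq> \<Union>A \<and>
    (\<forall>i. Suc i < length vs \<longrightarrow> {vs ! i, vs ! Suc i} \<in> A))"
  have "P [v0]" unfolding P_def using assms(2) by auto
  moreover have "length vs < Suc (card (\<Union>A))" if "P vs" for vs
    using that card_mono[OF fin, of "set vs"] unfolding P_def by (simp add: distinct_card less_Suc_eq_le)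
  ultimately obtain vs where vs: "P vs" "\<And>ws. P ws \<Longrightarrow> length ws \<le> length vs"
    using ex_has_greatest_nat[of P "[v0]" length "Suc (card (\<Union>A))"] by blast
  have ne: "vs \<noteq> []" and dist: "distinct vs" and sub: "set vs \<subseteq> \<Union>A"
    and path: "\<And>i. Suc i < length vs \<Longrightarrow> {vs ! i, vs ! Suc i} \<in> A" using vs(1) unfolding P_def by auto
  define v where "v = vs ! 0"
  have v: "v \<in> set vs" unfolding v_def using ne by simp
  have extend: "a \<in> set vs" if "{v, a} \<in> A" for a
  proof (rule ccontr)
    assume a: "a \<notin> set vs"
    have "{(a # vs) ! i, (a # vs) ! Suc i} \<in> A" if "Suc i < length (a # vs)" for i
    proof (cases i)
      case 0
      then show ?thesis using \<open>{v, a} \<in> A\<close> v_def by (simp add: insert_commute)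
    next
      case (Suc j)
      then show ?thesis using path[of j] that by simp
    qed
    moreover have "a \<in> \<Union>A" using \<open>{v, a} \<in> A\<close> by blast
    ultimately have "P (a # vs)" unfolding P_def using a dist sub by auto
    then show False using vs(2)[of "a # vs"] by simp
  qed
  obtain a b where ab: "a \<noteq> b" "{v, a} \<in> A" "{v, b} \<in> A" "a \<noteq> v" "b \<noteq> v"
    using two[of v] v sub by blast
  obtain k1 where k1: "k1 < length vs" "vs ! k1 = a" using extend[OF ab(2)] by (auto simp: in_set_conv_nth)
  obtain k2 where k2: "k2 < length vs" "vs ! k2 = b" using extend[OF ab(3)] by (auto simp: in_set_conv_nth)
  have "k1 \<noteq> 0" "k2 \<noteq> 0" "k1 \<noteq> k2" using ab k1 k2 unfolding v_def by metis+
  \<comment> \<open>Both neighbours of the start lie on the path at distinct nonzero positions, so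
    one of them closes a cycle of length at least 3.\<close>
  then have "k1 \<ge> 2 \<or> k2 \<ge> 2" by linarith
  then obtain k where k: "k \<ge> 2" "k < length vs" "{vs ! 0, vs ! k} \<in> A"
    using k1 k2 ab unfolding v_def by auto
  have "is_cycle A (take (Suc k) vs)"
    unfolding is_cycle_def
  proof (intro conjI allI impI)
    have len: "length (take (Suc k) vs) = Suc k" using k by simp
    show "length (take (Suc k) vs) \<ge> 3" using k len by simp
    show "distinct (take (Suc k) vs)" using dist by simp
    fix i assume "i < length (take (Suc k) vs)"
    then have i: "i \<le> k" using len by simp
    show "{take (Suc k) vs ! i, take (Suc k) vs ! (Suc i mod length (take (Suc k) vs))} \<in> A"
    proof (cases "i = k")
      case True
      then show ?thesis using k len by (simp add: insert_commute)
    next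
      case False
      then have "Suc i < Suc k" using i by simp
      then show ?thesis using path[of i] k len i by simp
    qed
  qed
  then show ?thesis by blast
qed

section \<open>Matchings along paths and cycles\<close>

context finite_graph
begin

lemma path_matching:
  assumes "even (length ws)" "distinct ws" "\<And>i. Suc i < length ws \<Longrightarrow> {ws ! i, ws ! Suc i} \<in> A" "A \<subseteq> E"
  shows "\<exists>M\<subseteq>A. matching_on (set ws) M"
  using assms(1-3)
proof (induction ws rule: induct_list012)
  case 1
  have "matching_on {} {}" by (rule matching_onI) auto
  then show ?case by auto
next
  case (2 x)
  then show ?case by simp
next
  case (3 x y zs)
  have "{zs ! i, zs ! Suc i} \<in> A" if "Suc i < length zs" for i
    using 3(5)[of "Suc (Suc i)"] that by simp
  then obtain M where M: "M \<subseteq> A" "matching_on (set zs) M" using 3(1,3,4) by auto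
  have xy: "{x, y} \<in> A" using 3(5)[of 0] by simp
  have "matching_on {x, y} {{x, y}}" by (rule matching_onI) (use xy assms(4) in auto)
  from matching_on_Un[OF this M(2)] have "matching_on (set (x # y # zs)) ({{x, y}} \<union> M)"
    using 3(4) by simp
  then show ?case using M(1) xy by (intro exI[of _ "{{x, y}} \<union> M"]) auto
qed

text \<open>Without \<open>a\<close>, the cycle read from \<open>a\<close> is a path with an even
  number of vertices.\<close>

lemma odd_cycle_near_matching:
  assumes "is_cycle A vs" "odd (length vs)" "a \<in> set vs" "A \<subseteq> E"
  shows "\<exists>M\<subseteq>A. matching_on (set vs - {a}) M"
proof -
  obtain ws where ws: "is_cycle A (a # ws)" "set (a # ws) = set vs" "length (a # ws) = length vs"
    using is_cycle_start[OF assms(1,3)] by auto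
  have "\<exists>M\<subseteq>A. matching_on (set ws) M"
  proof (rule path_matching[OF _ _ _ assms(4)])
    show "even (length ws)" using ws(3) assms(2) by (metis even_Suc length_Cons)
    show "distinct ws" using ws(1) unfolding is_cycle_def by simp
    fix i assume i: "Suc i < length ws"
    have "Suc i < length (a # ws)" using i by simp
    then have "{(a # ws) ! Suc i, (a # ws) ! (Suc (Suc i) mod length (a # ws))} \<in> A"
      using ws(1) unfolding is_cycle_def by blast
    moreover have "Suc (Suc i) mod length (a # ws) = Suc (Suc i)" using i by (intro mod_less) simp
    ultimately show "{ws ! i, ws ! Suc i} \<in> A" by (simp only: nth_Cons_Suc)
  qed
  moreover have "set ws = set vs - {a}" using ws(1,2) unfolding is_cycle_def by auto
  ultimately show ?thesis by simp
qed

lemma even_cycle_matching: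
  assumes "is_cycle A vs" "even (length vs)" "A \<subseteq> E"
  shows "\<exists>M\<subseteq>A. matching_on (set vs) M"
proof (rule path_matching[OF assms(2) _ _ assms(3)])
  show "distinct vs" using assms(1) unfolding is_cycle_def by simp
  fix i assume i: "Suc i < length vs"
  have "{vs ! i, vs ! (Suc i mod length vs)} \<in> A"
    using assms(1) Suc_lessD[OF i] unfolding is_cycle_def by blast
  then show "{vs ! i, vs ! Suc i} \<in> A" using i by simp
qed

text \<open>Peel off one cycle at a time and match it along alternate edges. Its vertices have no
  edges to the rest, so two-regularity persists.\<close>

lemma two_regular_matching:
  assumes "A \<subseteq> E" "\<And>v. v \<in> \<Union>A \<Longrightarrow> card {e \<in> A. v \<in> e} = 2"
    "\<And>vs. is_cycle A vs \<Longrightarrow> even (length vs)"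
  shows "\<exists>M\<subseteq>A. matching_on (\<Union>A) M"
  using finite_subset[OF assms(1) finite_E] assms
proof (induction A rule: finite_psubset_induct)
  case (psubset A)
  show ?case
  proof (cases "\<Union>A = {}")
    case True
    have "matching_on {} {}" by (rule matching_onI) auto
    then show ?thesis unfolding True by (intro exI[of _ "{}"]) simp
  next
    case False
    then obtain v0 where v0: "v0 \<in> \<Union>A" by auto
    have UA: "\<Union>A \<subseteq> V" using psubset.prems(1) edge_subset by blast
    have "\<exists>vs. is_cycle A vs"
    proof (rule is_cycle_exists[OF _ v0])
      show "finite (\<Union>A)" using UA finite_V finite_subset by blast
      fix v assume "v \<in> \<Union>A"
      then have "card {e \<in> A. v \<in> e} = 2" by (rule psubset.prems(2))
      then obtain e e' where ee: "{e \<in> A. v \<in> e} = {e, e'}" "e \<noteq> e'"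
        by (auto simp only: card_2_iff)
      have "e \<in> {e \<in> A. v \<in> e}" "e' \<in> {e \<in> A. v \<in> e}" unfolding ee(1) by auto
      then have e: "e \<in> A" "v \<in> e" "e' \<in> A" "v \<in> e'" by auto
      obtain a where a: "e = {v, a}" "v \<noteq> a"
        using edge_other_endpoint[OF subsetD[OF psubset.prems(1) e(1)] e(2)] .
      obtain b where b: "e' = {v, b}" "v \<noteq> b"
        using edge_other_endpoint[OF subsetD[OF psubset.prems(1) e(3)] e(4)] .
      show "\<exists>a b. a \<noteq> b \<and> {v, a} \<in> A \<and> {v, b} \<in> A \<and> a \<noteq> v \<and> b \<noteq> v"
        by (rule exI[of _ a], rule exI[of _ b]) (use a b e ee(2) in auto)
    qed
    then obtain vs where vs: "is_cycle A vs" by blast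
    have vsA: "set vs \<subseteq> \<Union>A" using is_cycle_two_neighbours[OF vs] by blast
    \<comment> \<open>The two cycle edges at \<open>v\<close> exhaust its degree.\<close>
    have closed: "e \<subseteq> set vs" if e: "e \<in> A" "v \<in> e" "v \<in> set vs" for e v
    proof -
      obtain a b where ab: "a \<in> set vs" "b \<in> set vs" "a \<noteq> b" "a \<noteq> v" "b \<noteq> v" "{v, a} \<in> A" "{v, b} \<in> A"
        using is_cycle_two_neighbours[OF vs e(3)] by blast
      have "card {e \<in> A. v \<in> e} = 2" using psubset.prems(2) e by blast
      moreover have "{{v, a}, {v, b}} \<subseteq> {e \<in> A. v \<in> e}" using ab by auto
      moreover have "card {{v, a}, {v, b}} = 2" using ab by (simp add: doubleton_eq_iff)
      moreover have "finite {e \<in> A. v \<in> e}" using psubset.hyps by simp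
      ultimately have "{{v, a}, {v, b}} = {e \<in> A. v \<in> e}" by (intro card_subset_eq) auto
      then have "e = {v, a} \<or> e = {v, b}" using e by blast
      then show ?thesis using ab e by auto
    qed
    define A' where "A' = {e \<in> A. e \<inter> set vs = {}}"
    have UA': "\<Union>A' = \<Union>A - set vs"
    proof (intro set_eqI iffI)
      fix v assume "v \<in> \<Union>A - set vs"
      then obtain e where e: "e \<in> A" "v \<in> e" "v \<notin> set vs" by auto
      have "e \<inter> set vs = {}" using closed[OF e(1)] e by auto
      then show "v \<in> \<Union>A'" using e unfolding A'_def by auto
    qed (auto simp: A'_def)
    have "\<exists>v. v \<in> set vs" using vs unfolding is_cycle_def by (cases vs) auto
    then obtain v1 where "v1 \<in> set vs" by (rule exE)
    then have "v1 \<in> \<Union>A" "v1 \<notin> \<Union>A'" using UA' vsA by auto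
    then have "A' \<noteq> A" by metis
    then have "A' \<subset> A" unfolding A'_def by auto
    then have "\<exists>M\<subseteq>A'. matching_on (\<Union>A') M"
    proof (rule psubset.IH)
      show "A' \<subseteq> E" using psubset.prems(1) unfolding A'_def by auto
      fix v assume v: "v \<in> \<Union>A'"
      then have "v \<notin> set vs" unfolding UA' by simp
      then have "e \<inter> set vs = {}" if "e \<in> A" "v \<in> e" for e using closed[OF that(1)] that by auto
      then have "{e \<in> A'. v \<in> e} = {e \<in> A. v \<in> e}" unfolding A'_def by auto
      then show "card {e \<in> A'. v \<in> e} = 2" using psubset.prems(2)[of v] v UA' by simp
    next
      fix us assume "is_cycle A' us"
      then have "is_cycle A us" unfolding is_cycle_def A'_def by blast
      then show "even (length us)" by (rule psubset.prems(3))
    qed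
    then obtain M where M: "M \<subseteq> A'" "matching_on (\<Union>A') M" by blast
    obtain M0 where M0: "M0 \<subseteq> A" "matching_on (set vs) M0"
      using even_cycle_matching[OF vs psubset.prems(3)[OF vs] psubset.prems(1)] by blast
    have "matching_on (\<Union>A' \<union> set vs) (M \<union> M0)"
      by (rule matching_on_Un[OF M(2) M0(2)]) (use UA' in auto)
    moreover have "\<Union>A' \<union> set vs = \<Union>A" using UA' vsA by auto
    moreover have "M \<union> M0 \<subseteq> A" using M(1) M0(1) unfolding A'_def by auto
    ultimately show ?thesis by (intro exI[of _ "M \<union> M0"]) simp
  qed
qed

lemma matching_on_even:
  assumes "matching_on W M" "finite W"
  shows "even (card W)"
proof -
  have "M \<inter> edge_cut E W = {}" using matching_onD(2)[OF assms(1)] by (auto simp: edge_cut_iff)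
  then show ?thesis using matching_on_parity[OF assms, of W] by simp
qed

end

section \<open>Hulls of odd cycles\<close>

context critical_structure
begin

lemma supp_Et: "supp E x \<subseteq> Et"
  unfolding supp_def using x_off by auto

lemma supp_half: "e \<in> supp E x \<Longrightarrow> x e \<ge> 1 / 2"
  using half_integral[of e] unfolding supp_def by auto

text \<open>Support edges carry at least 1/2 each, and the cut has total value 1.\<close>

lemma supp_cut_card:
  assumes "T \<in> singletons V \<union> H" "A \<subseteq> supp E x \<inter> edge_cut E T"
  shows "card A \<le> 2"
proof -
  have A: "A \<subseteq> edge_cut E T" using assms(2) by auto
  have "real (card A) * (1 / 2) \<le> (\<Sum>e\<in>A. x e)"
    using supp_half assms(2) by (intro sum_bounded_below) auto
  also have "\<dots> \<le> (\<Sum>e\<in>edge_cut E T. x e)"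
    by (rule sum_mono2[OF finite_edge_cut A]) (use x_nonneg in auto)
  also have "\<dots> = 1" using x_cut[OF assms(1)] .
  finally show ?thesis by simp
qed

lemma index_odd: "T \<in> singletons V \<union> H \<Longrightarrow> odd (card T)"
  and index_subset: "T \<in> singletons V \<union> H \<Longrightarrow> T \<subseteq> V"
  using H_odd H_subset unfolding singletons_def by auto

text \<open>Parity makes the number of crossings odd, and a cut has at most two support
  edges.\<close>

lemma matching_cut_1:
  assumes M: "matching_on W M" "M \<subseteq> supp E x" "W \<subseteq> V" and T: "T \<in> singletons V \<union> H" "T \<subseteq> W"
  shows "card (M \<inter> edge_cut E T) = 1"
proof -
  have "finite W" using M(3) finite_V finite_subset by blast
  moreover have "T \<inter> W = T" using T(2) by auto
  ultimately have "odd (card (M \<inter> edge_cut E T))"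
    using matching_on_parity[OF M(1), of T] index_odd[OF T(1)] by simp
  moreover have "card (M \<inter> edge_cut E T) \<le> 2" by (rule supp_cut_card[OF T(1)]) (use M(2) in auto)
  ultimately show ?thesis by (cases "card (M \<inter> edge_cut E T) = 2") (auto simp: le_less numeral_2_eq_2 less_Suc_eq)
qed

lemma degree_count:
  assumes "v \<in> V"
  shows "card {e \<in> E. x e = 1 / 2 \<and> v \<in> e} + 2 * card {e \<in> E. x e = 1 \<and> v \<in> e} = 2"
proof -
  have "1 = (\<Sum>e\<in>edge_cut E {v}. x e)" using x_cut[of "{v}"] assms by (simp add: singleton_in_singletons)
  also have "\<dots> = (\<Sum>e\<in>edge_cut E {v}. (if x e = 1 / 2 then 1 / 2 else 0) + (if x e = 1 then 1 else 0))"
    using half_integral by (intro sum.cong) auto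
  also have "\<dots> = real (card (edge_cut E {v} \<inter> {e. x e = 1 / 2})) * (1 / 2) + real (card (edge_cut E {v} \<inter> {e. x e = 1}))"
    using finite_edge_cut by (simp add: sum.distrib sum.If_cases)
  also have "edge_cut E {v} \<inter> {e. x e = 1 / 2} = {e \<in> E. x e = 1 / 2 \<and> v \<in> e}"
    by (auto simp: edge_cut_singleton)
  also have "edge_cut E {v} \<inter> {e. x e = 1} = {e \<in> E. x e = 1 \<and> v \<in> e}"
    by (auto simp: edge_cut_singleton)
  finally have "real (card {e \<in> E. x e = 1 / 2 \<and> v \<in> e} + 2 * card {e \<in> E. x e = 1 \<and> v \<in> e}) = real 2"
    by simp
  then show ?thesis using of_nat_eq_iff by blast
qed

text \<open>Otherwise the edges of value 1/2 form disjoint even cycles and have a perfect matching.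
  Together with the edges of value 1 it gives an integral solution of the system, which is
  \<open>x\<close> by uniqueness.\<close>

lemma odd_cycle_exists:
  assumes "\<not> integral_vector E x"
  shows "\<exists>vs. is_cycle (supp E x) vs \<and> odd (length vs)"
proof (rule ccontr)
  assume not: "\<not> ?thesis"
  define A where "A = {e \<in> E. x e = 1 / 2}"
  define B where "B = {e \<in> E. x e = 1}"
  have UA: "\<Union>A \<subseteq> V" using edge_subset unfolding A_def by blast
  have AE: "A \<subseteq> E" "A \<subseteq> supp E x" "B \<subseteq> E" "B \<subseteq> supp E x" unfolding A_def B_def supp_def by auto
  have deg: "card {e \<in> A. v \<in> e} + 2 * card {e \<in> B. v \<in> e} = 2" if "v \<in> V" for v
    using degree_count[OF that] unfolding A_def B_def by simp
  have fin: "finite {e \<in> A. v \<in> e}" "finite {e \<in> B. v \<in> e}" for v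
    using finite_E unfolding A_def B_def by auto
  have inA: "card {e \<in> A. v \<in> e} = 2" "{e \<in> B. v \<in> e} = {}" if "v \<in> \<Union>A" for v
  proof -
    have "{e \<in> A. v \<in> e} \<noteq> {}" using that by auto
    then have "card {e \<in> A. v \<in> e} \<noteq> 0" using fin by simp
    then have "card {e \<in> A. v \<in> e} = 2 \<and> card {e \<in> B. v \<in> e} = 0"
      using deg[OF subsetD[OF UA that]] by presburger
    then show "card {e \<in> A. v \<in> e} = 2" "{e \<in> B. v \<in> e} = {}" using fin(2)[of v] by simp_all
  qed
  have notA: "card {e \<in> B. v \<in> e} = 1" if "v \<in> V - \<Union>A" for v
  proof -
    have "{e \<in> A. v \<in> e} = {}" using that by auto
    then have "card {e \<in> A. v \<in> e} = 0" by (simp only: card.empty)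
    moreover have "v \<in> V" using that by simp
    ultimately show ?thesis using deg[of v] by linarith
  qed
  have "\<exists>M\<subseteq>A. matching_on (\<Union>A) M"
  proof (rule two_regular_matching[OF AE(1) inA(1)])
    fix vs assume "is_cycle A vs"
    then have "is_cycle (supp E x) vs" using AE(2) unfolding is_cycle_def by blast
    then show "even (length vs)" using not by blast
  qed
  then obtain M where M: "M \<subseteq> A" "matching_on (\<Union>A) M" by blast
  have "matching_on (V - \<Union>A) B"
  proof (rule matching_onI[OF AE(3)])
    show "\<Union>B = V - \<Union>A"
    proof (intro set_eqI iffI)
      fix v assume "v \<in> \<Union>B"
      then obtain e where e: "e \<in> B" "v \<in> e" by auto
      then have "v \<in> V" using edge_subset AE(3) by auto
      moreover have "v \<notin> \<Union>A" using inA(2)[of v] e by auto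
      ultimately show "v \<in> V - \<Union>A" by simp
    next
      fix v assume "v \<in> V - \<Union>A"
      then have "{e \<in> B. v \<in> e} \<noteq> {}" using notA[of v] by force
      then show "v \<in> \<Union>B" by auto
    qed
    then have BV: "v \<in> V - \<Union>A" if "e \<in> B" "v \<in> e" for e v using that by blast
    fix e e' v assume e: "e \<in> B" "e' \<in> B" "v \<in> e" "v \<in> e'"
    have "card {e \<in> B. v \<in> e} = 1" using notA[OF BV[OF e(1,3)]] .
    then obtain f where f: "{e \<in> B. v \<in> e} = {f}" using card_1_singletonE by blast
    have "e \<in> {e \<in> B. v \<in> e}" "e' \<in> {e \<in> B. v \<in> e}" using e by auto
    then show "e = e'" unfolding f by simp
  qed
  from matching_on_Un[OF M(2) this] have mN: "matching_on V (M \<union> B)" using UA by (simp add: Un_absorb1)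
  define N where "N = M \<union> B"
  have N_supp: "N \<subseteq> supp E x" using M(1) AE unfolding N_def by auto
  have "incidence_vector N = x"
  proof (rule x_unique)
    show "incidence_vector N e = 0" if "e \<notin> Et" for e
      using that N_supp supp_Et unfolding incidence_vector_def by auto
    fix T assume T: "T \<in> singletons V \<union> H"
    have "(\<Sum>e\<in>edge_cut E T. incidence_vector N e) = card (edge_cut E T \<inter> N)"
      unfolding incidence_vector_def using finite_edge_cut by (simp add: sum.If_cases)
    also have "edge_cut E T \<inter> N = N \<inter> edge_cut E T" by auto
    also have "card \<dots> = 1"
      using matching_cut_1[OF mN _ subset_refl T] N_supp index_subset[OF T] unfolding N_def by simp
    finally show "(\<Sum>e\<in>edge_cut E T. incidence_vector N e) = 1" by simp
  qed
  then have "x e \<in> \<int>" for e by (metis Ints_0 Ints_1 incidence_vector_def)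
  then show False using assms unfolding integral_vector_def by simp
qed

section \<open>Odd cycles against the sets of \<open>H\<close>\<close>

lemma cycle_closed:
  assumes C: "is_cycle (supp E x) vs" and e: "e \<in> supp E x" "v \<in> e" "v \<in> set vs"
  shows "e \<subseteq> set vs"
proof -
  obtain a b where ab: "a \<in> set vs" "b \<in> set vs" "a \<noteq> b" "a \<noteq> v" "b \<noteq> v"
    "{v, a} \<in> supp E x" "{v, b} \<in> supp E x"
    using is_cycle_two_neighbours[OF C e(3)] by blast
  have v: "v \<in> V" using e edge_subset unfolding supp_def by auto
  have "card {e, {v, a}, {v, b}} \<le> 2"
  proof (rule supp_cut_card)
    show "{v} \<in> singletons V \<union> H" using v by (simp add: singleton_in_singletons)
    show "{e, {v, a}, {v, b}} \<subseteq> supp E x \<inter> edge_cut E {v}"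
      using e ab unfolding edge_cut_singleton supp_def by auto
  qed
  moreover have "{v, a} \<noteq> {v, b}" using ab by (auto simp: doubleton_eq_iff)
  ultimately have "e = {v, a} \<or> e = {v, b}" by (auto simp: card_insert_if split: if_splits)
  then show ?thesis using ab e by auto
qed

lemma set_cycle_subset:
  assumes "is_cycle (supp E x) vs"
  shows "set vs \<subseteq> V"
proof
  fix v assume "v \<in> set vs"
  then obtain a where "{v, a} \<in> supp E x" using is_cycle_two_neighbours[OF assms] by blast
  then show "v \<in> V" using edge_subset unfolding supp_def by auto
qed

lemma positive_cut_edge:
  assumes "T \<in> singletons V \<union> H"
  shows "\<exists>f\<in>edge_cut E T. x f > 0"
proof (rule ccontr)
  assume "\<not> ?thesis"
  then have "x f = 0" if "f \<in> edge_cut E T" for f using x_nonneg[of f] that by force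
  then have "(\<Sum>e\<in>edge_cut E T. x e) = 0" by (intro sum.neutral) auto
  then show False using x_cut[OF assms] by simp
qed

text \<open>A positive cut edge of the enclosing maximal set ends off the cycle, so its critical
  matching covers the cycle and lies in the support. No support edge leaves the cycle, so an odd
  number of vertices would be perfectly matched.\<close>

lemma odd_cycle_not_inside:
  assumes C: "is_cycle (supp E x) vs" "odd (length vs)" and S: "S \<in> H"
  shows "\<not> set vs \<subseteq> S"
proof
  assume "set vs \<subseteq> S"
  then obtain S' where S': "top_set S'" "set vs \<subseteq> S'" using top_set_exists[OF S] by blast
  have SH: "S' \<in> H" using top_set_H[OF S'(1)] .
  obtain f where f: "f \<in> edge_cut E S'" "x f > 0" using positive_cut_edge[of S'] SH by blast
  define u where "u = endpoint S' f"
  have uS: "u \<in> S'" "u \<in> f" using endpoint[OF f(1)] unfolding u_def by auto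
  have f_supp: "f \<in> supp E x" using f edge_cut_subset unfolding supp_def by auto
  have u_vs: "u \<notin> set vs"
  proof
    assume "u \<in> set vs"
    then have "f \<subseteq> S'" using cycle_closed[OF C(1) f_supp uS(2)] S'(2) by simp
    then show False using f(1) edge_cut_iff by auto
  qed
  note mo = critical_matching_on[OF K(1)[OF SH uS(1)] uS(1)]
  have K_supp: "K S' u \<subseteq> supp E x" using critical_in_support[OF S'(1) f] unfolding u_def .
  define M where "M = {e \<in> K S' u. e \<inter> set vs \<noteq> {}}"
  have "matching_on (set vs) M"
  proof (rule matching_onI)
    show "M \<subseteq> E" using matching_onD(1)[OF mo] unfolding M_def by auto
    show "\<Union>M = set vs"
    proof (intro set_eqI iffI)
      fix v assume v: "v \<in> set vs"
      then have "v \<in> S' - {u}" using S'(2) u_vs by auto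
      then obtain e where "e \<in> K S' u" "v \<in> e" using matching_onD(2)[OF mo] by blast
      then show "v \<in> \<Union>M" using v unfolding M_def by auto
    next
      fix v assume "v \<in> \<Union>M"
      then obtain e w where "e \<in> K S' u" "v \<in> e" "w \<in> e" "w \<in> set vs" unfolding M_def by auto
      then show "v \<in> set vs" using cycle_closed[OF C(1), of e w] K_supp by auto
    qed
    fix e e' v assume "e \<in> M" "e' \<in> M" "v \<in> e" "v \<in> e'"
    then show "e = e'" using matching_onD(3)[OF mo] unfolding M_def by auto
  qed
  then have "even (card (set vs))" by (rule matching_on_even) simp
  then show False using C unfolding is_cycle_def by (simp add: distinct_card)
qed

text \<open>The cycle crosses the cut at least twice, and there is room for only two support
  edges.\<close>

lemma odd_cycle_cut:
  assumes C: "is_cycle (supp E x) vs" "odd (length vs)" and S: "S \<in> H" "S \<inter> set vs \<noteq> {}"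
  shows "\<exists>f f'. f \<noteq> f' \<and> f \<subseteq> set vs \<and> f' \<subseteq> set vs \<and> supp E x \<inter> edge_cut E S = {f, f'}"
proof -
  obtain f f' where f: "f \<in> supp E x" "f' \<in> supp E x" "f \<noteq> f'" "f \<subseteq> set vs" "f' \<subseteq> set vs"
    "f \<inter> S \<noteq> {}" "f' \<inter> S \<noteq> {}" "\<not> f \<subseteq> S" "\<not> f' \<subseteq> S"
    using is_cycle_crossing[OF C(1) S(2) odd_cycle_not_inside[OF C S(1)]] by blast
  have sub: "{f, f'} \<subseteq> supp E x \<inter> edge_cut E S"
    using f by (simp add: edge_cut_iff supp_def)
  moreover have "card (supp E x \<inter> edge_cut E S) \<le> card {f, f'}"
    using supp_cut_card[of S "supp E x \<inter> edge_cut E S"] S(1) f(3) by simp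
  ultimately have "{f, f'} = supp E x \<inter> edge_cut E S"
    using finite_edge_cut by (intro card_seteq) auto
  then show ?thesis using f by metis
qed

section \<open>Closure, matchings and disjointness of hulls\<close>

lemma hull_iff: "v \<in> cycle_hull H vs \<longleftrightarrow> v \<in> set vs \<or> (\<exists>S. top_set S \<and> S \<inter> set vs \<noteq> {} \<and> v \<in> S)"
proof
  assume "v \<in> cycle_hull H vs"
  then consider "v \<in> set vs" | S where "S \<in> H" "S \<inter> set vs \<noteq> {}" "v \<in> S"
    unfolding cycle_hull_def by auto
  then show "v \<in> set vs \<or> (\<exists>S. top_set S \<and> S \<inter> set vs \<noteq> {} \<and> v \<in> S)"
  proof cases
    case 2
    then obtain S' where "top_set S'" "S \<subseteq> S'" using top_set_exists by blast
    then show ?thesis using 2 by (intro disjI2 exI[of _ S']) auto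
  qed simp
next
  assume "v \<in> set vs \<or> (\<exists>S. top_set S \<and> S \<inter> set vs \<noteq> {} \<and> v \<in> S)"
  then show "v \<in> cycle_hull H vs" unfolding cycle_hull_def using top_set_H by auto
qed

lemma hull_H:
  assumes "S \<in> H" "S \<inter> cycle_hull H vs \<noteq> {}"
  shows "S \<subseteq> cycle_hull H vs"
proof -
  obtain v where v: "v \<in> S" "v \<in> cycle_hull H vs" using assms(2) by auto
  show ?thesis
  proof (cases "v \<in> set vs")
    case True
    then show ?thesis using v assms(1) unfolding cycle_hull_def by auto
  next
    case False
    then obtain T where T: "top_set T" "T \<inter> set vs \<noteq> {}" "v \<in> T" using v hull_iff by auto
    obtain S' where S': "top_set S'" "S \<subseteq> S'" using top_set_exists[OF assms(1)] by blast
    then have "S' = T" using top_set_unique T v by auto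
    moreover have "T \<subseteq> cycle_hull H vs" using T hull_iff[of _ vs] by blast
    ultimately show ?thesis using S' by auto
  qed
qed

lemma hull_subset: "is_cycle (supp E x) vs \<Longrightarrow> cycle_hull H vs \<subseteq> V"
  unfolding cycle_hull_def using set_cycle_subset H_subset by auto

text \<open>Support edges at a cycle vertex stay on the cycle. Those leaving a maximal set that
  meets the cycle are its two cut edges, which also belong to the cycle.\<close>

lemma hull_closed:
  assumes C: "is_cycle (supp E x) vs" "odd (length vs)" and e: "e \<in> supp E x" "e \<inter> cycle_hull H vs \<noteq> {}"
  shows "e \<subseteq> cycle_hull H vs"
proof -
  have vs_hull: "set vs \<subseteq> cycle_hull H vs" unfolding cycle_hull_def by auto
  obtain v where v: "v \<in> e" "v \<in> cycle_hull H vs" using e(2) by auto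
  then consider "v \<in> set vs" | S where "top_set S" "S \<inter> set vs \<noteq> {}" "v \<in> S" using hull_iff by auto
  then show ?thesis
  proof cases
    case 1
    then show ?thesis using cycle_closed[OF C(1) e(1) v(1)] vs_hull by auto
  next
    case 2
    have S_hull: "S \<subseteq> cycle_hull H vs" using 2 hull_iff by auto
    show ?thesis
    proof (cases "e \<subseteq> S")
      case False
      then have "e \<in> supp E x \<inter> edge_cut E S"
        using e(1) v 2 by (auto simp: edge_cut_iff supp_def)
      then have "e \<subseteq> set vs" using odd_cycle_cut[OF C top_set_H[OF 2(1)] 2(2)] by auto
      then show ?thesis using vs_hull by auto
    qed (use S_hull in auto)
  qed
qed

lemma hull_cut_zero:
  assumes C: "is_cycle (supp E x) vs" "odd (length vs)"
  shows "(\<Sum>e\<in>edge_cut E (cycle_hull H vs). x e) = 0"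
proof (rule sum.neutral, rule ballI)
  fix e assume "e \<in> edge_cut E (cycle_hull H vs)"
  then show "x e = 0" using hull_closed[OF C, of e] unfolding edge_cut_iff supp_def by auto
qed

text \<open>For each maximal set met by the cycle, a cycle edge leaving it yields a critical
  matching within the support that misses a cycle vertex. Its edges lie entirely on or off the
  cycle, and those off the cycle cover the rest of the set.\<close>

lemma hull_rest_matching:
  assumes C: "is_cycle (supp E x) vs" "odd (length vs)"
  shows "\<exists>R\<subseteq>supp E x. matching_on (cycle_hull H vs - set vs) R"
proof -
  define \<T> where "\<T> = {S. top_set S \<and> S \<inter> set vs \<noteq> {}}"
  have "\<exists>u M. u \<in> S \<and> u \<in> set vs \<and> M \<subseteq> supp E x \<and> matching_on (S - {u}) M" if "S \<in> \<T>" for S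
  proof -
    have S: "top_set S" "S \<in> H" "S \<inter> set vs \<noteq> {}" using that top_set_H unfolding \<T>_def by auto
    obtain f f' where f: "f \<subseteq> set vs" "supp E x \<inter> edge_cut E S = {f, f'}"
      using odd_cycle_cut[OF C S(2,3)] by auto
    then have fS: "f \<in> edge_cut E S" "f \<in> supp E x" by auto
    then have "x f > 0" using x_nonneg[of f] unfolding supp_def by auto
    from critical_in_support[OF S(1) fS(1) this]
    have "K S (endpoint S f) \<subseteq> supp E x" .
    moreover note endpoint[OF fS(1)] critical_matching_on[OF K(1)[OF S(2) endpoint(2)[OF fS(1)]] endpoint(2)[OF fS(1)]]
    ultimately show ?thesis using f(1)
      by (intro exI[of _ "endpoint S f"] exI[of _ "K S (endpoint S f)"]) auto
  qed
  then obtain u M where uM: "\<And>S. S \<in> \<T> \<Longrightarrow> u S \<in> S" "\<And>S. S \<in> \<T> \<Longrightarrow> u S \<in> set vs"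
    "\<And>S. S \<in> \<T> \<Longrightarrow> M S \<subseteq> supp E x" "\<And>S. S \<in> \<T> \<Longrightarrow> matching_on (S - {u S}) (M S)"
    by metis
  define R where "R = (\<Union>S\<in>\<T>. {e \<in> M S. e \<inter> set vs = {}})"
  have R_supp: "R \<subseteq> supp E x" using uM(3) unfolding R_def by auto
  have sub: "e \<subseteq> S" if "S \<in> \<T>" "e \<in> M S" for e S using matching_onD(2)[OF uM(4)[OF that(1)]] that(2) by auto
  have "matching_on (cycle_hull H vs - set vs) R"
  proof (rule matching_onI)
    show "R \<subseteq> E" using R_supp unfolding supp_def by auto
    show "\<Union>R = cycle_hull H vs - set vs"
    proof (intro set_eqI iffI)
      fix v assume "v \<in> \<Union>R"
      then obtain S e where e: "S \<in> \<T>" "e \<in> M S" "e \<inter> set vs = {}" "v \<in> e" unfolding R_def by auto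
      then have "v \<in> S" "v \<notin> set vs" using sub by auto
      then show "v \<in> cycle_hull H vs - set vs" using e(1) hull_iff unfolding \<T>_def by auto
    next
      fix v assume v: "v \<in> cycle_hull H vs - set vs"
      then obtain S where S: "S \<in> \<T>" "v \<in> S" using hull_iff unfolding \<T>_def by auto
      then have "v \<in> S - {u S}" using v uM(2) by auto
      then obtain e where e: "e \<in> M S" "v \<in> e" using matching_onD(2)[OF uM(4)[OF S(1)]] by blast
      have "e \<inter> set vs = {}"
      proof (rule ccontr)
        assume "e \<inter> set vs \<noteq> {}"
        then have "e \<subseteq> set vs" using cycle_closed[OF C(1), of e] e(1) uM(3)[OF S(1)] by auto
        then show False using e v by auto
      qed
      then show "v \<in> \<Union>R" using e S unfolding R_def by auto
    qed
    fix e e' v assume e: "e \<in> R" "e' \<in> R" "v \<in> e" "v \<in> e'"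
    then obtain S S' where S: "S \<in> \<T>" "e \<in> M S" "S' \<in> \<T>" "e' \<in> M S'" unfolding R_def by auto
    then have "v \<in> S" "v \<in> S'" using sub e by auto
    then have "S = S'" using top_set_unique S unfolding \<T>_def by auto
    then show "e = e'" using matching_onD(3)[OF uM(4)[OF S(1)]] S e by auto
  qed
  then show ?thesis using R_supp by blast
qed

lemma hull_near_matching:
  assumes C: "is_cycle (supp E x) vs" "odd (length vs)" and a: "a \<in> set vs"
  shows "\<exists>M\<subseteq>supp E x. matching_on (cycle_hull H vs - {a}) M"
proof -
  obtain R where R: "R \<subseteq> supp E x" "matching_on (cycle_hull H vs - set vs) R"
    using hull_rest_matching[OF C] by blast
  obtain M where M: "M \<subseteq> supp E x" "matching_on (set vs - {a}) M"
    using odd_cycle_near_matching[OF C a] unfolding supp_def by auto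
  have "matching_on ((cycle_hull H vs - set vs) \<union> (set vs - {a})) (R \<union> M)"
    by (rule matching_on_Un[OF R(2) M(2)]) auto
  moreover have "(cycle_hull H vs - set vs) \<union> (set vs - {a}) = cycle_hull H vs - {a}"
    using a unfolding cycle_hull_def by auto
  ultimately show ?thesis using R(1) M(1) by (intro exI[of _ "R \<union> M"]) auto
qed

lemma finite_hull: "is_cycle (supp E x) vs \<Longrightarrow> finite (cycle_hull H vs)"
  using hull_subset finite_V finite_subset by metis

lemma hull_card:
  assumes C: "is_cycle (supp E x) vs" "odd (length vs)"
  shows "odd (card (cycle_hull H vs))" and "card (cycle_hull H vs) \<ge> 3"
proof -
  have len: "length vs \<ge> 3" "card (set vs) = length vs"
    using C(1) unfolding is_cycle_def by (auto simp: distinct_card)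
  have sub: "set vs \<subseteq> cycle_hull H vs" unfolding cycle_hull_def by auto
  then show "card (cycle_hull H vs) \<ge> 3" using card_mono[OF finite_hull[OF C(1)] sub] len by simp
  obtain a where a: "a \<in> set vs" using len by (cases vs) auto
  obtain M where M: "matching_on (cycle_hull H vs - {a}) M" using hull_near_matching[OF C a] by blast
  have "even (card (cycle_hull H vs - {a}))"
    by (rule matching_on_even[OF M]) (use finite_hull[OF C(1)] in simp)
  moreover have "card (cycle_hull H vs) = Suc (card (cycle_hull H vs - {a}))"
    using a sub finite_hull[OF C(1)] by (metis card_Suc_Diff1 subsetD)
  ultimately show "odd (card (cycle_hull H vs))" by simp
qed

text \<open>For a vertex \<open>u\<close> of a maximal set \<open>S \<in> H\<close>, take the near-perfect matching that misses the
  endpoint \<open>a\<close> in \<open>S\<close> of an edge of the cycle leaving \<open>S\<close>. By parity it does not cross the cut of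
  \<open>S\<close>, so its part inside \<open>S\<close> may be exchanged for the critical matching of \<open>u\<close>.\<close>

lemma hull_critical:
  assumes C: "is_cycle (supp E x) vs" "odd (length vs)" and u: "u \<in> cycle_hull H vs"
  shows "\<exists>M\<subseteq>Et. critical_matching H (cycle_hull H vs) u M"
proof (cases "u \<in> \<Union>H")
  case False
  let ?h = "cycle_hull H vs"
  have "u \<in> set vs" using u False top_set_H hull_iff by blast
  then obtain M where M: "M \<subseteq> supp E x" "matching_on (?h - {u}) M"
    using hull_near_matching[OF C] by blast
  have "critical_matching H ?h u M"
    unfolding critical_matching_def
  proof (intro conjI ballI impI)
    show "M \<subseteq> inside ?h" using matching_onD(1,2)[OF M(2)] unfolding inside_def by auto
    fix T assume T: "T \<in> singletons ?h \<union> H" "T \<subseteq> ?h"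
    have TI: "T \<in> singletons V \<union> H" using T hull_subset[OF C(1)] unfolding singletons_def by auto
    show "card (M \<inter> edge_cut E T) = (if u \<in> T then 0 else 1)"
    proof (cases "u \<in> T")
      case True
      then have "T = {u}" using T False unfolding singletons_def by auto
      then have "M \<inter> edge_cut E T = {}"
        using matching_onD(2)[OF M(2)] by (auto simp: edge_cut_singleton)
      then show ?thesis using True by simp
    next
      case False
      then show ?thesis using matching_cut_1[OF M(2,1) _ TI] T hull_subset[OF C(1)] by auto
    qed
  qed
  then show ?thesis using M(1) supp_Et by blast
next
  case True
  let ?h = "cycle_hull H vs"
  obtain S where S: "top_set S" "u \<in> S" using True top_set_exists by blast
  have SH: "S \<in> H" using top_set_H[OF S(1)] .
  have S_hull: "S \<subseteq> ?h" using hull_H[OF SH] S u by auto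
  have S_vs: "S \<inter> set vs \<noteq> {}"
  proof (cases "u \<in> set vs")
    case False
    then obtain T where "top_set T" "T \<inter> set vs \<noteq> {}" "u \<in> T" using u hull_iff by auto
    then show ?thesis using top_set_unique[OF S(1)] S(2) by auto
  qed (use S in auto)
  obtain f f' where f: "f \<noteq> f'" "f \<subseteq> set vs" "supp E x \<inter> edge_cut E S = {f, f'}"
    using odd_cycle_cut[OF C SH S_vs] by auto
  then have fS: "f \<in> edge_cut E S" by auto
  define a where "a = endpoint S f"
  have a: "a \<in> S" "a \<in> f" "a \<in> set vs" using endpoint[OF fS] f(2) unfolding a_def by auto
  obtain M where M: "M \<subseteq> supp E x" "matching_on (?h - {a}) M"
    using hull_near_matching[OF C a(3)] by blast
  have finS: "finite S" using H_subset[OF SH] finite_V finite_subset by blast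
  have M_S: "M \<inter> edge_cut E S = {}"
  proof -
    have "f \<notin> M" using matching_onD(2)[OF M(2)] a by auto
    then have "M \<inter> edge_cut E S \<subseteq> {f'}" using M(1) f(3) by auto
    moreover have "even (card (M \<inter> edge_cut E S))"
    proof -
      have "S \<inter> (?h - {a}) = S - {a}" using S_hull by auto
      moreover have "even (card (S - {a}))" using H_odd[OF SH] a finS by simp
      ultimately show ?thesis
        using matching_on_parity[OF M(2), of S] finite_hull[OF C(1)] by simp
    qed
    ultimately show ?thesis by (cases "M \<inter> edge_cut E S = {}") (auto dest!: subset_singletonD)
  qed
  have M_dich: "e \<subseteq> S \<or> e \<inter> S = {}" if "e \<in> M" for e
    using M_S that matching_onD(1)[OF M(2)] unfolding set_eq_iff by (auto simp: edge_cut_iff)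
  note cm = K(1)[OF SH S(2)]
  define M' where "M' = {e \<in> M. e \<inter> S = {}} \<union> K S u"
  have KS: "e \<subseteq> S" "e \<in> E" if "e \<in> K S u" for e
    using critical_matchingD(1)[OF cm] that unfolding inside_def by auto
  have "critical_matching H ?h u M'"
    unfolding critical_matching_def
  proof (intro conjI ballI impI)
    show "M' \<subseteq> inside ?h"
    proof
      fix e assume "e \<in> M'"
      then consider "e \<in> M" | "e \<in> K S u" unfolding M'_def by auto
      then show "e \<in> inside ?h"
      proof cases
        case 1
        then show ?thesis using matching_onD(1,2)[OF M(2)] unfolding inside_def by auto
      next
        case 2
        then show ?thesis using KS[OF 2] S_hull unfolding inside_def by simp
      qed
    qed
    fix T assume T: "T \<in> singletons ?h \<union> H" "T \<subseteq> ?h"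
    have TI: "T \<in> singletons V \<union> H" using T hull_subset[OF C(1)] unfolding singletons_def by auto
    \<comment> \<open>Laminarity and maximality of S leave no member of \<open>H\<close> properly
      containing S.\<close>
    have "T \<subseteq> S \<or> T \<inter> S = {}"
    proof (cases "T \<in> H")
      case True
      then have "T \<subseteq> S \<or> S \<subseteq> T \<or> T \<inter> S = {}" using SH H_laminar unfolding laminar_def by blast
      then show ?thesis using S(1) True unfolding top_set_def by auto
    qed (use T in \<open>auto simp: singletons_def\<close>)
    then show "card (M' \<inter> edge_cut E T) = (if u \<in> T then 0 else 1)"
    proof
      assume TS: "T \<subseteq> S"
      have "e \<notin> edge_cut E T" if "e \<inter> S = {}" for e
      proof -
        have "e \<inter> T = {}" using TS that by auto
        then show ?thesis by (simp add: edge_cut_iff)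
      qed
      then have "M' \<inter> edge_cut E T = K S u \<inter> edge_cut E T" unfolding M'_def by auto
      moreover have "T \<in> singletons S \<union> H" using T TS unfolding singletons_def by auto
      ultimately show ?thesis using critical_matchingD(2)[OF cm _ TS] by simp
    next
      assume TS: "T \<inter> S = {}"
      have "M' \<inter> edge_cut E T = M \<inter> edge_cut E T"
      proof -
        have "e \<notin> edge_cut E T" if "e \<subseteq> S" for e
        proof -
          have "e \<inter> T = {}" using TS that by auto
          then show ?thesis by (simp add: edge_cut_iff)
        qed
        then show ?thesis unfolding M'_def using M_dich KS(1) by auto
      qed
      moreover have "card (M \<inter> edge_cut E T) = 1"
        by (rule matching_cut_1[OF M(2,1) _ TI]) (use T TS a hull_subset[OF C(1)] in auto)
      moreover have "u \<notin> T" using S(2) TS by auto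
      ultimately show ?thesis by simp
    qed
  qed
  moreover have "M' \<subseteq> Et" using M(1) supp_Et K(2)[OF SH S(2)] unfolding M'_def by auto
  ultimately show ?thesis by blast
qed

text \<open>If both cycles meet the same member of \<open>H\<close>, they contain its two support
  cut edges and hence share a vertex. Since no support edge leaves either cycle, sharing a vertex
  makes their vertex sets equal.\<close>

lemma hulls_disjoint:
  assumes C: "is_cycle (supp E x) vs" "odd (length vs)" and C': "is_cycle (supp E x) ws" "odd (length ws)"
    and meet: "cycle_hull H vs \<inter> cycle_hull H ws \<noteq> {}"
  shows "cycle_hull H vs = cycle_hull H ws"
proof -
  have both: "set vs \<inter> set ws \<noteq> {}" if S: "S \<in> H" "S \<inter> set vs \<noteq> {}" "S \<inter> set ws \<noteq> {}" for S
  proof -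
    obtain f f' where f: "f \<subseteq> set vs" "supp E x \<inter> edge_cut E S = {f, f'}"
      using odd_cycle_cut[OF C S(1,2)] by auto
    obtain g g' where g: "g \<subseteq> set ws" "g' \<subseteq> set ws" "supp E x \<inter> edge_cut E S = {g, g'}"
      using odd_cycle_cut[OF C' S(1,3)] by auto
    have "f \<in> {g, g'}" "f \<in> edge_cut E S" using f g by auto
    then have "f \<subseteq> set ws" "f \<noteq> {}" using g unfolding edge_cut_iff by auto
    then show ?thesis using f(1) by auto
  qed
  obtain v where v: "v \<in> cycle_hull H vs" "v \<in> cycle_hull H ws" using meet by auto
  have ne: "set vs \<inter> set ws \<noteq> {}"
  proof (cases "v \<in> set vs")
    case vs: True
    show ?thesis
    proof (cases "v \<in> set ws")
      case False
      then obtain S where "top_set S" "S \<inter> set ws \<noteq> {}" "v \<in> S" using v hull_iff by auto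
      then show ?thesis using both[of S] top_set_H vs by auto
    qed (use vs in auto)
  next
    case False
    then obtain S where S: "top_set S" "S \<inter> set vs \<noteq> {}" "v \<in> S" using v hull_iff by auto
    show ?thesis
    proof (cases "v \<in> set ws")
      case True
      then show ?thesis using both[of S] top_set_H S by auto
    next
      case False
      then obtain T where T: "top_set T" "T \<inter> set ws \<noteq> {}" "v \<in> T" using v hull_iff by auto
      then have "S = T" using S top_set_unique by auto
      then show ?thesis using both[of S] top_set_H S T by auto
    qed
  qed
  have "set vs \<subseteq> set ws"
    by (rule is_cycle_connected[OF C(1)]) (use ne cycle_closed[OF C'(1)] in auto)
  moreover have "set ws \<subseteq> set vs"
    by (rule is_cycle_connected[OF C'(1)]) (use ne cycle_closed[OF C(1)] in auto)
  ultimately have "set vs = set ws" by auto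
  then show ?thesis unfolding cycle_hull_def by simp
qed

end

section \<open>Progress, termination and correctness\<close>

context dual_phase_done
begin

abbreviation "kept \<equiv> positive_sets m \<F> D"

abbreviation "tight_edges \<equiv> {e \<in> E. \<forall>l\<le>m. load idx (D l) e = lc l e}"

lemma kept_subset: "kept \<subseteq> \<F>"
  unfolding positive_sets_def by auto

text \<open>The first nonzero dual of a set is positive, so testing for a positive entry detects
  every nonzero one.\<close>

lemma kept_iff:
  assumes "S \<in> \<F>"
  shows "S \<in> kept \<longleftrightarrow> (\<exists>l. D l S \<noteq> 0)"
proof
  assume "S \<in> kept"
  then obtain l where "D l S > 0" unfolding positive_sets_def by blast
  then show "\<exists>l. D l S \<noteq> 0" by (intro exI[of _ l]) simp
next
  assume ex: "\<exists>l. D l S \<noteq> 0"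
  define l where "l = (LEAST l. D l S \<noteq> 0)"
  have l: "D l S \<noteq> 0" "\<And>k. k < l \<Longrightarrow> D k S = 0"
    unfolding l_def using LeastI_ex[OF ex] not_less_Least by blast+
  have "l \<le> m" using l(1) D_above by (meson not_le)
  then have "D l S \<ge> 0" using lex_nonnegD[OF D_lex_nonneg[OF assms]] l(2) by blast
  then have "D l S > 0" using l(1) by simp
  then show "S \<in> kept" using assms \<open>l \<le> m\<close> unfolding positive_sets_def by blast
qed

lemma D_not_kept: "S \<notin> singletons V \<union> kept \<Longrightarrow> D l S = 0"
  using kept_iff D_off dix_subset by blast

lemma kept_cut: "S \<in> singletons V \<union> kept \<Longrightarrow> (\<Sum>e\<in>edge_cut E S. x e) = 1"
proof -
  assume S: "S \<in> singletons V \<union> kept"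
  have "S \<in> dix"
  proof (cases "S \<in> singletons V")
    case False
    then have "S \<in> kept" using S by simp
    then obtain l where "D l S \<noteq> 0" using kept_iff kept_subset by blast
    then show ?thesis using D_off by blast
  qed (simp add: dual_index_def)
  then show ?thesis by (rule dix_cut)
qed

text \<open>Complementary slackness at every level. The right-hand side does not depend on
  \<open>y\<close>, which is the source of uniqueness.\<close>

lemma cost_tight:
  assumes "\<And>e. e \<notin> tight_edges \<Longrightarrow> y e = 0"
    and "\<And>T. T \<in> singletons V \<union> kept \<Longrightarrow> (\<Sum>e\<in>edge_cut E T. y e) = 1" and "l \<le> m"
  shows "cost l y = (\<Sum>S\<in>idx. D l S)"
proof -
  have "cost l y = (\<Sum>e\<in>E. y e * load idx (D l) e)"
    unfolding cost_def
  proof (rule sum.cong[OF refl])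
    fix e
    show "lc l e * y e = y e * load idx (D l) e"
      using assms(1)[of e] assms(3) by (cases "e \<in> tight_edges") auto
  qed
  also have "\<dots> = (\<Sum>S\<in>idx. D l S * (\<Sum>e\<in>edge_cut E S. y e))" by (rule sum_load_cuts[OF finite_idx])
  also have "\<dots> = (\<Sum>S\<in>idx. D l S)"
  proof (rule sum.cong[OF refl])
    fix S
    show "D l S * (\<Sum>e\<in>edge_cut E S. y e) = D l S"
      using assms(2)[of S] D_not_kept[of S l] by (cases "S \<in> singletons V \<union> kept") auto
  qed
  finally show ?thesis .
qed

lemma x_not_tight: "e \<notin> tight_edges \<Longrightarrow> x e = 0"
  using supp_tight[of _ e] x_off[of e] unfolding supp_def by blast

lemma kept_critical:
  assumes S: "S \<in> kept" "u \<in> S"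
  shows "\<exists>K. critical_matching kept S u K \<and> K \<subseteq> tight_edges"
proof -
  have SF: "S \<in> \<F>" using S kept_subset by blast
  obtain l0 where l0: "D l0 S \<noteq> 0" using kept_iff[OF SF] S by blast
  obtain K where K: "critical_matching \<F> S u K" "\<And>e l. e \<in> K \<Longrightarrow> l \<le> m \<Longrightarrow> load idx (\<Gamma> l) e = lc l e"
    using critical SF S(2) unfolding critical_family_def by metis
  have "critical_matching kept S u K"
    using K(1) kept_subset unfolding critical_matching_def by blast
  moreover have "K \<subseteq> tight_edges"
  proof
    fix e assume e: "e \<in> K"
    then have ein: "e \<in> inside S" using critical_matchingD(1)[OF K(1)] by auto
    have "load idx (D l) e = lc l e" if "l \<le> m" for l
    proof -
      have "load idx (D l) e = load (below S) (D l) e" by (rule load_inside[OF SF ein])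
      also have "\<dots> = load (below S) (\<Gamma> l) e"
        by (rule load_cong) (use extremal_agreement[OF SF l0 that] in auto)
      also have "\<dots> = load idx (\<Gamma> l) e" by (rule load_inside[OF SF ein, symmetric])
      finally show ?thesis using K(2)[OF e that] by simp
    qed
    then show "e \<in> tight_edges" using ein unfolding inside_def by auto
  qed
  ultimately show ?thesis by blast
qed

sublocale cs: critical_structure V E kept tight_edges x
proof
  show "S \<subseteq> V" if "S \<in> kept" for S using that kept_subset F_subset by blast
  show "odd (card S)" if "S \<in> kept" for S using that kept_subset F_odd by blast
  show "laminar kept" using F_laminar kept_subset unfolding laminar_def by blast
  show "tight_edges \<subseteq> E" by auto
  show "x e \<ge> 0" for e by (rule x_nonneg)
  show "x e = 0" if "e \<notin> tight_edges" for e using that by (rule x_not_tight)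
  show "(\<Sum>e\<in>edge_cut E T. x e) = 1" if "T \<in> singletons V \<union> kept" for T using that by (rule kept_cut)
  show "y = x" if y: "\<And>e. e \<notin> tight_edges \<Longrightarrow> y e = 0"
    "\<And>T. T \<in> singletons V \<union> kept \<Longrightarrow> (\<Sum>e\<in>edge_cut E T. y e) = 1" for y
  proof (rule equal_costs_imp_equal)
    fix l assume "l \<le> m"
    then show "cost l y = cost l x"
      using cost_tight[OF y] cost_tight[OF x_not_tight kept_cut] by simp
  next
    show "y e = 0" if "e \<notin> E" for e using y(1)[of e] that by simp
  qed (rule x_off)
  show "\<exists>K. critical_matching kept S u K \<and> K \<subseteq> tight_edges" if "S \<in> kept" "u \<in> S" for S u
    using that by (rule kept_critical)
qed

section \<open>The next family inherits the invariant\<close>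

abbreviation "succ_family \<equiv> next_family E \<F> x D"

lemma next_family_iff: "S \<in> succ_family \<longleftrightarrow> S \<in> kept \<or>
  (\<exists>vs. is_cycle (supp E x) vs \<and> odd (length vs) \<and> S = cycle_hull kept vs)"
  unfolding next_family_def Let_def cycle_sets_def by auto

lemma next_family_cases [consumes 1, case_names kept hull]:
  assumes "S \<in> succ_family"
  obtains "S \<in> kept" | vs where "is_cycle (supp E x) vs" "odd (length vs)" "S = cycle_hull kept vs"
  using assms next_family_iff by blast

lemma next_family_laminar_odd: "laminar_odd_family V succ_family"
proof -
  \<comment> \<open>Against a hull only two relations occur: a kept set meeting it lies inside, and
    another hull meeting it is equal.\<close>
  have hull_lam: "A \<subseteq> B \<or> A \<inter> B = {}" if A: "A \<in> succ_family"
    and B: "is_cycle (supp E x) vs" "odd (length vs)" "B = cycle_hull kept vs" for A B vs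
    using A
  proof (cases rule: next_family_cases)
    case kept
    then show ?thesis using cs.hull_H[of A vs] B(3) by blast
  next
    case (hull ws)
    then show ?thesis using cs.hulls_disjoint[OF hull(1,2) B(1,2)] B(3) by blast
  qed
  have "A \<subseteq> B \<or> B \<subseteq> A \<or> A \<inter> B = {}" if A: "A \<in> succ_family" and B: "B \<in> succ_family" for A B
    using B
  proof (cases rule: next_family_cases)
    case kept
    note Bk = this
    show ?thesis using A
    proof (cases rule: next_family_cases)
      case kept
      then show ?thesis using Bk cs.H_laminar unfolding laminar_def by blast
    next
      case (hull ws)
      then show ?thesis using hull_lam[OF B hull] by blast
    qed
  next
    case (hull ws)
    then show ?thesis using hull_lam[OF A hull] by blast
  qed
  moreover have "S \<subseteq> V \<and> odd (card S)" if "S \<in> succ_family" for S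
    using that
  proof (cases rule: next_family_cases)
    case kept
    then show ?thesis using cs.H_subset cs.H_odd by blast
  next
    case (hull vs)
    then show ?thesis using cs.hull_subset cs.hull_card(1) by simp
  qed
  ultimately show ?thesis unfolding laminar_odd_family_def laminar_def by blast
qed

lemma next_family_card:
  assumes "S \<in> succ_family"
  shows "card S \<ge> 3"
  using assms
proof (cases rule: next_family_cases)
  case kept
  then show ?thesis using kept_subset F_card by blast
next
  case (hull vs)
  then show ?thesis using cs.hull_card(2) by simp
qed

lemma load_next_family: "load (singletons V \<union> succ_family) (D l) e = load idx (D l) e"
proof -
  have "finite succ_family"
    by (rule finite_subset[of _ "Pow V"])
      (use next_family_laminar_odd finite_V in \<open>auto simp: laminar_odd_family_def\<close>)
  then have fin: "finite (singletons V \<union> succ_family)" using finite_V by (simp add: finite_singletons)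
  have "load (singletons V \<union> succ_family) (D l) e = load (singletons V \<union> kept) (D l) e"
    by (rule load_mono_neutral[OF fin]) (use next_family_iff D_not_kept in auto)
  also have "\<dots> = load idx (D l) e"
    by (rule load_mono_neutral[OF finite_idx, symmetric]) (use kept_subset D_not_kept in auto)
  finally show ?thesis .
qed

text \<open>The only new set to be checked is S itself, and a matching inside S does not cross its
  cut.\<close>

lemma critical_matching_next:
  assumes "critical_matching kept S u K" "u \<in> S"
    and "\<And>T. T \<in> succ_family \<Longrightarrow> T \<notin> kept \<Longrightarrow> T \<subseteq> S \<Longrightarrow> T = S"
  shows "critical_matching succ_family S u K"
  unfolding critical_matching_def
proof (intro conjI ballI impI)
  show KS: "K \<subseteq> inside S" using critical_matchingD(1)[OF assms(1)] .
  fix T assume T: "T \<in> singletons S \<union> succ_family" "T \<subseteq> S"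
  show "card (K \<inter> edge_cut E T) = (if u \<in> T then 0 else 1)"
  proof (cases "T \<in> singletons S \<union> kept")
    case True
    then show ?thesis using critical_matchingD(2)[OF assms(1)] T(2) by blast
  next
    case False
    then have "T = S" using assms(3)[of T] T by blast
    then have "K \<inter> edge_cut E T = {}" using KS by (auto simp: inside_def edge_cut_iff)
    then show ?thesis using \<open>T = S\<close> assms(2) by simp
  qed
qed

lemma next_family_critical: "critical_family succ_family D"
  unfolding critical_family_def load_next_family
proof (intro conjI ballI)
  show "laminar_odd_family V succ_family" by (rule next_family_laminar_odd)
  show "3 \<le> card S" if "S \<in> succ_family" for S using that by (rule next_family_card)
  show "lex_nonneg m (\<lambda>l. D l S)" if "S \<in> succ_family" for S
  proof (cases "S \<in> kept")
    case True
    then show ?thesis using D_lex_nonneg kept_subset by blast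
  next
    case False
    have "S \<notin> singletons V" using next_family_card[OF that] unfolding singletons_def by force
    then have "D l S = 0" for l using D_not_kept False by simp
    then show ?thesis using lex_nonneg_zero by simp
  qed
  show "lex_nonneg m (\<lambda>l. lc l e - load idx (D l) e)" if "e \<in> inside S" for S e
    using slack_lex_nonneg that unfolding inside_def by simp
  show "\<exists>M. critical_matching succ_family S u M \<and> (\<forall>e\<in>M. \<forall>l\<le>m. load idx (D l) e = lc l e)"
    if S: "S \<in> succ_family" and u: "u \<in> S" for S u
  proof -
    have "\<exists>M. critical_matching kept S u M \<and> M \<subseteq> tight_edges \<and>
        (\<forall>T. T \<in> succ_family \<longrightarrow> T \<notin> kept \<longrightarrow> T \<subseteq> S \<longrightarrow> T = S)"
      using S
    proof (cases rule: next_family_cases)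
      case kept
      \<comment> \<open>A new set inside a kept set S is a hull meeting S, hence contains S.\<close>
      have "T = S" if T: "T \<in> succ_family" "T \<notin> kept" "T \<subseteq> S" for T
      proof -
        obtain vs where vs: "is_cycle (supp E x) vs" "T = cycle_hull kept vs"
          using T next_family_iff by blast
        have "T \<noteq> {}" using next_family_card[OF T(1)] by force
        then have "S \<subseteq> T" using cs.hull_H[OF kept, of vs] vs T(3) by blast
        then show ?thesis using T(3) by simp
      qed
      then show ?thesis using kept_critical[OF kept u] by blast
    next
      case (hull vs)
      have "T = S" if T: "T \<in> succ_family" "T \<notin> kept" "T \<subseteq> S" for T
      proof -
        obtain ws where ws: "is_cycle (supp E x) ws" "odd (length ws)" "T = cycle_hull kept ws"
          using T next_family_iff by blast
        have "T \<noteq> {}" using next_family_card[OF T(1)] by force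
        then show ?thesis using cs.hulls_disjoint[OF ws(1,2) hull(1,2)] ws(3) hull(3) T(3) by blast
      qed
      then show ?thesis using cs.hull_critical[OF hull(1,2)] u unfolding hull(3) by blast
    qed
    then obtain M where M: "critical_matching kept S u M" "M \<subseteq> tight_edges"
      "\<And>T. T \<in> succ_family \<Longrightarrow> T \<notin> kept \<Longrightarrow> T \<subseteq> S \<Longrightarrow> T = S" by blast
    have "critical_matching succ_family S u M" by (rule critical_matching_next[OF M(1) u M(3)])
    then show ?thesis using M(2) by blast
  qed
qed

text \<open>Weak duality with lexicographic terms: the cost difference splits into edge slacks times
  \<open>y\<close> and duals times cut excesses. New sets have zero dual, so \<open>D\<close>
  remains feasible for the next program.\<close>

lemma cost_difference_lex_nonneg:
  assumes y: "P_feasible V E succ_family y"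
  shows "lex_nonneg m (\<lambda>l. cost l y - cost l x)"
proof -
  let ?Y = "\<lambda>S. \<Sum>e\<in>edge_cut E S. y e"
  have diff: "cost l y - cost l x =
      (\<Sum>e\<in>E. (lc l e - load idx (D l) e) * y e) + (\<Sum>S\<in>idx. D l S * (?Y S - 1))" if "l \<le> m" for l
  proof -
    have "cost l x = (\<Sum>S\<in>idx. D l S)" using cost_tight[OF x_not_tight kept_cut that] by simp
    moreover have "cost l y = (\<Sum>e\<in>E. (lc l e - load idx (D l) e) * y e) + (\<Sum>e\<in>E. y e * load idx (D l) e)"
      unfolding cost_def sum.distrib[symmetric] by (intro sum.cong) (auto simp: algebra_simps)
    ultimately show ?thesis
      by (simp add: sum_load_cuts[OF finite_idx] right_diff_distrib sum_subtractf)
  qed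
  have "lex_nonneg m (\<lambda>l. (lc l e - load idx (D l) e) * y e)" if "e \<in> E" for e
    using slack_lex_nonneg[OF that] y that unfolding P_feasible_def by (intro lex_nonneg_scale) auto
  then have 1: "lex_nonneg m (\<lambda>l. \<Sum>e\<in>E. (lc l e - load idx (D l) e) * y e)"
    using finite_E by (intro lex_nonneg_sum) auto
  have "lex_nonneg m (\<lambda>l. D l S * (?Y S - 1))" if S: "S \<in> idx" for S
  proof -
    consider "S \<in> singletons V" | "S \<in> kept" | "S \<notin> singletons V \<union> kept" by blast
    then show ?thesis
    proof cases
      case 1
      then have "?Y S = 1" using y unfolding P_feasible_def singletons_def by auto
      then show ?thesis using lex_nonneg_zero by simp
    next
      case 2
      then have "?Y S \<ge> 1" using y next_family_iff unfolding P_feasible_def by blast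
      then show ?thesis using D_lex_nonneg 2 kept_subset by (intro lex_nonneg_scale) auto
    next
      case 3
      then show ?thesis using D_not_kept lex_nonneg_zero by simp
    qed
  qed
  then have "lex_nonneg m (\<lambda>l. \<Sum>S\<in>idx. D l S * (?Y S - 1))"
    using finite_idx by (intro lex_nonneg_sum) auto
  from lex_nonneg_add[OF 1 this] have
    "lex_nonneg m (\<lambda>l. (\<Sum>e\<in>E. (lc l e - load idx (D l) e) * y e) + (\<Sum>S\<in>idx. D l S * (?Y S - 1)))" .
  then show ?thesis using lex_nonneg_cong[OF diff] by simp
qed

lemma x_infeasible_next:
  assumes "\<not> integral_vector E x"
  shows "\<not> P_feasible V E succ_family x"
proof
  assume "P_feasible V E succ_family x"
  obtain vs where vs: "is_cycle (supp E x) vs" "odd (length vs)" using cs.odd_cycle_exists[OF assms] by blast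
  then have "cycle_hull kept vs \<in> succ_family" using next_family_iff by blast
  then have "1 \<le> (\<Sum>e\<in>edge_cut E (cycle_hull kept vs). x e)"
    using \<open>P_feasible V E succ_family x\<close> unfolding P_feasible_def by blast
  then show False using cs.hull_cut_zero[OF vs] by simp
qed

end

section \<open>The potential function and the invariant of the transition system\<close>

context cpm_instance
begin

definition lex_less :: "('v set \<Rightarrow> real) \<Rightarrow> ('v set \<Rightarrow> real) \<Rightarrow> bool" where
  "lex_less x y \<longleftrightarrow> (\<exists>i\<le>m. (\<forall>l<i. cost l x = cost l y) \<and> cost i x < cost i y)"

lemma lex_less_irrefl: "\<not> lex_less x x"
  unfolding lex_less_def by simp

lemma lex_less_trans:
  assumes "lex_less x y" "lex_less y z"
  shows "lex_less x z"
proof -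
  obtain i where i: "i \<le> m" "\<forall>l<i. cost l x = cost l y" "cost i x < cost i y"
    using assms(1) unfolding lex_less_def by blast
  obtain j where j: "j \<le> m" "\<forall>l<j. cost l y = cost l z" "cost j y < cost j z"
    using assms(2) unfolding lex_less_def by blast
  have "\<forall>l<min i j. cost l x = cost l z" using i j by simp
  moreover have "cost (min i j) x < cost (min i j) z"
    using i j by (cases i j rule: linorder_cases) (auto simp: min_def)
  ultimately show ?thesis unfolding lex_less_def using i(1) by (intro exI[of _ "min i j"]) auto
qed

lemma lex_nonneg_imp_less:
  assumes "lex_nonneg m (\<lambda>l. cost l y - cost l x)" "x \<noteq> y"
    "\<And>e. e \<notin> E \<Longrightarrow> x e = 0" "\<And>e. e \<notin> E \<Longrightarrow> y e = 0"
  shows "lex_less x y"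
proof -
  have ex: "\<exists>l. l \<le> m \<and> cost l x \<noteq> cost l y" using equal_costs_imp_equal assms(2-4) by blast
  define i where "i = (LEAST l. l \<le> m \<and> cost l x \<noteq> cost l y)"
  have i: "i \<le> m" "cost i x \<noteq> cost i y" unfolding i_def using LeastI_ex[OF ex] by blast+
  have less: "cost l x = cost l y" if "l < i" for l
    using not_less_Least[OF that[unfolded i_def]] that i(1) by auto
  then have "cost i y - cost i x \<ge> 0" using lex_nonnegD[OF assms(1) i(1)] by simp
  then show ?thesis unfolding lex_less_def using i less by (intro exI[of _ i]) auto
qed

text \<open>Unspecified for families without an optimum; \<open>rank\<close> only relies on
  \<open>lex_less\<close> being irreflexive and transitive.\<close>

definition opt :: "'v set set \<Rightarrow> 'v set \<Rightarrow> real" where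
  "opt \<F> = (THE x. lex_min_optimal V E c \<sigma> \<F> x)"

lemma opt_eq: "lex_min_optimal V E c \<sigma> \<F> x \<Longrightarrow> opt \<F> = x"
  unfolding opt_def using lex_min_optimal_unique by blast

definition rank :: "'v set set \<Rightarrow> nat" where
  "rank \<F> = card {\<G>. \<G> \<subseteq> Pow V \<and> lex_less (opt \<F>) (opt \<G>)}"

lemma rank_decreases:
  assumes "\<G> \<subseteq> Pow V" "lex_less (opt \<F>) (opt \<G>)"
  shows "rank \<G> < rank \<F>"
  unfolding rank_def
proof (rule psubset_card_mono)
  show "finite {\<G>. \<G> \<subseteq> Pow V \<and> lex_less (opt \<F>) (opt \<G>)}"
    by (rule finite_subset[of _ "Pow (Pow V)"]) (use finite_V in auto)
  show "{\<H>. \<H> \<subseteq> Pow V \<and> lex_less (opt \<G>) (opt \<H>)} \<subset> {\<H>. \<H> \<subseteq> Pow V \<and> lex_less (opt \<F>) (opt \<H>)}"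
  proof (rule psubsetI)
    show "{\<H>. \<H> \<subseteq> Pow V \<and> lex_less (opt \<G>) (opt \<H>)} \<subseteq> {\<H>. \<H> \<subseteq> Pow V \<and> lex_less (opt \<F>) (opt \<H>)}"
      using lex_less_trans[OF assms(2)] by auto
    have "\<G> \<in> {\<H>. \<H> \<subseteq> Pow V \<and> lex_less (opt \<F>) (opt \<H>)}"
      "\<G> \<notin> {\<H>. \<H> \<subseteq> Pow V \<and> lex_less (opt \<G>) (opt \<H>)}"
      using assms lex_less_irrefl by auto
    then show "{\<H>. \<H> \<subseteq> Pow V \<and> lex_less (opt \<G>) (opt \<H>)} \<noteq> {\<H>. \<H> \<subseteq> Pow V \<and> lex_less (opt \<F>) (opt \<H>)}"
      by metis
  qed
qed

text \<open>Within an iteration the offset falls from m+3 to 1, its value at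
  \<open>i = Suc m\<close>, so returning also decreases the measure. The factor m+4 exceeds every
  offset, so a drop in \<open>rank\<close> pays for restarting the loop.\<close>

fun config_measure :: "'v config \<Rightarrow> nat" where
  "config_measure (Outer \<F> \<Gamma>) = rank \<F> * (m + 4) + (m + 3)"
| "config_measure (Inner \<F> \<Gamma> x i L M N Q D) = rank \<F> * (m + 4) + (m + 2 - i)"
| "config_measure (Returned x) = 0"

text \<open>The vectors \<open>r\<close> are not stored in a configuration, hence the existential
  quantifier over their history \<open>R\<close>.\<close>

fun config_ok :: "'v config \<Rightarrow> bool" where
  "config_ok (Outer \<F> \<Gamma>) \<longleftrightarrow> critical_family \<F> \<Gamma>"
| "config_ok (Inner \<F> \<Gamma> x i L M N Q D) \<longleftrightarrow> critical_family \<F> \<Gamma> \<and>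
     lex_min_optimal V E c \<sigma> \<F> x \<and> i \<le> Suc m \<and> (\<exists>R. dual_phase \<F> \<Gamma> x i L M N Q D R)"
| "config_ok (Returned x) \<longleftrightarrow> (\<exists>A. min_cost_perfect_matching V E c A \<and> x = incidence_vector A)"

lemma integral_optimum:
  assumes F: "laminar_odd_family V \<F>" and lex: "lex_min_optimal V E c \<sigma> \<F> x"
    and int: "integral_vector E x"
  shows "\<exists>A. min_cost_perfect_matching V E c A \<and> x = incidence_vector A"
proof -
  note feas = lex_min_optimal_feasible[OF lex]
  define A where "A = {e \<in> E. x e = 1}"
  have x01: "x e = 0 \<or> x e = 1" if "e \<in> E" for e
  proof -
    have "x e \<in> \<int>" using int that unfolding integral_vector_def by blast
    then obtain k :: int where k: "x e = of_int k" by (rule Ints_cases)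
    then have "0 \<le> k" "k \<le> 1" using P_feasible_le_1[OF feas, of e] by simp_all
    then have "k = 0 \<or> k = 1" by auto
    then show ?thesis using k by auto
  qed
  have xA: "x = incidence_vector A"
  proof
    fix e
    show "x e = incidence_vector A e"
      using x01[of e] feas unfolding incidence_vector_def A_def P_feasible_def by (cases "e \<in> E") auto
  qed
  have AE: "A \<subseteq> E" unfolding A_def by auto
  have "\<exists>!e. e \<in> A \<and> v \<in> e" if "v \<in> V" for v
  proof -
    have "real (card (A \<inter> edge_cut E {v})) = 1"
      using feas that sum_incidence_vector[OF edge_cut_subset, of A "{v}"] unfolding P_feasible_def xA by auto
    then have "card (A \<inter> edge_cut E {v}) = 1" by simp
    moreover have "A \<inter> edge_cut E {v} = {e. e \<in> A \<and> v \<in> e}" using AE by (auto simp: edge_cut_singleton)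
    ultimately obtain f where "{e. e \<in> A \<and> v \<in> e} = {f}" using card_1_singletonE by metis
    then have "e \<in> A \<and> v \<in> e \<longleftrightarrow> e = f" for e by (metis mem_Collect_eq singleton_iff)
    then show ?thesis by simp
  qed
  then have pm: "perfect_matching V E A" unfolding perfect_matching_def using AE by simp
  have cost_inc: "cost 0 (incidence_vector B) = of_int (\<Sum>e\<in>B. c e)" if "B \<subseteq> E" for B
  proof -
    have "cost 0 (incidence_vector B) = (\<Sum>e\<in>E. if e \<in> B then of_int (c e) else 0)"
      unfolding cost_0 incidence_vector_def by (intro sum.cong) auto
    also have "\<dots> = (\<Sum>e\<in>E \<inter> B. of_int (c e))" using finite_E by (simp add: sum.inter_restrict)
    also have "E \<inter> B = B" using that by auto
    finally show ?thesis by simp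
  qed
  have "(\<Sum>e\<in>A. c e) \<le> (\<Sum>e\<in>B. c e)" if B: "perfect_matching V E B" for B
  proof -
    have "cost 0 x \<le> cost 0 (incidence_vector B)"
      by (rule lex_min_optimalD[OF lex incidence_vector_feasible[OF B F]]) auto
    moreover have "B \<subseteq> E" using B unfolding perfect_matching_def by simp
    ultimately have "real_of_int (\<Sum>e\<in>A. c e) \<le> real_of_int (\<Sum>e\<in>B. c e)"
      unfolding xA by (simp only: cost_inc AE)
    then show ?thesis by (simp only: of_int_le_iff)
  qed
  then have "min_cost_perfect_matching V E c A"
    unfolding min_cost_perfect_matching_def is_arg_min_linorder using pm by simp
  then show ?thesis using xA by blast
qed

lemma critical_family_laminar_odd: "critical_family \<F> \<Gamma> \<Longrightarrow> laminar_odd_family V \<F>"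
  unfolding critical_family_def by blast

lemma cpm_step_ok:
  assumes "cpm_step V E c \<sigma> s t" "config_ok s"
  shows "config_ok t \<and> config_measure t < config_measure s"
  using assms
proof (induction rule: cpm_step.induct)
  case (solve_primal \<F> x \<Gamma>)
  then show ?case using dual_phase_init by auto
next
  case (solve_dual i \<F> x \<Gamma> L M N Q r \<Pi> L' M' N' Q' D' D)
  then obtain R where "critical_family \<F> \<Gamma>" "lex_min_optimal V E c \<sigma> \<F> x" "dual_phase \<F> \<Gamma> x i L M N Q D R"
    by auto
  moreover from this have "dual_phase \<F> \<Gamma> x (Suc i) L' M' N' Q' D' (R(i := r))"
    using dual_phase_step[OF critical_family_finite \<open>dual_phase \<F> \<Gamma> x i L M N Q D R\<close> solve_dual(2-7)]
    by blast
  ultimately show ?case using solve_dual(1) by auto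
next
  case (repeat_loop i x \<F> \<Gamma> L M N Q D)
  then obtain R where ok: "critical_family \<F> \<Gamma>" "lex_min_optimal V E c \<sigma> \<F> x"
    "dual_phase \<F> \<Gamma> x (Suc m) L M N Q D R" and i: "i = Suc m"
    by (auto simp: le_Suc_eq)
  interpret dual_phase_done V E c \<sigma> \<F> \<Gamma> D R x L M N Q
    by unfold_locales (use ok in auto)
  let ?G = "next_family E \<F> x D"
  have lo: "laminar_odd_family V ?G" by (rule next_family_laminar_odd)
  obtain y where y: "lex_min_optimal V E c \<sigma> ?G y" using lex_min_optimal_exists[OF lo] by blast
  note yf = lex_min_optimal_feasible[OF y]
  have "lex_less x y"
  proof (rule lex_nonneg_imp_less[OF cost_difference_lex_nonneg[OF yf]])
    show "x \<noteq> y" using x_infeasible_next[OF repeat_loop(2)] yf by blast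
    show "y e = 0" if "e \<notin> E" for e using yf that unfolding P_feasible_def by blast
  qed (rule x_off)
  then have "lex_less (opt \<F>) (opt ?G)" using opt_eq[OF ok(2)] opt_eq[OF y] by simp
  moreover have "?G \<subseteq> Pow V" using lo unfolding laminar_odd_family_def by auto
  ultimately have "rank ?G < rank \<F>" by (intro rank_decreases)
  then have "Suc (rank ?G) * (m + 4) \<le> rank \<F> * (m + 4)" by (intro mult_le_mono1) simp
  then have "config_measure (Outer ?G D) < config_measure (Inner \<F> \<Gamma> x i L M N Q D)"
    unfolding i by (simp add: algebra_simps)
  then show ?case using next_family_critical by simp
next
  case (return_solution i x \<F> \<Gamma> L M N Q D)
  then have "i = Suc m" by (auto simp: le_Suc_eq)
  then show ?case
    using integral_optimum[OF critical_family_laminar_odd _ return_solution(2)] return_solution(3) by auto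
qed

text \<open>Excludes dead ends: existence of the primal optimum and of every dual optimum ensures
  that only returning stops a run.\<close>

lemma config_ok_progress:
  assumes "config_ok s" "\<nexists>t. cpm_step V E c \<sigma> s t"
  shows "\<exists>x. s = Returned x"
proof (cases s)
  case (Outer \<F> \<Gamma>)
  then have "laminar_odd_family V \<F>" using assms(1) critical_family_laminar_odd by auto
  then show ?thesis using lex_min_optimal_exists cpm_step.solve_primal assms(2) Outer by blast
next
  case (Inner \<F> \<Gamma> x i L M N Q D)
  then obtain R where ok: "critical_family \<F> \<Gamma>" "lex_min_optimal V E c \<sigma> \<F> x" "i \<le> Suc m"
    "dual_phase \<F> \<Gamma> x i L M N Q D R" using assms(1) by auto
  show ?thesis
  proof (cases "i \<le> m")
    case True
    have "card S \<noteq> 1" if "S \<in> \<F>" for S using ok(1) that unfolding critical_family_def by force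
    then obtain r \<Pi> where "D_optimal V E \<F> x (lc i) (\<Gamma> i) L M N Q (r, \<Pi>)"
      using dual_phase_progress[OF critical_family_finite[OF ok(1)] _ ok(2) True ok(4)] by blast
    then show ?thesis using cpm_step.solve_dual[OF True] assms(2) Inner by blast
  next
    case False
    then have "i > m" by simp
    then show ?thesis
      using cpm_step.repeat_loop[of E i x V c \<sigma> \<F> \<Gamma> L M N Q D]
        cpm_step.return_solution[of E i x V c \<sigma> \<F> \<Gamma> L M N Q D] assms(2) Inner by blast
  qed
next
  case (Returned x)
  then show ?thesis by simp
qed

lemma config_ok_init: "config_ok cpm_init"
  unfolding cpm_init_def using critical_family_init by simp

lemma terminates: "cpm_terminates V E c \<sigma>"
  unfolding cpm_terminates_def
proof
  assume "\<exists>s :: nat \<Rightarrow> 'v config. s 0 = cpm_init \<and> (\<forall>k. cpm_step V E c \<sigma> (s k) (s (Suc k)))"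
  then obtain s :: "nat \<Rightarrow> 'v config" where s: "s 0 = cpm_init" "\<And>k. cpm_step V E c \<sigma> (s k) (s (Suc k))"
    by blast
  have ok: "config_ok (s k)" for k
    by (induction k) (use s config_ok_init cpm_step_ok in auto)
  have "config_measure (s k) + k \<le> config_measure (s 0)" for k
  proof (induction k)
    case (Suc k)
    then show ?case using cpm_step_ok[OF s(2)[of k] ok] by simp
  qed simp
  from this[of "Suc (config_measure (s 0))"] show False by simp
qed

lemma halts_correctly:
  assumes "cpm_halts_in V E c \<sigma> s"
  shows "\<exists>A. min_cost_perfect_matching V E c A \<and> s = Returned (incidence_vector A)"
proof -
  have steps: "(cpm_step V E c \<sigma>)\<^sup>*\<^sup>* cpm_init s" and halt: "\<nexists>t. cpm_step V E c \<sigma> s t"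
    using assms unfolding cpm_halts_in_def by blast+
  from steps have "config_ok s"
    by (induction rule: rtranclp_induct) (use config_ok_init cpm_step_ok in auto)
  moreover from config_ok_progress[OF this halt] obtain x where "s = Returned x" by blast
  ultimately show ?thesis by auto
qed

end

theorem theorem1:
  fixes V :: "'v set" and E :: "'v set set"
    and c :: "'v set \<Rightarrow> int" and \<sigma> :: "'v set \<Rightarrow> nat"
  assumes "simple_graph V E"
    and "\<exists>A. perfect_matching V E A"
    and "bij_betw \<sigma> E {1..card E}"
  shows "cpm_terminates V E c \<sigma> \<and>
    (\<forall>s. cpm_halts_in V E c \<sigma> s \<longrightarrow>
      (\<exists>A. min_cost_perfect_matching V E c A \<and> s = Returned (incidence_vector A)))"
proof -
  interpret cpm_instance V E c \<sigma> by unfold_locales (use assms in auto)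
  show ?thesis using terminates halts_correctly by blast
qed

end
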